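(* Let $\omega_0=(\tfrac13,\tfrac12)$ and let $\underline{\mathcal S}$ be the complex vector space of 9-tuples $(F_1,\dots,F_9)$, where $F_i$ is a germ of holomorphic function of one complex variable at $U_i(\omega_0)$, such that $\sum_{i=1}^9 F_i(U_i)=0$ as a germ of holomorphic function at $\omega_0$ in $\mathbb C^2$. Let $\mathbf C_1,\dots,\mathbf C_8$ be a basis of the space of constant solutions $\{(c_1,\dots,c_9)\in\mathbb C^9:\ \sum_i c_i=0\}$, and let $\mathbf F_1,\dots,\mathbf F_{28}$ be the 28 explicit 9-tuples of functions listed in the context (each component being taken as a germ at the corresponding point $U_i(\omega_0)$). Then the family $\mathbf\Gamma=\{\mathbf C_1,\dots,\mathbf C_8,\mathbf F_1,\dots,\mathbf F_{28}\}$ is a basis of $\underline{\mathcal S}$ over $\mathbb C$. In particular $\dim_{\mathbb C}\underline{\mathcal S}=36$.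
   Context: The functions $U_i$ are $$U_1=x,\quad U_2=y,\quad U_3=\frac{x}{y},\quad U_4=\frac{1-y}{1-x},\quad U_5=\frac{x(1-y)}{y(1-x)},\quad U_6=xy,$$ $$U_7=\frac{x(1-y)}{x-1},\quad U_8=\frac{1-y}{y(x-1)},\quad U_9=\frac{x(1-y)^2}{y(1-x)^2}.$$ All one-variable functions below are holomorphic functions on the simply connected domain $\Omega=\mathbb C\setminus\bigl(\{-it: t\ge 0\}\cup\{1+it:t\ge 0\}\bigr)$, obtained by analytic continuation on $\Omega$ from their usual definition on the real interval $]0,1[$. The symbol $z$ denotes the variable (the identity function), $\mathrm{Log}$ the logarithm, and $\mathrm{Li}_n(z)=\sum_{k\ge1}z^k/k^n$ (near $0$) the $n$-th polylogarithm. Set - $a(z)=\operatorname{arctanh}(\sqrt z)$, - $d(z)=\mathrm{Li}_2(z)+\tfrac12\mathrm{Log}(z)\mathrm{Log}(1-z)-\tfrac{\pi^2}{6}$, - $g(z)=\mathrm{Li}_3(z)-\mathrm{Log}(z)\,\mathrm{Li}_2(z)-\tfrac13\mathrm{Log}^2(z)\,\mathrm{Log}(1-z)-\tfrac29\mathrm{Li}_3(1)$, - $h(z)=2\,\mathrm{Log}(z)\,\mathrm{Li}_2(z)+\mathrm{Log}^2(z)\,\mathrm{Log}(1-z)$, - $\tilde g(z)=g(z)-\tfrac{i\pi}{3}\mathrm{Li}_2(z)+\tfrac{4i\pi}{3}d(z)+\tfrac{\pi^2}{3}\mathrm{Log}(1-z)+\tfrac{2i\pi^3}{9}$, - $\tilde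 h(z)=h(z)+2i\pi\,\mathrm{Li}_2(z)-4i\pi\, d(z)-\pi^2\,\mathrm{Log}(1-z)-\tfrac{2i\pi^3}{3}$. The 9-tuples are (each entry being a function of its own variable $z$; the $i$-th entry is to be composed with $U_i$): $\mathbf F_1=(\mathrm{Log}\,z,\,-\mathrm{Log}\,z,\,-\mathrm{Log}\,z,0,0,0,0,0,0)$ $\mathbf F_2=(\mathrm{Log}\tfrac{z}{1-z},\,0,\,\mathrm{Log}\tfrac{1-z}{z},\,-\mathrm{Log}(1-z),0,0,0,0,0)$ $\mathbf F_3=(\mathrm{Log}(1-z),\,-\mathrm{Log}(1-z),\,0,\,\mathrm{Log}\,z,0,0,0,0,0)$ $\mathbf F_4=(0,0,\mathrm{Log}\,z,\mathrm{Log}\,z,-\mathrm{Log}\,z,0,0,0,0)$ $\mathbf F_5=(\mathrm{Log}(1-z),0,-\mathrm{Log}(1-z),0,\mathrm{Log}(1-z),0,0,0,0)$ $\mathbf F_6=(\mathrm{Log}\,z,\mathrm{Log}\,z,0,0,0,-\mathrm{Log}\,z,0,0,0)$ $\mathbf F_7=(\mathrm{Log}\,z,0,0,\mathrm{Log}\,z,0,0,-\mathrm{Log}\,z+i\pi,0,0)$ $\mathbf F_8=(\tfrac1z,0,0,0,\tfrac1z,0,\tfrac1z-1,0,0)$ $\mathbf F_9=(\mathrm{Log}(1-z),0,0,0,0,-\mathrm{Log}(1-z),\mathrm{Log}(1-z),0,0)$ $\mathbf F_{10}=(0,z,0,z,0,0,z-1,0,0)$ $\mathbf F_{11}=(0,0,0,0,0,\mathrm{Log}\,z,-\mathrm{Log}\,z,\mathrm{Log}\,z,0)$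 $\mathbf F_{12}=(0,\mathrm{Log}\,z,0,0,0,0,-\mathrm{Log}(1-z),\mathrm{Log}(1-z),0)$ $\mathbf F_{13}=(0,0,0,0,0,0,\mathrm{Log}\,z,\mathrm{Log}\,z,-\mathrm{Log}\,z-2i\pi)$ [i.e. the last entry is the function $z\mapsto -\mathrm{Log}(z)-2i\pi$] $\mathbf F_{14}=(0,0,0,0,\mathrm{Log}(1-z),0,\mathrm{Log}(1-z),0,-\mathrm{Log}(1-z))$ $\mathbf F_{15}=(0,\tfrac1z,0,0,z,0,0,z-1,0)$ $\mathbf F_{16}=(z,0,0,\tfrac1z,0,0,0,\tfrac1z-1,0)$ $\mathbf F_{17}=(0,0,a(z),0,0,-a(z),0,0,-a(z))$ $\mathbf F_{18}=(2\mathrm{Log}^2z,\,2\mathrm{Log}^2z,\,-\mathrm{Log}^2z,0,0,-\mathrm{Log}^2z,0,0,0)$ $\mathbf F_{19}=(0,0,0,0,0,\mathrm{Log}^2z,\,-2\mathrm{Log}^2z,\,-2\mathrm{Log}^2z,\,\mathrm{Log}^2z+4i\pi\,\mathrm{Log}\,z-4\pi^2)$ $\mathbf F_{20}=(0,0,\mathrm{Log}^2z,\,-2\mathrm{Log}^2z,\,-2\mathrm{Log}^2z,0,0,0,\mathrm{Log}^2z)$ $\mathbf F_{21}=(d(z),-d(z),-d(z),-d(z),d(z),0,0,0,0)$ $\mathbf F_{22}=(d(z),\,d(z)-\tfrac{i\pi}{2}\mathrm{Log}\,z,0,0,0,-d(z),d(z),-d(z),0)$ $\mathbf F_{23}=(\pi^2,0,0,\,d(z)-\tfrac{i\pi}{2}\mathrm{Log}\,z,\,d(z),0,d(z),\,d(z)+\tfrac{i\pi}{2}\mathrm{Log}\,z-i\pi\,\mathrm{Log}(1-z),\,-d(z))$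 $\mathbf F_{24}=(\mathrm{Li}_2(z),\mathrm{Li}_2(z),0,\tfrac12\mathrm{Log}^2z,0,-\mathrm{Li}_2(z),\mathrm{Li}_2(z),\,-\mathrm{Li}_2(z)-\tfrac12\mathrm{Log}^2z+i\pi\,\mathrm{Log}\,z,\,\tfrac{\pi^2}{3})$ $\mathbf F_{25}=(0,\tfrac12\mathrm{Log}^2z,0,\mathrm{Li}_2(z),\mathrm{Li}_2(z),0,\mathrm{Li}_2(z),\mathrm{Li}_2(z),-\mathrm{Li}_2(z))$ $\mathbf F_{26}=(2\mathrm{Li}_2(z),0,-\mathrm{Li}_2(z),0,2\mathrm{Li}_2(z),-\mathrm{Li}_2(z),2\mathrm{Li}_2(z),0,-\mathrm{Li}_2(z))$ $\mathbf F_{27}=(2g,\,2g,\,-g,\,2g,\,2g,\,-g,\,2\tilde g,\,2\tilde g,\,-g)$ $\mathbf F_{28}=(2h,\ 2h-\tfrac{2\pi^2}{3}\mathrm{Log}\,z,\ -h,\ 2h,\ 2h,\ -h,\ 2\tilde h,\ 2\tilde h,\ -h)$ *)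

theory Defs
  imports "HOL-Complex_Analysis.Complex_Analysis"
begin

no_notation fps_nth (infixl \<open>$\<close> 75)

section \<open>Functions on the slit plane\<close>

definition Omega :: "complex set" where
  "Omega = UNIV - ({- (\<i> * of_real t) | t::real. t \<ge> 0} \<union> {1 + \<i> * of_real t | t::real. t \<ge> 0})"

lemma Omega_iff:
  "z \<in> Omega \<longleftrightarrow> \<not> (Re z = 0 \<and> Im z \<le> 0) \<and> \<not> (Re z = 1 \<and> Im z \<ge> 0)"
proof -
  have "(\<exists>t\<ge>0. z = - (\<i> * of_real t)) \<longleftrightarrow> Re z = 0 \<and> Im z \<le> 0"
    by (auto simp: complex_eq_iff intro: exI[of _ "- Im z"])
  moreover have "(\<exists>t\<ge>0. z = 1 + \<i> * of_real t) \<longleftrightarrow> Re z = 1 \<and> Im z \<ge> 0"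
    by (auto simp: complex_eq_iff intro: exI[of _ "Im z"])
  ultimately show ?thesis
    by (auto simp: Omega_def)
qed

definition Omega_left :: "complex set" where
  "Omega_left = {z. Re z < 1 \<and> \<not> (Re z = 0 \<and> Im z \<le> 0)}"

definition Omega_right :: "complex set" where
  "Omega_right = {z. Re z > 0 \<and> \<not> (Re z = 1 \<and> Im z \<ge> 0)}"

lemma Omega_eq: "Omega = Omega_left \<union> Omega_right"
  by (auto simp: Omega_iff Omega_left_def Omega_right_def)

lemma open_Omega_left: "open Omega_left"
proof -
  have eq: "Omega_left = {z. Re z < 1} \<inter> ({z. Re z < 0} \<union> {z. Re z > 0} \<union> {z. Im z > 0})"
    by (auto simp: Omega_left_def)
  show ?thesis
    unfolding eq by (intro open_Int open_Un open_halfspace_Re_lt open_halfspace_Re_gt open_halfspace_Im_gt)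
qed

lemma open_Omega_right: "open Omega_right"
proof -
  have eq: "Omega_right = {z. Re z > 0} \<inter> ({z. Re z < 1} \<union> {z. Re z > 1} \<union> {z. Im z < 0})"
    by (auto simp: Omega_right_def)
  show ?thesis
    unfolding eq by (intro open_Int open_Un open_halfspace_Re_lt open_halfspace_Re_gt open_halfspace_Im_lt)
qed

lemma open_Omega: "open Omega"
  by (simp add: Omega_eq open_Un open_Omega_left open_Omega_right)

lemma starlike_Omega_left: "starlike Omega_left"
  unfolding starlike_def
proof (intro bexI ballI subsetI)
  show "\<i> \<in> Omega_left"
    by (simp add: Omega_left_def)
  fix x w assume x: "x \<in> Omega_left" and "w \<in> closed_segment \<i> x"
  then obtain u where u: "0 \<le> u" "u \<le> 1" and w: "w = (1 - u) *\<^sub>R \<i> + u *\<^sub>R x"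
    by (auto simp: closed_segment_def)
  have "u * Re x < 1"
  proof (cases "u = 0")
    case False
    then have "u * Re x < u * 1"
      using u x by (intro mult_strict_left_mono) (auto simp: Omega_left_def)
    then show ?thesis
      using u by simp
  qed simp
  moreover have "Im w > 0" if "Re w = 0"
  proof (cases "u = 0")
    case False
    then have "Im x > 0"
      using that x w by (auto simp: Omega_left_def)
    then have "u * Im x > 0" and "1 - u \<ge> 0"
      using u False by auto
    then show ?thesis
      using w by simp
  qed (use w in simp)
  ultimately show "w \<in> Omega_left"
    using w by (auto simp: Omega_left_def)
qed

lemma Omega_right_reflect: "z \<in> Omega_right \<longleftrightarrow> 1 - z \<in> Omega_left"
  by (auto simp: Omega_left_def Omega_right_def)

lemma starlike_Omega_right: "starlike Omega_right"
proof -
  obtain a where a: "a \<in> Omega_left" and seg: "\<And>x. x \<in> Omega_left \<Longrightarrow> closed_segment a x \<subseteq> Omega_left"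
    using starlike_Omega_left by (auto simp: starlike_def)
  show ?thesis
    unfolding starlike_def
  proof (intro bexI ballI subsetI)
    show "1 - a \<in> Omega_right"
      using a by (simp add: Omega_right_reflect)
    fix x w assume x: "x \<in> Omega_right" and "w \<in> closed_segment (1 - a) x"
    then obtain u where u: "0 \<le> u" "u \<le> 1" and w: "w = (1 - u) *\<^sub>R (1 - a) + u *\<^sub>R x"
      by (auto simp: closed_segment_def)
    have "1 - w = (1 - u) *\<^sub>R a + u *\<^sub>R (1 - x)"
      unfolding w by (simp add: algebra_simps scaleR_conv_of_real)
    then have "1 - w \<in> closed_segment a (1 - x)"
      using u by (auto simp: closed_segment_def)
    then show "w \<in> Omega_right"
      using seg[of "1 - x"] x by (auto simp: Omega_right_reflect)
  qed
qed

lemma Omega_strip: "Omega_left \<inter> Omega_right = {z. 0 < Re z \<and> Re z < 1}"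
  by (auto simp: Omega_left_def Omega_right_def)

lemma half_in_Omega: "of_real (1/2) \<in> Omega_left" "of_real (1/2) \<in> Omega_right"
  by (auto simp: Omega_left_def Omega_right_def)

lemma connected_Omega: "connected Omega"
  unfolding Omega_eq
  using starlike_Omega_left starlike_Omega_right half_in_Omega
  by (intro connected_Un starlike_imp_connected) auto

lemma real_in_Omega: "0 < x \<Longrightarrow> x < 1 \<Longrightarrow> complex_of_real x \<in> Omega"
  by (simp add: Omega_iff)

lemma primitive_Omega:
  assumes "f holomorphic_on Omega"
  shows "\<exists>g. \<forall>z\<in>Omega. (g has_field_derivative f z) (at z)"
proof -
  have diff: "f field_differentiable at z" if "z \<in> Omega" for z
    using assms that open_Omega holomorphic_on_imp_differentiable_at by blast
  obtain g where g: "\<And>z. z \<in> Omega_left \<Longrightarrow> (g has_field_derivative f z) (at z)"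
    using holomorphic_starlike_primitive[OF _ starlike_Omega_left open_Omega_left finite.emptyI, of f]
      diff holomorphic_on_imp_continuous_on[OF holomorphic_on_subset[OF assms]]
    by (auto simp: Omega_eq)
  obtain h where h: "\<And>z. z \<in> Omega_right \<Longrightarrow> (h has_field_derivative f z) (at z)"
    using holomorphic_starlike_primitive[OF _ starlike_Omega_right open_Omega_right finite.emptyI, of f]
      diff holomorphic_on_imp_continuous_on[OF holomorphic_on_subset[OF assms]]
    by (auto simp: Omega_eq)
  have "convex (Omega_left \<inter> Omega_right)"
    unfolding Omega_strip Collect_conj_eq
    by (intro convex_Int convex_halfspace_Re_gt convex_halfspace_Re_lt)
  moreover have "((\<lambda>z. g z - h z) has_field_derivative 0) (at z within Omega_left \<inter> Omega_right)"
    if "z \<in> Omega_left \<inter> Omega_right" for z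
    using DERIV_diff[OF g h, of z] that by (auto intro: has_field_derivative_at_within)
  ultimately obtain c where c: "\<And>z. z \<in> Omega_left \<inter> Omega_right \<Longrightarrow> g z - h z = c"
    using has_field_derivative_zero_constant by metis
  define k where "k = (\<lambda>z. if z \<in> Omega_left then g z else h z + c)"
  have "(k has_field_derivative f z) (at z)" if "z \<in> Omega" for z
  proof (cases "z \<in> Omega_left")
    case True
    then show ?thesis
      by (rule has_field_derivative_transform_within_open[OF g open_Omega_left])
        (use True in \<open>auto simp: k_def\<close>)
  next
    case False
    then have z: "z \<in> Omega_right"
      using that by (simp add: Omega_eq)
    have "((\<lambda>z. h z + c) has_field_derivative f z) (at z)"
      using DERIV_add[OF h[OF z] DERIV_const[of c]] by simp
    then show ?thesis
      by (rule has_field_derivative_transform_within_open[OF _ open_Omega_right z])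
        (use c in \<open>fastforce simp: k_def algebra_simps\<close>)
  qed
  then show ?thesis
    by blast
qed

text \<open>The holomorphic function on \<^term>\<open>Omega\<close> that continues a real function given on the
  interval from 0 to 1. It is unique on \<^term>\<open>Omega\<close> when it exists (\<open>continuation_unique\<close>
  below), and its values outside \<^term>\<open>Omega\<close> are irrelevant.\<close>

definition continues :: "(complex \<Rightarrow> complex) \<Rightarrow> (real \<Rightarrow> real) \<Rightarrow> bool" where
  "continues g f \<longleftrightarrow> g holomorphic_on Omega \<and> (\<forall>x\<in>{0<..<1}. g (of_real x) = of_real (f x))"

definition continuation :: "(real \<Rightarrow> real) \<Rightarrow> complex \<Rightarrow> complex" where
  "continuation f = (SOME g. continues g f)"

lemma continuation_unique:
  assumes "continues g f" and "continues h f" and "z \<in> Omega"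
  shows "g z = h z"
proof -
  have "g z - h z = 0"
  proof (rule analytic_continuation[of "\<lambda>z. g z - h z" Omega "of_real ` {0<..<1}" "of_real (1/2)"])
    show "complex_of_real (1/2) islimpt of_real ` {0<..<1}"
      unfolding islimpt_approachable
    proof (intro allI impI)
      fix e :: real assume e: "e > 0"
      define x where "x = 1/2 + min (e/2) (1/4)"
      have x: "x \<in> {0<..<1}" and "x \<noteq> 1/2" and "\<bar>x - 1/2\<bar> < e"
        using e by (auto simp: x_def)
      moreover from this have "complex_of_real x \<noteq> of_real (1/2)"
        by (simp only: of_real_eq_iff not_False_eq_True)
      moreover have "dist (complex_of_real x) (of_real (1/2)) = \<bar>x - 1/2\<bar>"
        by (simp only: dist_of_real dist_real_def)
      ultimately show "\<exists>z\<in>of_real ` {0<..<1}. z \<noteq> complex_of_real (1/2) \<and> dist z (of_real (1/2)) < e"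
        by (intro bexI[of _ "of_real x"]) simp_all
    qed
  qed (use assms in \<open>auto simp: continues_def open_Omega connected_Omega real_in_Omega
        Omega_iff intro!: holomorphic_intros\<close>)
  then show ?thesis
    by simp
qed

lemma continues_continuation: "continues g f \<Longrightarrow> continues (continuation f) f"
  unfolding continuation_def by (rule someI[of "\<lambda>g. continues g f"])

lemma continuation_eq: "continues g f \<Longrightarrow> z \<in> Omega \<Longrightarrow> continuation f z = g z"
  using continuation_unique continues_continuation by blast

lemma continuation_by_derivative:
  assumes "\<phi> holomorphic_on Omega"
    and "\<And>x. 0 < x \<Longrightarrow> x < 1 \<Longrightarrow> (f has_real_derivative f' x) (at x)"
    and "\<And>x. 0 < x \<Longrightarrow> x < 1 \<Longrightarrow> \<phi> (of_real x) = of_real (f' x)"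
  shows "continues (continuation f) f"
proof -
  obtain g where g: "\<And>z. z \<in> Omega \<Longrightarrow> (g has_field_derivative \<phi> z) (at z)"
    using primitive_Omega[OF assms(1)] by blast
  have "((\<lambda>x. g (of_real x) - of_real (f x)) has_vector_derivative 0) (at x within {0<..<1})"
    if x: "x \<in> {0<..<1}" for x
  proof -
    have "(g has_field_derivative of_real (f' x)) (at (of_real x))"
      using g[OF real_in_Omega, of x] x assms(3)[of x] by simp
    then have "((\<lambda>x. g (of_real x)) has_vector_derivative of_real (f' x)) (at x within {0<..<1})"
      by (rule has_vector_derivative_real_field)
    moreover have "((\<lambda>x. complex_of_real (f x)) has_vector_derivative of_real (f' x))
        (at x within {0<..<1})"
      using assms(2)[of x] x
      by (intro has_vector_derivative_of_real has_vector_derivative_at_within)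
        (simp add: has_real_derivative_iff_has_vector_derivative)
    ultimately show ?thesis
      using has_vector_derivative_diff[of _ "of_real (f' x)" _ _ "of_real (f' x)"] by simp
  qed
  then obtain c where c: "\<And>x. x \<in> {0<..<1} \<Longrightarrow> g (of_real x) - of_real (f x) = c"
    using has_vector_derivative_zero_constant[OF convex_real_interval(8),
        of 0 1 "\<lambda>x. g (of_real x) - of_real (f x)"] by metis
  have "continues (\<lambda>z. g z - c) f"
    unfolding continues_def
  proof (intro conjI ballI)
    show "(\<lambda>z. g z - c) holomorphic_on Omega"
      using g by (intro holomorphic_intros) (auto simp: holomorphic_on_open open_Omega)
    show "g (of_real x) - c = of_real (f x)" if "x \<in> {0<..<1}" for x
      using c[OF that] by (simp add: algebra_simps)
  qed
  then show ?thesis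
    by (rule continues_continuation)
qed

definition polylog :: "nat \<Rightarrow> real \<Rightarrow> real" where
  "polylog n x = (\<Sum>k. x ^ Suc k / real (Suc k) ^ n)"

definition Log :: "complex \<Rightarrow> complex" where
  "Log = continuation ln"

definition Log1m :: "complex \<Rightarrow> complex" where
  "Log1m = continuation (\<lambda>x. ln (1 - x))"

definition Li :: "nat \<Rightarrow> complex \<Rightarrow> complex" where
  "Li n = continuation (polylog n)"

definition a_fun :: "complex \<Rightarrow> complex" where
  "a_fun = continuation (\<lambda>x. artanh (sqrt x))"

lemma continues_Log: "continues Log ln"
  unfolding Log_def
  by (rule continuation_by_derivative[of "\<lambda>z. 1 / z"])
    (auto simp: Omega_iff intro!: holomorphic_intros derivative_eq_intros)

lemma continues_Log1m: "continues Log1m (\<lambda>x. ln (1 - x))"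
  unfolding Log1m_def
  by (rule continuation_by_derivative[of "\<lambda>z. - 1 / (1 - z)"])
    (auto simp: Omega_iff intro!: holomorphic_intros derivative_eq_intros)

lemma continues_Log_quotients:
  "continues (\<lambda>z. Log z - Log1m z) (\<lambda>x. ln (x / (1 - x)))"
  "continues (\<lambda>z. Log1m z - Log z) (\<lambda>x. ln ((1 - x) / x))"
  using continues_Log continues_Log1m
  by (auto simp: continues_def ln_div intro!: holomorphic_intros)

lemma polylog_0: "0 < x \<Longrightarrow> x < 1 \<Longrightarrow> polylog 0 x = x / (1 - x)"
  using suminf_mult[OF summable_geometric, of x x] suminf_geometric[of x]
  by (simp add: polylog_def)

lemma polylog_Suc_derivative:
  assumes "0 < x" and "x < 1"
  shows "(polylog (Suc n) has_real_derivative polylog n x / x) (at x)"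
proof -
  define c where "c = (\<lambda>k. if k = 0 then 0 else 1 / real k ^ Suc n)"
  have summ: "summable (\<lambda>k. c k * y ^ k)" if "norm y < 1" for y :: real
  proof (rule summable_comparison_test')
    show "summable (\<lambda>k. \<bar>y\<bar> ^ k)"
      using that by (simp add: summable_geometric)
    show "norm (c k * y ^ k) \<le> \<bar>y\<bar> ^ k" for k
    proof (cases "k = 0")
      case False
      then have "\<bar>c k\<bar> \<le> 1"
        by (simp add: c_def divide_le_eq del: power_Suc)
      then show ?thesis
        by (simp add: abs_mult power_abs mult_left_le_one_le)
    qed (simp add: c_def)
  qed
  have eq: "polylog (Suc n) y = (\<Sum>k. c k * y ^ k)" if "norm y < 1" for y
    using suminf_split_head[OF summ[OF that]] by (simp add: polylog_def c_def)
  have diffs: "diffs c k = 1 / real (Suc k) ^ n" for k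
    by (simp add: diffs_def c_def)
  have summ': "summable (\<lambda>k. diffs c k * x ^ k)"
    using assms summ by (intro termdiff_converges[of x 1]) auto
  have "polylog n x = (\<Sum>k. x * (diffs c k * x ^ k))"
    by (simp add: polylog_def diffs)
  also have "\<dots> = x * (\<Sum>k. diffs c k * x ^ k)"
    by (rule suminf_mult[OF summ'])
  finally have "(\<Sum>k. diffs c k * x ^ k) = polylog n x / x"
    using assms by (simp add: field_simps)
  moreover have "((\<lambda>x. \<Sum>k. c k * x ^ k) has_real_derivative (\<Sum>k. diffs c k * x ^ k)) (at x)"
    using assms summ by (intro termdiffs_strong') auto
  ultimately have "((\<lambda>x. \<Sum>k. c k * x ^ k) has_real_derivative polylog n x / x) (at x)"
    by simp
  then show ?thesis
    by (rule has_field_derivative_transform_within_open[of _ _ _ "{0<..<1}"]) (use assms eq in auto)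
qed

lemma continues_Li: "continues (Li n) (polylog n)"
proof (induction n)
  case 0
  have "continues (\<lambda>z. z / (1 - z)) (polylog 0)"
    by (auto simp: continues_def polylog_0 Omega_iff intro!: holomorphic_intros)
  then show ?case
    unfolding Li_def by (rule continues_continuation)
next
  case (Suc n)
  show ?case
    unfolding Li_def
  proof (rule continuation_by_derivative[where \<phi> = "\<lambda>z. Li n z / z" and f' = "\<lambda>x. polylog n x / x"])
    show "(\<lambda>z. Li n z / z) holomorphic_on Omega"
      using Suc by (auto simp: continues_def Omega_iff intro!: holomorphic_intros)
  qed (use Suc in \<open>auto simp: continues_def polylog_Suc_derivative\<close>)
qed

lemma continues_a_fun: "continues a_fun (\<lambda>x. artanh (sqrt x))"
  unfolding a_fun_def
proof (rule continuation_by_derivative[of "\<lambda>z. 1 / (2 * exp (Log z / 2) * (1 - z))"])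
  show "(\<lambda>z. 1 / (2 * exp (Log z / 2) * (1 - z))) holomorphic_on Omega"
    using continues_Log by (auto simp: continues_def Omega_iff intro!: holomorphic_intros)
  fix x :: real assume x: "0 < x" "x < 1"
  have "((\<lambda>x. artanh (sqrt x)) has_real_derivative 1 / (1 - sqrt x ^ 2) * (inverse (sqrt x) / 2)) (at x)"
    using x by (intro DERIV_chain2[OF artanh_real_has_field_derivative DERIV_real_sqrt]) auto
  then show "((\<lambda>x. artanh (sqrt x)) has_real_derivative 1 / (2 * sqrt x * (1 - x))) (at x)"
    using x by (simp add: divide_simps mult_ac)
  have "exp (ln x / 2) = sqrt x"
    using x by (simp add: powr_half_sqrt[symmetric] powr_def)
  then have "exp (Log (of_real x) / 2) = complex_of_real (sqrt x)"
    using continues_Log x exp_of_real[of "ln x / 2", where 'a = complex]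
    by (simp add: continues_def)
  then show "1 / (2 * exp (Log (of_real x) / 2) * (1 - of_real x))
      = complex_of_real (1 / (2 * sqrt x * (1 - x)))"
    by simp
qed

definition d_fun :: "complex \<Rightarrow> complex" where
  "d_fun z = Li 2 z + 1/2 * Log z * Log1m z - of_real pi ^ 2 / 6"

definition g_fun :: "complex \<Rightarrow> complex" where
  "g_fun z = Li 3 z - Log z * Li 2 z - 1/3 * Log z ^ 2 * Log1m z - 2/9 * of_real (polylog 3 1)"

definition h_fun :: "complex \<Rightarrow> complex" where
  "h_fun z = 2 * Log z * Li 2 z + Log z ^ 2 * Log1m z"

definition g_tilde :: "complex \<Rightarrow> complex" where
  "g_tilde z = g_fun z - \<i> * of_real pi / 3 * Li 2 z + 4 * \<i> * of_real pi / 3 * d_fun z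
     + of_real pi ^ 2 / 3 * Log1m z + 2 * \<i> * of_real pi ^ 3 / 9"

definition h_tilde :: "complex \<Rightarrow> complex" where
  "h_tilde z = h_fun z + 2 * \<i> * of_real pi * Li 2 z - 4 * \<i> * of_real pi * d_fun z
     - of_real pi ^ 2 * Log1m z - 2 * \<i> * of_real pi ^ 3 / 3"


section \<open>Germs\<close>

definition U :: "complex \<times> complex \<Rightarrow> complex ^ 9" where
  "U = (\<lambda>(x, y). vector
     [x,
      y,
      x / y,
      (1 - y) / (1 - x),
      x * (1 - y) / (y * (1 - x)),
      x * y,
      x * (1 - y) / (x - 1),
      (1 - y) / (y * (x - 1)),
      x * (1 - y) ^ 2 / (y * (1 - x) ^ 2)])"

definition omega0 :: "complex \<times> complex" where
  "omega0 = (1/3, 1/2)"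

text \<open>A tuple of functions is encoded as a vector-valued function \<open>F\<close> of one variable: its
  \<open>i\<close>-th entry is \<open>\<lambda>z. F z $ i\<close>. Tuples of germs are tuples of functions with the \<open>i\<close>-th entry
  holomorphic near \<open>U omega0 $ i\<close>, modulo equality of the \<open>i\<close>-th entries near that point.
  The index type is \<^typ>\<open>9\<close>, where \<open>9 = 0\<close>; the entries of \<open>vector [\<dots>]\<close> have indices
  1 to 9 in this order (\<open>vector_9\<close> below).\<close>

definition same_germs :: "(complex \<Rightarrow> complex ^ 9) \<Rightarrow> (complex \<Rightarrow> complex ^ 9) \<Rightarrow> bool" where
  "same_germs F G \<longleftrightarrow> (\<forall>i. (\<lambda>z. F z $ i) analytic_on {U omega0 $ i}
     \<and> (\<lambda>z. G z $ i) analytic_on {U omega0 $ i}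
     \<and> (\<forall>\<^sub>F z in nhds (U omega0 $ i). F z $ i = G z $ i))"

lemma same_germs_refl_iff:
  "same_germs F F \<longleftrightarrow> (\<forall>i. (\<lambda>z. F z $ i) analytic_on {U omega0 $ i})"
  by (simp add: same_germs_def)

lemma eventually_eq2:
  assumes "\<forall>\<^sub>F z in A. f z = f' z" and "\<forall>\<^sub>F z in A. g z = g' z"
  shows "\<forall>\<^sub>F z in A. h (f z) (g z) = h (f' z) (g' z)"
  using assms by eventually_elim simp

quotient_type germs = "complex \<Rightarrow> complex ^ 9" / partial: same_germs
  morphisms rep_germs germs_of
proof (rule part_equivpI)
  show "\<exists>F. same_germs F F"
    by (rule exI[of _ "\<lambda>_. 0"]) (simp add: same_germs_refl_iff)
  show "symp same_germs"
    by (rule sympI) (auto simp: same_germs_def eq_commute)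
  show "transp same_germs"
    by (rule transpI) (unfold same_germs_def, smt (verit) eventually_elim2)
qed

instantiation germs :: ab_group_add
begin

lift_definition zero_germs :: germs is "\<lambda>_. 0"
  by (simp add: same_germs_refl_iff)

lift_definition plus_germs :: "germs \<Rightarrow> germs \<Rightarrow> germs" is "\<lambda>F G z. F z + G z"
  by (auto simp: same_germs_def intro!: analytic_on_add eventually_eq2[where h = "(+)"])

lift_definition minus_germs :: "germs \<Rightarrow> germs \<Rightarrow> germs" is "\<lambda>F G z. F z - G z"
  by (auto simp: same_germs_def intro!: analytic_on_diff eventually_eq2[where h = "(-)"])

lift_definition uminus_germs :: "germs \<Rightarrow> germs" is "\<lambda>F z. - F z"
  by (auto simp: same_germs_def intro!: analytic_on_neg elim: eventually_mono)

instance
  by standard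
    (transfer; auto simp: same_germs_def algebra_simps
      intro!: analytic_on_add analytic_on_diff analytic_on_neg)+

end

lift_definition scale_germs :: "complex \<Rightarrow> germs \<Rightarrow> germs" is "\<lambda>c F z. c *s F z"
  by (auto simp: same_germs_def intro!: analytic_on_mult elim: eventually_mono)

global_interpretation germs: vector_space scale_germs
  by standard
    (transfer; auto simp: same_germs_def algebra_simps intro!: analytic_on_add analytic_on_mult)+

lemma vector_9:
  fixes f :: "'a::zero"
  shows "(vector [a, b, c, d, e, f, g, h, k] :: 'a ^ 9) $ 1 = a"
    "(vector [a, b, c, d, e, f, g, h, k] :: 'a ^ 9) $ 2 = b"
    "(vector [a, b, c, d, e, f, g, h, k] :: 'a ^ 9) $ 3 = c"
    "(vector [a, b, c, d, e, f, g, h, k] :: 'a ^ 9) $ 4 = d"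
    "(vector [a, b, c, d, e, f, g, h, k] :: 'a ^ 9) $ 5 = e"
    "(vector [a, b, c, d, e, f, g, h, k] :: 'a ^ 9) $ 6 = f"
    "(vector [a, b, c, d, e, f, g, h, k] :: 'a ^ 9) $ 7 = g"
    "(vector [a, b, c, d, e, f, g, h, k] :: 'a ^ 9) $ 8 = h"
    "(vector [a, b, c, d, e, f, g, h, k] :: 'a ^ 9) $ 9 = k"
  by (simp_all add: vector_def)

lemma UNIV_9: "(UNIV :: 9 set) = {1, 2, 3, 4, 5, 6, 7, 8, 9}"
  by (rule sym, rule card_subset_eq) simp_all

lemma isCont_U: "isCont (\<lambda>w. U w $ i) omega0"
proof -
  have "i \<in> {1, 2, 3, 4, 5, 6, 7, 8, 9}"
    unfolding UNIV_9[symmetric] by simp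
  then show ?thesis
    by (elim insertE emptyE)
      (auto simp: U_def case_prod_unfold vector_9 omega0_def intro!: continuous_intros)
qed

lift_definition is_relation :: "germs \<Rightarrow> bool" is
  "\<lambda>F. \<forall>\<^sub>F w in nhds omega0. (\<Sum>i\<in>UNIV. F (U w $ i) $ i) = 0"
proof -
  fix F G assume FG: "same_germs F G"
  have "\<forall>\<^sub>F w in nhds omega0. F (U w $ i) $ i = G (U w $ i) $ i" for i
  proof -
    have "filterlim (\<lambda>w. U w $ i) (nhds (U omega0 $ i)) (nhds omega0)"
      using isCont_U[of i] by (simp add: isCont_def tendsto_nhds_iff)
    moreover have "\<forall>\<^sub>F z in nhds (U omega0 $ i). F z $ i = G z $ i"
      using FG by (simp add: same_germs_def)
    ultimately show ?thesis
      by (rule eventually_compose_filterlim[rotated])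
  qed
  then have ev: "\<forall>\<^sub>F w in nhds omega0. \<forall>i. F (U w $ i) $ i = G (U w $ i) $ i"
    by (simp add: eventually_all_finite)
  show "(\<forall>\<^sub>F w in nhds omega0. (\<Sum>i\<in>UNIV. F (U w $ i) $ i) = 0) \<longleftrightarrow>
        (\<forall>\<^sub>F w in nhds omega0. (\<Sum>i\<in>UNIV. G (U w $ i) $ i) = 0)"
    by (rule eventually_cong[OF ev]) simp
qed

definition S :: "germs set" where
  "S = {G. is_relation G}"

lemma subspace_S: "germs.subspace S"
proof (rule germs.subspaceI)
  show "0 \<in> S"
    unfolding S_def mem_Collect_eq by transfer simp
  show "F + G \<in> S" if "F \<in> S" and "G \<in> S" for F G
    using that unfolding S_def mem_Collect_eq
    by transfer (erule (1) eventually_elim2, simp add: sum.distrib)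
  show "scale_germs c F \<in> S" if "F \<in> S" for c F
    using that unfolding S_def mem_Collect_eq
    by transfer (erule eventually_mono, simp flip: sum_distrib_left)
qed

section \<open>The explicit solutions\<close>

abbreviation (input) ipi :: complex where
  "ipi \<equiv> \<i> * of_real pi"

abbreviation (input) pi2 :: complex where
  "pi2 \<equiv> of_real pi ^ 2"

definition Fs :: "(complex \<Rightarrow> complex ^ 9) list" where
  "Fs =
   [\<lambda>z. vector [Log z, - Log z, - Log z, 0, 0, 0, 0, 0, 0],
    \<lambda>z. vector [continuation (\<lambda>x. ln (x / (1 - x))) z, 0,
                continuation (\<lambda>x. ln ((1 - x) / x)) z, - Log1m z, 0, 0, 0, 0, 0],
    \<lambda>z. vector [Log1m z, - Log1m z, 0, Log z, 0, 0, 0, 0, 0],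
    \<lambda>z. vector [0, 0, Log z, Log z, - Log z, 0, 0, 0, 0],
    \<lambda>z. vector [Log1m z, 0, - Log1m z, 0, Log1m z, 0, 0, 0, 0],
    \<lambda>z. vector [Log z, Log z, 0, 0, 0, - Log z, 0, 0, 0],
    \<lambda>z. vector [Log z, 0, 0, Log z, 0, 0, - Log z + ipi, 0, 0],
    \<lambda>z. vector [1 / z, 0, 0, 0, 1 / z, 0, 1 / z - 1, 0, 0],
    \<lambda>z. vector [Log1m z, 0, 0, 0, 0, - Log1m z, Log1m z, 0, 0],
    \<lambda>z. vector [0, z, 0, z, 0, 0, z - 1, 0, 0],
    \<lambda>z. vector [0, 0, 0, 0, 0, Log z, - Log z, Log z, 0],
    \<lambda>z. vector [0, Log z, 0, 0, 0, 0, - Log1m z, Log1m z, 0],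
    \<lambda>z. vector [0, 0, 0, 0, 0, 0, Log z, Log z, - Log z - 2 * ipi],
    \<lambda>z. vector [0, 0, 0, 0, Log1m z, 0, Log1m z, 0, - Log1m z],
    \<lambda>z. vector [0, 1 / z, 0, 0, z, 0, 0, z - 1, 0],
    \<lambda>z. vector [z, 0, 0, 1 / z, 0, 0, 0, 1 / z - 1, 0],
    \<lambda>z. vector [0, 0, a_fun z, 0, 0, - a_fun z, 0, 0, - a_fun z],
    \<lambda>z. vector [2 * Log z ^ 2, 2 * Log z ^ 2, - (Log z ^ 2), 0, 0, - (Log z ^ 2), 0, 0, 0],
    \<lambda>z. vector [0, 0, 0, 0, 0, Log z ^ 2, - 2 * Log z ^ 2, - 2 * Log z ^ 2,
                Log z ^ 2 + 4 * ipi * Log z - 4 * pi2],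
    \<lambda>z. vector [0, 0, Log z ^ 2, - 2 * Log z ^ 2, - 2 * Log z ^ 2, 0, 0, 0, Log z ^ 2],
    \<lambda>z. vector [d_fun z, - d_fun z, - d_fun z, - d_fun z, d_fun z, 0, 0, 0, 0],
    \<lambda>z. vector [d_fun z, d_fun z - ipi / 2 * Log z, 0, 0, 0, - d_fun z, d_fun z, - d_fun z, 0],
    \<lambda>z. vector [pi2, 0, 0, d_fun z - ipi / 2 * Log z, d_fun z, 0, d_fun z,
                d_fun z + ipi / 2 * Log z - ipi * Log1m z, - d_fun z],
    \<lambda>z. vector [Li 2 z, Li 2 z, 0, 1/2 * Log z ^ 2, 0, - Li 2 z, Li 2 z,
                - Li 2 z - 1/2 * Log z ^ 2 + ipi * Log z, pi2 / 3],
    \<lambda>z. vector [0, 1/2 * Log z ^ 2, 0, Li 2 z, Li 2 z, 0, Li 2 z, Li 2 z, - Li 2 z],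
    \<lambda>z. vector [2 * Li 2 z, 0, - Li 2 z, 0, 2 * Li 2 z, - Li 2 z, 2 * Li 2 z, 0, - Li 2 z],
    \<lambda>z. vector [2 * g_fun z, 2 * g_fun z, - g_fun z, 2 * g_fun z, 2 * g_fun z, - g_fun z,
                2 * g_tilde z, 2 * g_tilde z, - g_fun z],
    \<lambda>z. vector [2 * h_fun z, 2 * h_fun z - 2 * pi2 / 3 * Log z, - h_fun z, 2 * h_fun z,
                2 * h_fun z, - h_fun z, 2 * h_tilde z, 2 * h_tilde z, - h_fun z]]"

text \<open>Every tuple in \<^term>\<open>Fs\<close> lies in the domain of \<^term>\<open>germs_of\<close>.\<close>

lemma index_9_cases:
  fixes i :: 9
  assumes "P 1" "P 2" "P 3" "P 4" "P 5" "P 6" "P 7" "P 8" "P 9"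
  shows "P i"
proof -
  have "i \<in> {1, 2, 3, 4, 5, 6, 7, 8, 9}"
    unfolding UNIV_9[symmetric] by simp
  then show ?thesis
    using assms by blast
qed

lemma base_points_in_Omega: "U omega0 $ i \<in> Omega"
  by (rule index_9_cases[of _ i])
    (simp_all add: U_def omega0_def vector_9 Omega_iff power2_eq_square Re_divide Im_divide)

lemma holomorphic_pieces [holomorphic_intros]:
  "Log holomorphic_on Omega" "Log1m holomorphic_on Omega" "Li n holomorphic_on Omega"
  "a_fun holomorphic_on Omega"
  "d_fun holomorphic_on Omega" "g_fun holomorphic_on Omega" "h_fun holomorphic_on Omega"
  "g_tilde holomorphic_on Omega" "h_tilde holomorphic_on Omega"
  "continuation (\<lambda>x. ln (x / (1 - x))) holomorphic_on Omega"
  "continuation (\<lambda>x. ln ((1 - x) / x)) holomorphic_on Omega"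
proof -
  show 1: "Log holomorphic_on Omega" "Log1m holomorphic_on Omega" "Li n holomorphic_on Omega"
    "a_fun holomorphic_on Omega" for n
    using continues_Log continues_Log1m continues_Li continues_a_fun by (simp_all add: continues_def)
  show 2: "d_fun holomorphic_on Omega" "g_fun holomorphic_on Omega" "h_fun holomorphic_on Omega"
    unfolding d_fun_def g_fun_def h_fun_def by (intro holomorphic_intros 1; simp)+
  show "g_tilde holomorphic_on Omega" "h_tilde holomorphic_on Omega"
    unfolding g_tilde_def h_tilde_def by (intro holomorphic_intros 1 2; simp)+
  show "continuation (\<lambda>x. ln (x / (1 - x))) holomorphic_on Omega"
    "continuation (\<lambda>x. ln ((1 - x) / x)) holomorphic_on Omega"
    using continues_Log_quotients[THEN continues_continuation] by (simp_all add: continues_def)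
qed

lemma holomorphic_vector_9:
  assumes "f1 holomorphic_on A" "f2 holomorphic_on A" "f3 holomorphic_on A"
    "f4 holomorphic_on A" "f5 holomorphic_on A" "f6 holomorphic_on A"
    "f7 holomorphic_on A" "f8 holomorphic_on A" "f9 holomorphic_on A"
  shows "(\<lambda>z. (vector [f1 z, f2 z, f3 z, f4 z, f5 z, f6 z, f7 z, f8 z, f9 z] :: complex ^ 9) $ i)
    holomorphic_on A"
  by (rule index_9_cases[of _ i]) (simp_all only: vector_9 assms)

lemma Fs_holomorphic:
  assumes "F \<in> set Fs"
  shows "(\<lambda>z. F z $ i) holomorphic_on Omega"
proof -
  have "0 \<notin> Omega" by (simp add: Omega_iff)
  then show ?thesis
    using assms unfolding Fs_def list.set
    by (elim insertE emptyE; hypsubst; intro holomorphic_vector_9 holomorphic_intros holomorphic_pieces) auto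
qed

lemma Fs_germs: "F \<in> set Fs \<Longrightarrow> same_germs F F"
  unfolding same_germs_refl_iff
  using Fs_holomorphic base_points_in_Omega analytic_on_holomorphic open_Omega by blast

end

theory Submission
  imports Defs "HOL-Real_Asymp.Real_Asymp"
begin

text \<open>
  Three facts together say that the 36 germs are a basis: each of them is a solution, they are
  linearly independent, and no more than 36 independent solutions exist.

  \<^bold>\<open>They are solutions.\<close> On the real triangle \<open>0 < x < y < 1\<close>, which contains the base point,
  every \<open>U i\<close> is a real number of \<^term>\<open>Omega\<close>; it is negative for \<open>i = 7, 8\<close> and lies between 0
  and 1 otherwise. There \<open>Log (U i)\<close> and \<open>Log1m (U i)\<close> are integer combinations of the six letters
  \<open>ln x\<close>, \<open>ln y\<close>, \<open>ln (1 - x)\<close>, \<open>ln (1 - y)\<close>, \<open>ln (y - x)\<close>, \<open>ln (1 - x * y)\<close>, up to the summand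
  \<open>\<i> * pi\<close> of the logarithm of a negative number. So the relations between logarithms are linear
  algebra. For a relation between dilogarithms or trilogarithms, the derivative in \<open>y\<close> is a
  polynomial in the letters and their derivatives, and this polynomial is identically zero; for the
  trilogarithmic relation \<open>spence_kummer_h\<close> it is so modulo the dilogarithmic ones. The
  constant of integration is found as \<open>y\<close> tends to 1. This limit needs no special values
  beyond \<open>Li 2 1 = pi\<^sup>2 / 6\<close>, because \<open>U 4, U 5, U 7, U 8, U 9\<close> then tend to 0, \<open>U 2\<close> tends to 1, and
  \<open>U 1, U 3, U 6\<close> all tend to \<open>x\<close>. The identity theorem, applied in one variable after the
  other, carries a relation from the triangle to a complex neighbourhood of the base point.

  \<^bold>\<open>They are independent.\<close> All entries of the tuples are combinations of the twelve functions
  \<open>1\<close>, \<open>z\<close>, \<open>1/z\<close>, \<open>arctanh (sqrt z)\<close>, \<open>Log\<close>, \<open>Log1m\<close>, \<open>Log\<^sup>2\<close>, \<open>Log * Log1m\<close>, \<open>Li 2\<close>, \<open>Li 3\<close>,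
  \<open>Log * Li 2\<close>, \<open>Log\<^sup>2 * Log1m\<close>, which are independent by their asymptotic expansions at 0
  (\<open>functions_independent\<close>). A linear relation between the tuples is thus a system of linear
  equations for its coefficients, and this system is triangular.

  \<^bold>\<open>There are no more.\<close> This is Bol's bound on the rank of a planar web. If all entries
  of a solution vanish to order \<open>k\<close>, then the terms of order \<open>k\<close> give a linear relation between the
  \<open>k\<close>-th powers of the nine linear forms \<open>dU i\<close>. These are pairwise independent, hence any \<open>k + 1\<close>
  of their \<open>k\<close>-th powers are independent, and the relation is determined by the coefficients of
  the first \<open>8 - k\<close> forms. A solution is therefore determined by \<open>8 + 7 + \<dots> + 1 = 36\<close> Taylor
  coefficients (\<open>free_jets_determine\<close>).
\<close>

section \<open>Logarithms and polylogarithms on the slit plane\<close>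

text \<open>The principal logarithm of \<open>- \<i> * z\<close> has its cut exactly along the negative imaginary
  half-line that is removed from \<^term>\<open>Omega\<close>, so a shift by \<open>\<i> * pi / 2\<close> is an explicit formula for
  the continued logarithm on all of \<^term>\<open>Omega\<close>. The map \<open>z \<mapsto> 1 - z\<close> exchanges the two half-lines,
  hence the same formula for \<^const>\<open>Log1m\<close>.\<close>

lemma Log_eq_Ln:
  assumes "z \<in> Omega"
  shows "Log z = Ln (- (\<i> * z)) + \<i> * of_real pi / 2"
  unfolding Log_def
proof (rule continuation_eq[OF _ assms])
  show "continues (\<lambda>z. Ln (- (\<i> * z)) + \<i> * of_real pi / 2) ln"
    unfolding continues_def
  proof (intro conjI ballI)
    show "(\<lambda>z. Ln (- (\<i> * z)) + \<i> * of_real pi / 2) holomorphic_on Omega"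
      by (auto intro!: holomorphic_intros simp: Omega_iff complex_nonpos_Reals_iff)
    show "Ln (- (\<i> * of_real x)) + \<i> * of_real pi / 2 = of_real (ln x)" if "x \<in> {0<..<1}" for x
      using Ln_times_of_real[of x "-\<i>"] Ln_of_real[of x] that by (simp add: mult.commute)
  qed
qed

lemma Log1m_eq_Ln:
  assumes "z \<in> Omega"
  shows "Log1m z = Ln (- (\<i> * (1 - z))) + \<i> * of_real pi / 2"
  unfolding Log1m_def
proof (rule continuation_eq[OF _ assms])
  show "continues (\<lambda>z. Ln (- (\<i> * (1 - z))) + \<i> * of_real pi / 2) (\<lambda>x. ln (1 - x))"
    unfolding continues_def
  proof (intro conjI ballI)
    show "(\<lambda>z. Ln (- (\<i> * (1 - z))) + \<i> * of_real pi / 2) holomorphic_on Omega"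
      by (auto intro!: holomorphic_intros simp: Omega_iff complex_nonpos_Reals_iff)
    show "Ln (- (\<i> * (1 - of_real x))) + \<i> * of_real pi / 2 = of_real (ln (1 - x))"
      if "x \<in> {0<..<1}" for x
      using Ln_times_of_real[of "1 - x" "-\<i>"] Ln_of_real[of "1 - x"] that by
          (simp add: mult.commute)
  qed
qed

lemma neg_real_in_Omega: "t > 0 \<Longrightarrow> - complex_of_real t \<in> Omega"
  by (simp add: Omega_iff)

lemma Log_of_real: "0 < t \<Longrightarrow> t < 1 \<Longrightarrow> Log (of_real t) = of_real (ln t)"
  using continues_Log by (simp add: continues_def)

text \<open>The negative axis is reached from the unit interval through the upper half-plane, hence
  the sign of \<open>\<i> * pi\<close>.\<close>

lemma Log_of_real_neg: "t > 0 \<Longrightarrow> Log (- of_real t) = of_real (ln t) + \<i> * of_real pi"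
  using Ln_times_of_real[of t "\<i>"] Ln_of_real[of t] by
      (simp add: Log_eq_Ln neg_real_in_Omega mult.commute)

lemma Log1m_of_real: "0 < t \<Longrightarrow> t < 1 \<Longrightarrow> Log1m (of_real t) = of_real (ln (1 - t))"
  using continues_Log1m by (simp add: continues_def)

lemma Log1m_of_real_neg: "t > 0 \<Longrightarrow> Log1m (- of_real t) = of_real (ln (1 + t))"
  using Ln_times_of_real[of "1 + t" "-\<i>"] Ln_of_real[of "1 + t"] by
      (simp add: Log1m_eq_Ln neg_real_in_Omega mult.commute)

text \<open>Both \<open>deriv g\<close> and \<open>\<phi>\<close> continue \<open>f'\<close>, so they agree on \<^term>\<open>Omega\<close>. This turns
  differentiation rules on the unit interval into rules on \<^term>\<open>Omega\<close>.\<close>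

lemma continues_deriv:
  assumes g: "continues g f" and \<phi>: "\<phi> holomorphic_on Omega"
    and f: "\<And>x. 0 < x \<Longrightarrow> x < 1 \<Longrightarrow> (f has_real_derivative f' x) (at x)"
    and eq: "\<And>x. 0 < x \<Longrightarrow> x < 1 \<Longrightarrow> \<phi> (of_real x) = of_real (f' x)"
    and z: "z \<in> Omega"
  shows "(g has_field_derivative \<phi> z) (at z)"
proof -
  have hol: "g holomorphic_on Omega"
    using g by (simp add: continues_def)
  have "deriv g (of_real x) = of_real (f' x)" if x: "x \<in> {0<..<1}" for x
  proof -
    have "(g has_field_derivative deriv g (of_real x)) (at (of_real x))"
      using hol x real_in_Omega open_Omega holomorphic_derivI by auto
    then have "((\<lambda>x. g (of_real x)) has_vector_derivative deriv g (of_real x)) (at x)"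
      by (rule has_vector_derivative_real_field)
    then have "((\<lambda>x. of_real (f x)) has_vector_derivative deriv g (of_real x)) (at x)"
      by (rule has_vector_derivative_transform_within_open[of _ _ _ "{0<..<1}"])
        (use g x in \<open>auto simp: continues_def\<close>)
    moreover have "((\<lambda>x. complex_of_real (f x)) has_vector_derivative of_real (f' x)) (at x)"
      using f[of x] x
      by (intro has_vector_derivative_of_real)
        (simp add: has_real_derivative_iff_has_vector_derivative)
    ultimately show ?thesis
      by (rule vector_derivative_unique_at)
  qed
  then have "continues (deriv g) f'" "continues \<phi> f'"
    using \<phi> eq hol open_Omega by (auto simp: continues_def intro: holomorphic_deriv)
  then have "deriv g z = \<phi> z"
    using continuation_unique z by blast
  then show ?thesis
    using holomorphic_derivI[OF hol open_Omega z] by simp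
qed

lemma DERIV_Log: "z \<in> Omega \<Longrightarrow> (Log has_field_derivative 1 / z) (at z)"
  by (rule continues_deriv[OF continues_Log, of "\<lambda>z. 1 / z" "\<lambda>x. 1 / x"])
    (auto simp: Omega_iff intro!: holomorphic_intros derivative_eq_intros)

lemma DERIV_Log1m: "z \<in> Omega \<Longrightarrow> (Log1m has_field_derivative - 1 / (1 - z)) (at z)"
  by (rule continues_deriv[OF continues_Log1m, of "\<lambda>z. - 1 / (1 - z)" "\<lambda>x. - 1 / (1 - x)"])
    (auto simp: Omega_iff intro!: holomorphic_intros derivative_eq_intros)

lemma DERIV_Li: "z \<in> Omega \<Longrightarrow> (Li (Suc n) has_field_derivative Li n z / z) (at z)"
  by (rule continues_deriv[OF continues_Li, where \<phi> = "\<lambda>z. Li n z / z" and f' =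
      "\<lambda>x. polylog n x / x"])
    (use continues_Li[of n] in \<open>auto simp: continues_def Omega_iff polylog_Suc_derivative intro!:
        holomorphic_intros\<close>)

lemma polylog_1:
  assumes "0 < x" "x < 1"
  shows "polylog 1 x = - ln (1 - x)"
proof -
  have "(\<lambda>n. x ^ n / real n) sums (- ln (1 - x))"
    using sums_minus[OF ln_series'[of "- x"]] assms by simp
  then have "(\<lambda>n. x ^ Suc n / real (Suc n)) sums (- ln (1 - x))"
    using sums_Suc_iff[of "\<lambda>n. x ^ n / real n"] by simp
  then show ?thesis
    by (simp add: polylog_def sums_iff)
qed

lemma Log1m_eq_Li:
  assumes "z \<in> Omega"
  shows "Log1m z = - Li 1 z"
proof -
  have "continues (\<lambda>z. - Li 1 z) (\<lambda>x. ln (1 - x))"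
    using continues_Li[of 1] polylog_1 by (auto simp: continues_def intro!: holomorphic_intros)
  then show ?thesis
    using assms by (simp add: Log1m_def continuation_eq)
qed

text \<open>The slit disc is a chain of three overlapping convex pieces; its connectedness makes the
  power series of the polylogarithm valid on the whole of it.\<close>

lemma connected_slit_disc: "connected (Omega \<inter> ball 0 1)"
proof -
  have eq: "Omega \<inter> ball 0 1 = ({z. Re z > 0} \<inter> ball 0 1 \<union> {z. Im z > 0} \<inter> ball 0 1)
      \<union> {z. Re z < 0} \<inter> ball 0 1"
  proof -
    have "Re z \<noteq> 1" if "norm z < 1" for z
      using complex_Re_le_cmod[of z] that by auto
    then show ?thesis
      by (auto simp: Omega_iff)
  qed
  have 1: "Complex (1/2) (1/2) \<in> ball 0 1" "Complex (-1/2) (1/2) \<in> ball 0 1"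
    by (simp_all add: cmod_def power2_eq_square real_less_lsqrt)
  show ?thesis
    unfolding eq
    by (intro connected_Un convex_connected convex_Int convex_ball convex_halfspace_Re_gt
        convex_halfspace_Im_gt convex_halfspace_Re_lt)
      (use 1 in force)+
qed

lemma polylog_summable:
  fixes z :: complex
  assumes "norm z < 1"
  shows "summable (\<lambda>k. norm (z ^ Suc k / of_nat (Suc k) ^ n))"
proof (rule summable_comparison_test')
  show "summable (\<lambda>k. norm z ^ Suc k)"
    using assms by (subst summable_Suc_iff) (simp add: summable_geometric)
  show "norm (norm (z ^ Suc k / of_nat (Suc k) ^ n)) \<le> norm z ^ Suc k" for k
  proof -
    have "(1::real) \<le> real (Suc k) ^ n"
      by (rule one_le_power) simp
    then have "norm z ^ Suc k / real (Suc k) ^ n \<le> norm z ^ Suc k / 1"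
      by (intro divide_left_mono) auto
    then show ?thesis
      by (simp add: norm_divide norm_power del: power_Suc of_nat_Suc)
  qed
qed

lemma Li_eq_series:
  assumes "z \<in> Omega" "norm z < 1"
  shows "Li n z = (\<Sum>k. z ^ Suc k / of_nat (Suc k) ^ n)"
proof -
  define c where "c = (\<lambda>k. if k = 0 then 0 else 1 / of_nat k ^ n :: complex)"
  define P where "P = (\<lambda>z. \<Sum>k. c k * z ^ k)"
  have summ: "summable (\<lambda>k. c k * z ^ k)" if "norm z < 1" for z
    using summable_norm_cancel[OF polylog_summable[OF that, of n]]
    by (subst summable_Suc_iff[symmetric]) (simp add: c_def)
  have P: "P z = (\<Sum>k. z ^ Suc k / of_nat (Suc k) ^ n)" if "norm z < 1" for z
    using suminf_split_head[OF summ[OF that]] by (simp add: P_def c_def)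
  have "(P has_field_derivative (\<Sum>k. diffs c k * z ^ k)) (at z)" if "norm z < 1" for z
    unfolding P_def by (rule termdiffs_strong'[where K = 1]) (use summ that in auto)
  then have holP: "P holomorphic_on ball 0 1"
    by (metis holomorphic_on_open open_ball mem_ball_0)
  have "Li n z - P z = 0"
  proof (rule analytic_continuation[of "\<lambda>z. Li n z - P z" "Omega \<inter> ball 0 1" "of_real ` {0<..<1}"
      "of_real (1/2)"])
    show "(\<lambda>z. Li n z - P z) holomorphic_on Omega \<inter> ball 0 1"
      by (intro holomorphic_intros holomorphic_on_subset[OF holP]
          holomorphic_on_subset[OF holomorphic_pieces(3)]) auto
    have "(1/2::real) islimpt {0<..<1}"
      by (rule islimpt_greaterThanLessThan1[THEN islimpt_subset, of "1/2" 1]) auto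
    moreover have "\<forall>\<^sub>F x in at (1/2). complex_of_real x \<noteq> of_real (1/2)"
      unfolding of_real_eq_iff by (rule eventually_neq_at_within)
    ultimately show "complex_of_real (1/2) islimpt of_real ` {0<..<1}"
      by (intro islimpt_isCont_image continuous_intros)
    show "Li n z - P z = 0" if z: "z \<in> of_real ` {0<..<1}" for z
    proof -
      obtain x where x: "z = of_real x" "0 < x" "x < 1"
        using z by auto
      have "summable (\<lambda>k. x ^ Suc k / real (Suc k) ^ n)"
        using summable_norm_cancel[OF polylog_summable, of "of_real x" n] x
        by (subst summable_complex_of_real[symmetric]) simp
      then have "P z = of_real (polylog n x)"
        using x suminf_of_real[of "\<lambda>k. x ^ Suc k / real (Suc k) ^ n", where 'a = complex] by
            (simp add: P polylog_def)
      then show ?thesis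
        using continues_Li[of n] x by (simp add: continues_def)
    qed
  qed (use assms connected_slit_disc open_Omega in \<open>auto simp: Omega_iff\<close>)
  then show ?thesis
    using P assms by simp
qed

lemma norm_Li_le:
  assumes "z \<in> Omega" "norm z < 1"
  shows "norm (Li n z) \<le> norm z / (1 - norm z)"
proof -
  have le: "norm (z ^ Suc k / of_nat (Suc k) ^ n) \<le> norm z * norm z ^ k" for k
  proof -
    have "(1::real) \<le> real (Suc k) ^ n"
      by (rule one_le_power) simp
    then have "norm z ^ Suc k / real (Suc k) ^ n \<le> norm z ^ Suc k / 1"
      by (intro divide_left_mono) auto
    then show ?thesis
      by (simp only: norm_divide norm_power norm_of_nat) simp
  qed
  have geo: "(\<lambda>k. norm z * norm z ^ k) sums (norm z * (1 / (1 - norm z)))"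
    using assms by (intro sums_mult geometric_sums) simp
  have "norm (Li n z) \<le> (\<Sum>k. norm (z ^ Suc k / of_nat (Suc k) ^ n))"
    unfolding Li_eq_series[OF assms] by (rule summable_norm[OF polylog_summable[OF assms(2)]])
  also have "\<dots> \<le> (\<Sum>k. norm z * norm z ^ k)"
    by (intro suminf_le le polylog_summable assms sums_summable[OF geo])
  also have "\<dots> = norm z / (1 - norm z)"
    using geo by (simp add: sums_iff)
  finally show ?thesis .
qed

text \<open>A crude bound for \<open>Log\<close>; only the logarithmic growth at 0 matters.\<close>

lemma norm_Log_le:
  assumes "z \<in> Omega"
  shows "norm (Log z) \<le> \<bar>ln (norm z)\<bar> + 2 * pi"
proof -
  have z: "z \<noteq> 0"
    using assms by (auto simp: Omega_iff)
  have "norm (Ln (- (\<i> * z))) \<le> \<bar>Re (Ln (- (\<i> * z)))\<bar> + \<bar>Im (Ln (- (\<i> * z)))\<bar>"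
    by (rule cmod_le)
  also have "\<dots> \<le> \<bar>ln (norm z)\<bar> + pi"
    using z mpi_less_Im_Ln[of "- (\<i> * z)"] Im_Ln_le_pi[of "- (\<i> * z)"] by (simp add: norm_mult)
  finally have "norm (Ln (- (\<i> * z))) \<le> \<bar>ln (norm z)\<bar> + pi" .
  moreover have "norm (\<i> * complex_of_real pi / 2) \<le> pi"
    by (simp add: norm_mult norm_divide)
  ultimately have "norm (Ln (- (\<i> * z))) + norm (\<i> * of_real pi / 2) \<le> \<bar>ln (norm z)\<bar> + 2 * pi"
    by linarith
  then show ?thesis
    unfolding Log_eq_Ln[OF assms] using norm_triangle_ineq order_trans by blast
qed

text \<open>Near 0, \<open>Li n z\<close> is of the size of \<open>z\<close>, which beats the powers of \<open>Log z\<close>. The argument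
  may approach 0 from any direction in \<^term>\<open>Omega\<close>, in particular through negative reals.\<close>

lemma tendsto_Log_power_Li:
  assumes "m \<le> 2"
  shows "((\<lambda>z. Log z ^ m * Li n z) \<longlongrightarrow> 0) (at 0 within Omega)"
proof (rule Lim_null_comparison)
  have "((\<lambda>r::real. (2 * pi + 1 - ln r)^2 * (2 * r)) \<longlongrightarrow> 0) (at_right 0)"
    by real_asymp
  moreover have "filterlim norm (at_right 0) (at (0::complex) within Omega)"
    unfolding filterlim_at
    by (auto simp: eventually_at_filter intro!: tendsto_eq_intros always_eventually)
  ultimately show "((\<lambda>z. (2 * pi + 1 - ln (norm z))^2 * (2 * norm z)) \<longlongrightarrow> 0) (at 0 within Omega)"
    by (rule filterlim_compose)
  have "norm (Log z ^ m * Li n z) \<le> (2 * pi + 1 - ln (norm z))^2 * (2 * norm z)"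
    if z: "z \<in> Omega" "norm z < 1/2" for z
  proof -
    have z0: "z \<noteq> 0"
      using z by (auto simp: Omega_iff)
    then have "ln (norm z) < 0"
      using z by simp
    then have "norm (Log z) \<le> 2 * pi + 1 - ln (norm z)" and 1: "1 \<le> 2 * pi + 1 - ln (norm z)"
      using norm_Log_le[OF z(1)] pi_gt_zero by linarith+
    then have "norm (Log z) ^ m \<le> (2 * pi + 1 - ln (norm z)) ^ m"
      by (intro power_mono) auto
    also have "\<dots> \<le> (2 * pi + 1 - ln (norm z)) ^ 2"
      using assms 1 by (intro power_increasing) auto
    finally have "norm (Log z) ^ m \<le> (2 * pi + 1 - ln (norm z))^2" .
    moreover have "norm z / (1 - norm z) \<le> 2 * norm z"
      using z mult_left_mono[of "norm z" "1/2" "norm z"] by (simp add: field_simps)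
    then have "norm (Li n z) \<le> 2 * norm z"
      using norm_Li_le[of z n] z by linarith
    ultimately show ?thesis
      unfolding norm_mult norm_power by (intro mult_mono) auto
  qed
  moreover have "\<forall>\<^sub>F z in at (0::complex) within Omega. z \<in> Omega \<and> norm z < 1/2"
    by (auto simp: eventually_at dist_norm intro!: exI[of _ "1/2"])
  ultimately show "\<forall>\<^sub>F z in at 0 within Omega. norm (Log z ^ m * Li n z)
      \<le> (2 * pi + 1 - ln (norm z))^2 * (2 * norm z)"
    by (auto elim: eventually_mono)
qed

text \<open>The series converges uniformly up to 1 by comparison with its value there.\<close>

lemma tendsto_polylog_1:
  assumes "n \<ge> 2"
  shows "((\<lambda>x. polylog n x) \<longlongrightarrow> polylog n 1) (at_left 1)"
proof -
  have "summable (\<lambda>k. 1 / real (Suc k) ^ n)"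
    using assms inverse_power_summable[of n, where 'a = real]
    by (subst summable_Suc_iff) (simp add: inverse_eq_divide)
  then have "uniform_limit {0..1} (\<lambda>N x. \<Sum>k<N. x ^ Suc k / real (Suc k) ^ n)
      (\<lambda>x. \<Sum>k. x ^ Suc k / real (Suc k) ^ n) sequentially"
    by (rule Weierstrass_m_test[rotated])
      (auto simp: power_abs divide_le_cancel mult_le_one power_le_one simp flip: power_Suc)
  then have "continuous_on {0..1} (polylog n)"
    unfolding polylog_def
    by (rule uniform_limit_theorem[rotated]) (auto intro!: always_eventually continuous_intros)
  then have "(polylog n \<longlongrightarrow> polylog n 1) (at 1 within {0..1})"
    by (auto simp: continuous_on)
  then show ?thesis
    by (simp add: at_within_Icc_at_left)
qed

lemma polylog_2_1: "polylog 2 1 = pi\<^sup>2 / 6"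
  using inverse_squares_sums by (simp add: polylog_def sums_iff add.commute)

section \<open>The arguments on the real triangle\<close>

text \<open>The functions \<open>l0\<close> and \<open>l1\<close> stand for the derivatives of \<open>log f\<close> and \<open>log (1 - f)\<close>. All
  derivatives of the multivalued functions below are linear in these two numbers, and for \<open>f = U
  i\<close> they are short combinations of four rational functions. No quotient of \<open>f\<close> then survives in
  a computation.\<close>

definition log_derivs :: "(complex \<Rightarrow> complex) \<Rightarrow> complex \<Rightarrow> complex \<Rightarrow> complex \<Rightarrow> bool" where
  "log_derivs f w l0 l1 \<longleftrightarrow> f w \<in> Omega \<and> (f has_field_derivative f w * l0) (at w)
     \<and> f w * l0 = - (1 - f w) * l1"

lemma DERIV_chain_log_derivs:
  assumes "log_derivs f w l0 l1"
  shows DERIV_Log_chain: "((\<lambda>w. Log (f w)) has_field_derivative l0) (at w)"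
    and DERIV_Log1m_chain: "((\<lambda>w. Log1m (f w)) has_field_derivative l1) (at w)"
    and DERIV_Li_2_chain: "((\<lambda>w. Li 2 (f w)) has_field_derivative - Log1m (f w) * l0) (at w)"
    and DERIV_Li_3_chain: "((\<lambda>w. Li 3 (f w)) has_field_derivative Li 2 (f w) * l0) (at w)"
proof -
  have f: "f w \<in> Omega" "(f has_field_derivative f w * l0) (at w)"
    and eq: "f w * l0 = - (1 - f w) * l1"
    using assms unfolding log_derivs_def by blast+
  then have nz: "f w \<noteq> 0" "1 - f w \<noteq> 0"
    by (auto simp: Omega_iff complex_eq_iff)
  show "((\<lambda>w. Log (f w)) has_field_derivative l0) (at w)"
    using DERIV_chain2[OF DERIV_Log[OF f(1)] f(2)] nz by simp
  show "((\<lambda>w. Log1m (f w)) has_field_derivative l1) (at w)"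
    by (rule DERIV_cong[OF DERIV_chain2[OF DERIV_Log1m[OF f(1)] f(2)]])
      (use nz eq in \<open>simp add: divide_simps; simp add: algebra_simps\<close>)
  show "((\<lambda>w. Li 2 (f w)) has_field_derivative - Log1m (f w) * l0) (at w)"
    using DERIV_chain2[OF DERIV_Li[OF f(1), of 1] f(2)] nz Log1m_eq_Li[OF f(1)]
    by (simp add: numeral_2_eq_2)
  show "((\<lambda>w. Li 3 (f w)) has_field_derivative Li 2 (f w) * l0) (at w)"
    using DERIV_chain2[OF DERIV_Li[OF f(1), of 2] f(2)] nz
    by (simp add: numeral_2_eq_2 numeral_3_eq_3)
qed

text \<open>The dilogarithms cancel in the derivative of \<^const>\<open>g_fun\<close>; this is why the relation for \<open>g\<close>
  does not depend on relations between dilogarithms, whereas the one for \<open>h\<close> does.\<close>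

lemma DERIV_chain_tuple_functions:
  assumes "log_derivs f w l0 l1"
  shows DERIV_d_chain: "((\<lambda>w. d_fun (f w)) has_field_derivative
      (Log (f w) * l1 - Log1m (f w) * l0) / 2) (at w)"
    and DERIV_g_chain: "((\<lambda>w. g_fun (f w)) has_field_derivative
      (Log (f w) * Log1m (f w) * l0 - Log (f w) ^ 2 * l1) / 3) (at w)"
    and DERIV_h_chain: "((\<lambda>w. h_fun (f w)) has_field_derivative
      2 * Li 2 (f w) * l0 + Log (f w) ^ 2 * l1) (at w)"
  unfolding d_fun_def g_fun_def h_fun_def
  by (rule DERIV_cong, (rule derivative_intros DERIV_chain_log_derivs[OF assms])+,
      simp add: field_simps power2_eq_square)+

lemma DERIV_chain_tilde:
  assumes "log_derivs f w l0 l1"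
  shows DERIV_g_tilde_chain: "((\<lambda>w. g_tilde (f w)) has_field_derivative
      (Log (f w) * Log1m (f w) * l0 - Log (f w) ^ 2 * l1) / 3
      + ipi / 3 * Log1m (f w) * l0 + 2 * ipi / 3 * (Log (f w) * l1 - Log1m (f w) * l0)
          + pi2 / 3 * l1) (at w)"
    and DERIV_h_tilde_chain: "((\<lambda>w. h_tilde (f w)) has_field_derivative
      2 * Li 2 (f w) * l0 + Log (f w) ^ 2 * l1
      - 2 * ipi * Log1m (f w) * l0 - 2 * ipi * (Log (f w) * l1 - Log1m (f w) * l0) - pi2 * l1)
          (at w)"
  unfolding g_tilde_def h_tilde_def
  by (rule DERIV_cong, (rule derivative_intros DERIV_chain_log_derivs[OF assms]
      DERIV_chain_tuple_functions[OF assms])+,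
      simp add: field_simps power2_eq_square)+

lemma U_real:
  assumes "0 < x" "x < y" "y < (1::real)"
  defines "u \<equiv> U (of_real x, of_real y)"
  shows "u $ 1 = of_real x" "u $ 2 = of_real y" "u $ 3 = of_real (x / y)"
    "u $ 4 = of_real ((1 - y) / (1 - x))" "u $ 5 = of_real (x * (1 - y) / (y * (1 - x)))"
    "u $ 6 = of_real (x * y)" "u $ 7 = - of_real (x * (1 - y) / (1 - x))"
    "u $ 8 = - of_real ((1 - y) / (y * (1 - x)))"
    "u $ 9 = of_real (x * (1 - y) ^ 2 / (y * (1 - x) ^ 2))"
proof -
  have e: "c / (of_real x - 1) = - (c / (1 - of_real x))" for c :: complex
    by (subst minus_diff_eq[symmetric], subst divide_minus_right) simp
  show "u $ 1 = of_real x" "u $ 2 = of_real y" "u $ 3 = of_real (x / y)"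
    "u $ 4 = of_real ((1 - y) / (1 - x))" "u $ 5 = of_real (x * (1 - y) / (y * (1 - x)))"
    "u $ 6 = of_real (x * y)"
    "u $ 9 = of_real (x * (1 - y) ^ 2 / (y * (1 - x) ^ 2))"
    by (simp_all add: u_def U_def vector_9)
  show "u $ 7 = - of_real (x * (1 - y) / (1 - x))"
    unfolding u_def U_def vector_9 case_prod_conv e by simp
  show "u $ 8 = - of_real ((1 - y) / (y * (1 - x)))"
    unfolding u_def U_def vector_9 case_prod_conv divide_divide_eq_left[symmetric] e by simp
qed

lemma triangle_bounds:
  assumes "0 < x" "x < y" "y < (1::real)"
  shows "0 < x / y" "x / y < 1" "0 < (1 - y) / (1 - x)" "(1 - y) / (1 - x) < 1"
    "0 < x * (1 - y) / (y * (1 - x))" "x * (1 - y) / (y * (1 - x)) < 1"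
    "0 < x * y" "x * y < 1" "0 < x * (1 - y) / (1 - x)" "0 < (1 - y) / (y * (1 - x))"
    "0 < x * (1 - y) ^ 2 / (y * (1 - x) ^ 2)" "x * (1 - y) ^ 2 / (y * (1 - x) ^ 2) < 1"
proof -
  show a: "0 < x / y" "x / y < 1" "0 < (1 - y) / (1 - x)" "(1 - y) / (1 - x) < 1"
    "0 < x * (1 - y) / (y * (1 - x))" "0 < x * y" "0 < x * (1 - y) / (1 - x)" "0 < (1
        - y) / (y * (1 - x))"
    "0 < x * (1 - y) ^ 2 / (y * (1 - x) ^ 2)"
    using assms by simp_all
  show "x * y < 1"
    using mult_strict_mono[of x 1 y 1] assms by simp
  have "(x / y) * ((1 - y) / (1 - x)) < 1 * 1"
    by (rule mult_strict_mono) (use a in auto)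
  then show b: "x * (1 - y) / (y * (1 - x)) < 1"
    by simp
  have "(x * (1 - y) / (y * (1 - x))) * ((1 - y) / (1 - x)) < 1 * 1"
    by (rule mult_strict_mono) (use a b in auto)
  then show "x * (1 - y) ^ 2 / (y * (1 - x) ^ 2) < 1"
    by (simp add: power2_eq_square mult_ac)
qed

lemma Log_U:
  assumes T: "0 < x" "x < y" "y < (1::real)"
  defines "u \<equiv> U (of_real x, of_real y)"
  shows "Log (u $ 1) = of_real (ln x)" "Log (u $ 2) = of_real (ln y)" "Log (u $ 3)
      = of_real (ln x) - of_real (ln y)"
    "Log (u $ 4) = of_real (ln (1 - y)) - of_real (ln (1 - x))" "Log (u $ 5) = of_real (ln x)
        + of_real (ln (1 - y)) - of_real (ln y) - of_real (ln (1 - x))"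
    "Log (u $ 6) = of_real (ln x) + of_real (ln y)" "Log (u $ 7) = of_real (ln x) + of_real (ln (1
        - y)) - of_real (ln (1 - x)) + ipi"
    "Log (u $ 8) = of_real (ln (1 - y)) - of_real (ln y) - of_real (ln (1 - x)) + ipi"
    "Log (u $ 9) = of_real (ln x) + 2 * of_real (ln (1 - y)) - of_real (ln y) - 2 * of_real (ln (1
        - x))"
proof -
  have pos: "0 < x" "x < 1" "0 < y" "y < 1" "0 < 1 - x" "0 < 1 - y"
    using T by auto
  have "ln (x / y) = ln x - ln y" "ln ((1 - y) / (1 - x)) = ln (1 - y) - ln (1 - x)"
    "ln (x * (1 - y) / (y * (1 - x))) = ln x + ln (1 - y) - ln y - ln (1 - x)"
    "ln (x * y) = ln x + ln y" "ln (x * (1 - y) / (1 - x)) = ln x + ln (1 - y) - ln (1 - x)"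
    "ln ((1 - y) / (y * (1 - x))) = ln (1 - y) - ln y - ln (1 - x)"
    "ln (x * (1 - y) ^ 2 / (y * (1 - x) ^ 2)) = ln x + 2 * ln (1 - y) - ln y - 2 * ln (1 - x)"
    using pos by (simp_all add: ln_div ln_mult ln_realpow)
  note lns = this
  show "Log (u $ 1) = of_real (ln x)" "Log (u $ 2) = of_real (ln y)" "Log (u $ 3) = of_real (ln x)
      - of_real (ln y)"
    "Log (u $ 4) = of_real (ln (1 - y)) - of_real (ln (1 - x))" "Log (u $ 5) = of_real (ln x)
        + of_real (ln (1 - y)) - of_real (ln y) - of_real (ln (1 - x))"
    "Log (u $ 6) = of_real (ln x) + of_real (ln y)" "Log (u $ 7) = of_real (ln x) + of_real (ln (1
        - y)) - of_real (ln (1 - x)) + ipi"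
    "Log (u $ 8) = of_real (ln (1 - y)) - of_real (ln y) - of_real (ln (1 - x)) + ipi"
    "Log (u $ 9) = of_real (ln x) + 2 * of_real (ln (1 - y)) - of_real (ln y) - 2 * of_real (ln (1
        - x))"
    by (simp_all only: u_def U_real[OF T] Log_of_real Log_of_real_neg triangle_bounds[OF T] pos lns
        of_real_diff of_real_add of_real_mult[of 2] of_real_numeral)
qed

lemma one_minus_U:
  assumes T: "0 < x" "x < y" "y < (1::real)"
  shows "1 - x / y = (y - x) / y" "1 - (1 - y) / (1 - x) = (y - x) / (1 - x)"
    "1 - x * (1 - y) / (y * (1 - x)) = (y - x) / (y * (1 - x))"
    "1 + x * (1 - y) / (1 - x) = (1 - x * y) / (1 - x)"
    "1 + (1 - y) / (y * (1 - x)) = (1 - x * y) / (y * (1 - x))"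
    "1 - x * (1 - y) ^ 2 / (y * (1 - x) ^ 2) = (y - x) * (1 - x * y) / (y * (1 - x) ^ 2)"
  using T by (simp_all add: divide_simps) (simp_all add: algebra_simps power2_eq_square)

lemma Log1m_U:
  assumes T: "0 < x" "x < y" "y < (1::real)"
  defines "u \<equiv> U (of_real x, of_real y)"
  shows "Log1m (u $ 1) = of_real (ln (1 - x))" "Log1m (u $ 2) = of_real (ln (1 - y))"
    "Log1m (u $ 3) = of_real (ln (y - x)) - of_real (ln y)" "Log1m (u $ 4) = of_real (ln (y - x))
        - of_real (ln (1 - x))"
    "Log1m (u $ 5) = of_real (ln (y - x)) - of_real (ln y) - of_real (ln (1 - x))" "Log1m (u $ 6)
        = of_real (ln (1 - x * y))"
    "Log1m (u $ 7) = of_real (ln (1 - x * y)) - of_real (ln (1 - x))"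
    "Log1m (u $ 8) = of_real (ln (1 - x * y)) - of_real (ln y) - of_real (ln (1 - x))"
    "Log1m (u $ 9) = of_real (ln (y - x)) + of_real (ln (1 - x * y)) - of_real (ln y)
        - 2 * of_real (ln (1 - x))"
proof -
  have pos: "0 < x" "x < 1" "0 < y" "y < 1" "0 < 1 - x" "0 < 1 - y" "0 < y - x" "0 < 1 - x * y"
    using T triangle_bounds(8)[OF T] by auto
  have "ln ((y - x) / y) = ln (y - x) - ln y" "ln ((y - x) / (1 - x)) = ln (y - x) - ln (1 - x)"
    "ln ((y - x) / (y * (1 - x))) = ln (y - x) - ln y - ln (1 - x)"
    "ln ((1 - x * y) / (1 - x)) = ln (1 - x * y) - ln (1 - x)"
    "ln ((1 - x * y) / (y * (1 - x))) = ln (1 - x * y) - ln y - ln (1 - x)"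
    "ln ((y - x) * (1 - x * y) / (y * (1 - x) ^ 2)) = ln (y - x) + ln (1 - x * y) - ln y
        - 2 * ln (1 - x)"
    using pos by (simp_all add: ln_div ln_mult ln_realpow)
  note lns = this
  show "Log1m (u $ 1) = of_real (ln (1 - x))" "Log1m (u $ 2) = of_real (ln (1 - y))"
    "Log1m (u $ 3) = of_real (ln (y - x)) - of_real (ln y)" "Log1m (u $ 4) = of_real (ln (y - x))
        - of_real (ln (1 - x))"
    "Log1m (u $ 5) = of_real (ln (y - x)) - of_real (ln y) - of_real (ln (1 - x))" "Log1m (u $ 6)
        = of_real (ln (1 - x * y))"
    "Log1m (u $ 7) = of_real (ln (1 - x * y)) - of_real (ln (1 - x))"
    "Log1m (u $ 8) = of_real (ln (1 - x * y)) - of_real (ln y) - of_real (ln (1 - x))"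
    "Log1m (u $ 9) = of_real (ln (y - x)) + of_real (ln (1 - x * y)) - of_real (ln y)
        - 2 * of_real (ln (1 - x))"
    by (simp_all only: u_def U_real[OF T] Log1m_of_real Log1m_of_real_neg triangle_bounds[OF T] pos
        one_minus_U[OF T] lns of_real_diff of_real_add of_real_mult[of 2] of_real_numeral)
qed

lemma U_in_Omega:
  assumes T: "0 < x" "x < y" "y < (1::real)"
  shows "U (of_real x, of_real y) $ i \<in> Omega"
proof -
  have pos: "0 < y" "x < 1" using T by auto
  show ?thesis
    by (rule index_9_cases[where P = "\<lambda>i. U (of_real x, of_real y) $ i
        \<in> Omega"], unfold U_real[OF T])
      (simp_all only: real_in_Omega neg_real_in_Omega triangle_bounds[OF T] T pos)
qed

text \<open>For fixed \<open>x\<close>, the four rational functions \<open>r = 1/y\<close>, \<open>s = 1/(1 - y)\<close>, \<open>q = 1/(y - x)\<close> and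
  \<open>v = -x/(1 - x * y)\<close> span all logarithmic derivatives of \<open>U i\<close> and \<open>1 - U i\<close>. They are
  returned as unspecified numbers: the identities checked with them are polynomial identities in
  independent variables.\<close>

lemma log_derivs_U:
  assumes T: "0 < x" "x < y" "y < (1::real)"
  obtains r s v q where
    "log_derivs (\<lambda>w. U (of_real x, w) $ 1) (of_real y) 0 0"
    "log_derivs (\<lambda>w. U (of_real x, w) $ 2) (of_real y) r (- s)"
    "log_derivs (\<lambda>w. U (of_real x, w) $ 3) (of_real y) (- r) (q - r)"
    "log_derivs (\<lambda>w. U (of_real x, w) $ 4) (of_real y) (- s) q"
    "log_derivs (\<lambda>w. U (of_real x, w) $ 5) (of_real y) (- s - r) (q - r)"
    "log_derivs (\<lambda>w. U (of_real x, w) $ 6) (of_real y) r v"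
    "log_derivs (\<lambda>w. U (of_real x, w) $ 7) (of_real y) (- s) v"
    "log_derivs (\<lambda>w. U (of_real x, w) $ 8) (of_real y) (- s - r) (v - r)"
    "log_derivs (\<lambda>w. U (of_real x, w) $ 9) (of_real y) (- 2 * s - r) (q + v - r)"
proof -
  define a b where "a = complex_of_real x" and "b = complex_of_real y"
  have "a * b \<noteq> 1"
    using triangle_bounds(8)[OF T] unfolding a_def b_def of_real_mult[symmetric] of_real_eq_1_iff
        by simp
  then have nz: "a \<noteq> 1" "b \<noteq> 1" "a \<noteq> b" "b \<noteq> a" "a * b \<noteq> 1" "b * a \<noteq> 1" "a - 1 \<noteq> 0" "1 \<noteq> a" "1 \<noteq> b"
    "b \<noteq> 0" "1 - a \<noteq> 0" "1 - b \<noteq> 0" "b - a \<noteq> 0" "1 - a * b \<noteq> 0"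
    using T by (auto simp: a_def b_def mult.commute)
  have O: "U (a, b) $ i \<in> Omega" for i
    unfolding a_def b_def by (rule U_in_Omega[OF T])
  show ?thesis
    by (rule that[of "1 / b" "1 / (1 - b)" "1 / (b - a)" "- a / (1 - a * b)"];
        fold a_def b_def; simp only: log_derivs_def O simp_thms; rule conjI;
        unfold U_def vector_9 case_prod_conv;
        ((rule DERIV_cong, (rule derivative_intros | simp add: nz)+,
           ((simp add: nz divide_simps)?, (simp add: algebra_simps power2_eq_square
               power4_eq_xxxx)?)?)
         | ((simp add: nz divide_simps)?, (simp add: algebra_simps power2_eq_square)?)))
qed

section \<open>Limits at the boundary of the triangle\<close>

lemma vanishes_by_derivative:
  fixes \<Phi> :: "complex \<Rightarrow> complex"
  assumes y: "x < y" "y < (1::real)"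
    and D: "\<And>y. x < y \<Longrightarrow> y < 1 \<Longrightarrow> (\<Phi> has_field_derivative 0) (at (of_real y))"
    and lim: "((\<lambda>y. \<Phi> (of_real y)) \<longlongrightarrow> 0) (at_left (1::real))"
  shows "\<Phi> (of_real y) = 0"
proof -
  have "((\<lambda>y. \<Phi> (of_real y)) has_vector_derivative 0) (at t within {x<..<1})" if "t \<in> {x<..<1}"
      for t
    using D[of t] that by (intro has_vector_derivative_real_field) auto
  then obtain c where c: "\<And>t. t \<in> {x<..<1} \<Longrightarrow> \<Phi> (of_real t) = c"
    using has_vector_derivative_zero_constant[OF convex_real_interval(8), of x 1
        "\<lambda>y. \<Phi> (of_real y)"]
    by metis
  have "\<forall>\<^sub>F t in at_left 1. \<Phi> (of_real t) = c"
    using y c by (auto simp: eventually_at_left_field intro!: exI[of _ x])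
  then have "((\<lambda>y. \<Phi> (of_real y)) \<longlongrightarrow> c) (at_left 1)"
    by (rule tendsto_eventually)
  then have "c = 0"
    using lim by (rule tendsto_unique[rotated]) simp
  then show ?thesis
    using c y by simp
qed

text \<open>The constants in \<^const>\<open>g_tilde\<close> and \<^const>\<open>h_tilde\<close> are those for which \<open>g_tilde\<close> has the same
  limit as \<open>g\<close> at 0, and \<open>h_tilde\<close> the same as \<open>h\<close>.\<close>

lemma tendsto_at_0:
  shows tendsto_Li_0: "(Li n \<longlongrightarrow> 0) (at 0 within Omega)"
    and tendsto_Log1m_0: "(Log1m \<longlongrightarrow> 0) (at 0 within Omega)"
    and tendsto_d_0: "(d_fun \<longlongrightarrow> - (pi2 / 6)) (at 0 within Omega)"
    and tendsto_g_0: "(g_fun \<longlongrightarrow> - (2/9 * of_real (polylog 3 1))) (at 0 within Omega)"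
    and tendsto_h_0: "(h_fun \<longlongrightarrow> 0) (at 0 within Omega)"
    and tendsto_g_tilde_0: "(g_tilde \<longlongrightarrow> - (2/9 * of_real (polylog 3 1))) (at 0 within Omega)"
    and tendsto_h_tilde_0: "(h_tilde \<longlongrightarrow> 0) (at 0 within Omega)"
proof -
  have Omega: "\<forall>\<^sub>F z in at 0 within Omega. z \<in> Omega"
    by (simp add: eventually_at_filter)
  have Log1m: "\<forall>\<^sub>F z in at 0 within Omega. - (Log z ^ m * Li 1 z) = Log z ^ m * Log1m z" for m
    using Omega by eventually_elim (simp add: Log1m_eq_Li)
  show Li: "(Li n \<longlongrightarrow> 0) (at 0 within Omega)" for n
    using tendsto_Log_power_Li[of 0 n] by simp
  have LLi: "((\<lambda>z. Log z * Li n z) \<longlongrightarrow> 0) (at 0 within Omega)" for n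
    using tendsto_Log_power_Li[of 1 n] by simp
  have M: "((\<lambda>z. Log z ^ m * Log1m z) \<longlongrightarrow> 0) (at 0 within Omega)" if "m \<le> 2" for m
    using Lim_transform_eventually[OF tendsto_minus[OF tendsto_Log_power_Li[OF that, of 1]] Log1m]
        by simp
  show Log1m: "(Log1m \<longlongrightarrow> 0) (at 0 within Omega)"
    using M[of 0] by simp
  have M1: "((\<lambda>z. Log z * Log1m z) \<longlongrightarrow> 0) (at 0 within Omega)"
    using M[of 1] by simp
  note lims = Li LLi M1 M[of 2, simplified] Log1m
  show d: "(d_fun \<longlongrightarrow> - (pi2 / 6)) (at 0 within Omega)"
    unfolding d_fun_def mult.assoc by (rule tendsto_eq_intros lims refl | simp)+
  show g: "(g_fun \<longlongrightarrow> - (2/9 * of_real (polylog 3 1))) (at 0 within Omega)"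
    unfolding g_fun_def mult.assoc by (rule tendsto_eq_intros lims refl | simp)+
  show h: "(h_fun \<longlongrightarrow> 0) (at 0 within Omega)"
    unfolding h_fun_def mult.assoc by (rule tendsto_eq_intros lims refl | simp)+
  show "(g_tilde \<longlongrightarrow> - (2/9 * of_real (polylog 3 1))) (at 0 within Omega)"
    unfolding g_tilde_def by (rule tendsto_eq_intros lims d g refl | simp add: power3_eq_cube
        power2_eq_square)+
  show "(h_tilde \<longlongrightarrow> 0) (at 0 within Omega)"
    unfolding h_tilde_def by (rule tendsto_eq_intros lims d h refl | simp add: power3_eq_cube
        power2_eq_square)+
qed

lemma tendsto_at_1:
  shows tendsto_Log_1: "((\<lambda>y. Log (of_real y)) \<longlongrightarrow> 0) (at_left (1::real))"
    and tendsto_Log_Log1m_1: "((\<lambda>y. Log (of_real y) * Log1m (of_real y)) \<longlongrightarrow> 0) (at_left (1::real))"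
    and tendsto_Li_2_1: "((\<lambda>y. Li 2 (of_real y)) \<longlongrightarrow> pi2 / 6) (at_left (1::real))"
    and tendsto_d_1: "((\<lambda>y. d_fun (of_real y)) \<longlongrightarrow> 0) (at_left (1::real))"
    and tendsto_g_1: "((\<lambda>y. g_fun (of_real y)) \<longlongrightarrow> 7/9 * of_real (polylog 3 1)) (at_left (1::real))"
    and tendsto_h_1: "((\<lambda>y. h_fun (of_real y)) \<longlongrightarrow> 0) (at_left (1::real))"
proof -
  have transfer_limit: "((\<lambda>y. F (of_real y)) \<longlongrightarrow> of_real l) (at_left (1::real))"
    if "(f \<longlongrightarrow> l) (at_left 1)" "\<And>y. 0 < y \<Longrightarrow> y < 1 \<Longrightarrow> F (of_real y) = of_real (f y)"
    for F :: "complex \<Rightarrow> complex" and f l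
  proof (rule Lim_transform_eventually[OF tendsto_of_real[OF that(1)]])
    show "\<forall>\<^sub>F y in at_left 1. of_real (f y) = F (of_real y)"
      using that(2) by (auto simp: eventually_at_left_field intro!: exI[of _ 0])
  qed
  have "((\<lambda>y::real. ln y) \<longlongrightarrow> 0) (at_left 1)" "((\<lambda>y::real. ln y * ln (1 - y)) \<longlongrightarrow> 0) (at_left 1)"
    "((\<lambda>y::real. ln y ^ 2 * ln (1 - y)) \<longlongrightarrow> 0) (at_left 1)"
    by real_asymp+
  note real = this
  show L: "((\<lambda>y. Log (of_real y)) \<longlongrightarrow> 0) (at_left (1::real))"
    using transfer_limit[OF real(1), of Log] by (simp add: Log_of_real)
  show LM: "((\<lambda>y. Log (of_real y) * Log1m (of_real y)) \<longlongrightarrow> 0) (at_left (1::real))"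
    using transfer_limit[OF real(2), of "\<lambda>z. Log z * Log1m z"] by
        (simp add: Log_of_real Log1m_of_real)
  have LLM: "((\<lambda>y. Log (of_real y) ^ 2 * Log1m (of_real y)) \<longlongrightarrow> 0) (at_left (1::real))"
    using transfer_limit[OF real(3), of "\<lambda>z. Log z ^ 2 * Log1m z"] by
        (simp add: Log_of_real Log1m_of_real)
  have Li: "((\<lambda>y. Li n (of_real y)) \<longlongrightarrow> of_real (polylog n 1)) (at_left (1::real))" if "n \<ge> 2" for n
    using continues_Li[of n] by (intro transfer_limit[OF tendsto_polylog_1[OF that]]) (simp add:
        continues_def)
  show Li2: "((\<lambda>y. Li 2 (of_real y)) \<longlongrightarrow> pi2 / 6) (at_left (1::real))"
    using Li[of 2] by (simp add: polylog_2_1)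
  note lims = L LM LLM Li2 Li[of 3]
  show "((\<lambda>y. d_fun (of_real y)) \<longlongrightarrow> 0) (at_left (1::real))"
    unfolding d_fun_def mult.assoc by (rule tendsto_eq_intros lims refl | simp)+
  show "((\<lambda>y. g_fun (of_real y)) \<longlongrightarrow> 7/9 * of_real (polylog 3 1)) (at_left (1::real))"
    unfolding g_fun_def mult.assoc by (rule tendsto_eq_intros lims refl | simp)+
  show "((\<lambda>y. h_fun (of_real y)) \<longlongrightarrow> 0) (at_left (1::real))"
    unfolding h_fun_def mult.assoc by (rule tendsto_eq_intros lims refl | simp)+
qed

lemma tendsto_U_at_left_1:
  fixes F :: "complex \<Rightarrow> complex"
  assumes x: "0 < x" "x < (1::real)"
  shows tendsto_U_to_0: "(F \<longlongrightarrow> l) (at 0 within Omega) \<Longrightarrow> i \<in> {4, 5, 7, 8, 9} \<Longrightarrow>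
      ((\<lambda>y. F (U (of_real x, of_real y) $ i)) \<longlongrightarrow> l) (at_left (1::real))"
    and tendsto_U_to_x: "F holomorphic_on Omega \<Longrightarrow> i \<in> {1, 3, 6} \<Longrightarrow>
      ((\<lambda>y. F (U (of_real x, of_real y) $ i)) \<longlongrightarrow> F (of_real x)) (at_left (1::real))"
    and tendsto_U_to_1: "((\<lambda>y. F (of_real y)) \<longlongrightarrow> l) (at_left (1::real)) \<Longrightarrow>
      ((\<lambda>y. F (U (of_real x, of_real y) $ 2)) \<longlongrightarrow> l) (at_left (1::real))"
proof -
  have nz: "complex_of_real x \<noteq> 0" "complex_of_real x \<noteq> 1" "1 - complex_of_real x \<noteq> 0"
    "complex_of_real x - 1 \<noteq> 0"
    using x by auto
  have cont: "((\<lambda>y. U (of_real x, of_real y) $ i) \<longlongrightarrow> U (of_real x, 1) $ i) (at_left (1::real))" for i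
  proof -
    have "isCont (\<lambda>w. U (of_real x, w) $ i) 1" (is "?P i")
      by (rule index_9_cases[where P = ?P]; unfold U_def vector_9 case_prod_conv;
          use x in \<open>auto intro!: continuous_intros\<close>)
    moreover have "((\<lambda>y. complex_of_real y) \<longlongrightarrow> 1) (at_left 1)"
      by (rule tendsto_eq_intros refl | simp)+
    ultimately show ?thesis
      by (rule isCont_tendsto_compose)
  qed
  have ev: "\<forall>\<^sub>F y in at_left 1. U (of_real x, of_real y) $ i \<in> Omega" for i
    using U_in_Omega x by (auto simp: eventually_at_left_field intro!: exI[of _ x])
  show "((\<lambda>y. F (U (of_real x, of_real y) $ i)) \<longlongrightarrow> l) (at_left (1::real))"
    if "(F \<longlongrightarrow> l) (at 0 within Omega)" "i \<in> {4, 5, 7, 8, 9}"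
  proof (rule filterlim_compose[OF that(1)])
    have "U (of_real x, 1) $ i = 0"
      using that(2) by (auto simp: U_def vector_9)
    moreover have "\<forall>\<^sub>F y in at_left 1. U (of_real x, of_real y) $ i \<in> Omega
        \<and> U (of_real x, of_real y) $ i \<noteq> 0"
      using ev[of i] by eventually_elim (auto simp: Omega_iff)
    ultimately show "filterlim (\<lambda>y. U (of_real x, of_real y) $ i)
        (at 0 within Omega) (at_left (1::real))"
      unfolding filterlim_at using cont[of i] by simp
  qed
  show "((\<lambda>y. F (U (of_real x, of_real y) $ i)) \<longlongrightarrow> F (of_real x)) (at_left (1::real))"
    if "F holomorphic_on Omega" "i \<in> {1, 3, 6}"
  proof -
    have "isCont F (of_real x)"
      using that(1) x real_in_Omega open_Omega
      by (meson continuous_on_eq_continuous_at holomorphic_on_imp_continuous_on)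
    moreover have "U (of_real x, 1) $ i = of_real x"
      using that(2) by (auto simp: U_def vector_9)
    ultimately show ?thesis
      using cont[of i] by (auto intro: isCont_tendsto_compose)
  qed
  show "((\<lambda>y. F (U (of_real x, of_real y) $ 2)) \<longlongrightarrow> l) (at_left (1::real))"
    if "((\<lambda>y. F (of_real y)) \<longlongrightarrow> l) (at_left (1::real))"
    using that by (simp add: U_def vector_9)
qed

section \<open>Functional equations on the triangle\<close>

lemmas DERIV_chains = DERIV_d_chain DERIV_g_chain DERIV_h_chain DERIV_g_tilde_chain
    DERIV_h_tilde_chain
  DERIV_Log_chain DERIV_Log1m_chain DERIV_Li_2_chain

lemmas DERIV_arith = DERIV_const DERIV_add DERIV_diff DERIV_minus DERIV_cmult DERIV_cdivide
    DERIV_mult DERIV_power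

context
  fixes x :: real
  assumes x: "0 < x" "x < 1"
begin

lemmas U_limits = tendsto_d_0[THEN tendsto_U_to_0[OF x]] tendsto_Li_0[THEN tendsto_U_to_0[OF x]]
  tendsto_Log1m_0[THEN tendsto_U_to_0[OF x]]
  tendsto_g_0[THEN tendsto_U_to_0[OF x]] tendsto_g_tilde_0[THEN tendsto_U_to_0[OF x]]
  tendsto_h_0[THEN tendsto_U_to_0[OF x]] tendsto_h_tilde_0[THEN tendsto_U_to_0[OF x]]
  holomorphic_pieces[THEN tendsto_U_to_x[OF x]]
  tendsto_Log_1[THEN tendsto_U_to_1[OF x]] tendsto_Log_Log1m_1[THEN tendsto_U_to_1[OF x]]
  tendsto_Li_2_1[THEN tendsto_U_to_1[OF x]]
  tendsto_d_1[THEN tendsto_U_to_1[OF x]] tendsto_g_1[THEN tendsto_U_to_1[OF x]]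
  tendsto_h_1[THEN tendsto_U_to_1[OF x]]

abbreviation (input) u :: "9 \<Rightarrow> complex \<Rightarrow> complex" where
  "u i w \<equiv> U (of_real x, w) $ i"

lemma vanishes_on_fibre:
  fixes \<Phi> :: "complex \<Rightarrow> complex"
  assumes "x < y" "y < 1"
    and D: "\<And>y r s v q. x < y \<Longrightarrow> y < 1 \<Longrightarrow>
      log_derivs (u 1) (of_real y) 0 0 \<Longrightarrow>
      log_derivs (u 2) (of_real y) r (- s) \<Longrightarrow>
      log_derivs (u 3) (of_real y) (- r) (q - r) \<Longrightarrow>
      log_derivs (u 4) (of_real y) (- s) q \<Longrightarrow>
      log_derivs (u 5) (of_real y) (- s - r) (q - r) \<Longrightarrow>
      log_derivs (u 6) (of_real y) r v \<Longrightarrow>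
      log_derivs (u 7) (of_real y) (- s) v \<Longrightarrow>
      log_derivs (u 8) (of_real y) (- s - r) (v - r) \<Longrightarrow>
      log_derivs (u 9) (of_real y) (- 2 * s - r) (q + v - r) \<Longrightarrow>
      (\<Phi> has_field_derivative 0) (at (of_real y))"
    and lim: "((\<lambda>y. \<Phi> (of_real y)) \<longlongrightarrow> 0) (at_left 1)"
  shows "\<Phi> (of_real y) = 0"
proof (rule vanishes_by_derivative[OF assms(1,2)])
  show "(\<Phi> has_field_derivative 0) (at (of_real y))" if y: "x < y" "y < 1" for y
    by (rule log_derivs_U[OF x(1) y]) (rule D[OF y])
qed (rule lim)

text \<open>Abel's five-term relation for the Rogers dilogarithm \<^const>\<open>d_fun\<close>. The names of the next five
  relations list the indices of the \<open>U i\<close> in which a dilogarithm occurs.\<close>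

lemma rogers_five_term:
  assumes y: "x < y" "y < 1"
  defines "w \<equiv> complex_of_real y"
  shows "d_fun (u 1 w) - d_fun (u 2 w) - d_fun (u 3 w) - d_fun (u 4 w) + d_fun (u 5 w) = 0"
  unfolding w_def
proof (rule vanishes_on_fibre[OF y, where \<Phi> = "\<lambda>w. d_fun (u 1 w) - d_fun (u 2 w) - d_fun (u 3 w)
    - d_fun (u 4 w) + d_fun (u 5 w)"], goal_cases)
  case (1 y r s v q)
  then show ?case
    by - (rule DERIV_cong, (rule DERIV_arith DERIV_chains | assumption)+,
      simp only: Log_U[OF x(1)] Log1m_U[OF x(1)],
      simp add: algebra_simps add_divide_distrib diff_divide_distrib power2_eq_square)
next
  case 2
  show ?case
    by (rule tendsto_eq_intros U_limits refl | simp)+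
qed

lemma rogers_relation_12678:
  assumes y: "x < y" "y < 1"
  defines "w \<equiv> complex_of_real y"
  shows "d_fun (u 1 w) + d_fun (u 2 w) - ipi / 2 * Log (u 2 w) - d_fun (u 6 w) + d_fun (u 7 w)
      - d_fun (u 8 w) = 0"
  unfolding w_def
proof (rule vanishes_on_fibre[OF y, where \<Phi> = "\<lambda>w. d_fun (u 1 w) + d_fun (u 2 w)
    - ipi / 2 * Log (u 2 w) - d_fun (u 6 w) + d_fun (u 7 w) - d_fun (u 8 w)"], goal_cases)
  case (1 y r s v q)
  then show ?case
    by - (rule DERIV_cong, (rule DERIV_arith DERIV_chains | assumption)+,
      simp only: Log_U[OF x(1)] Log1m_U[OF x(1)],
      simp add: algebra_simps add_divide_distrib diff_divide_distrib power2_eq_square)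
next
  case 2
  show ?case
    by (rule tendsto_eq_intros U_limits refl | simp)+
qed

text \<open>Here and in \<open>Li_2_relation_12678\<close>, the logarithms of \<open>U 4\<close> and \<open>U 8\<close> in the tuple are
  singular as \<open>y\<close> tends to 1. Since \<open>U 4 = - y * U 8\<close>, their combination can be written with
  \<open>Log (U 2)\<close> alone, and each term below has a limit.\<close>

lemma rogers_relation_45789:
  assumes y: "x < y" "y < 1"
  defines "w \<equiv> complex_of_real y"
  shows "d_fun (u 4 w) + d_fun (u 5 w) + d_fun (u 7 w) + d_fun (u 8 w) - d_fun (u 9 w)
      - ipi / 2 * Log (u 2 w) - ipi * Log1m (u 8 w) + pi2 / 2 = 0"
  unfolding w_def
proof (rule vanishes_on_fibre[OF y, where \<Phi> = "\<lambda>w. d_fun (u 4 w) + d_fun (u 5 w) + d_fun (u 7 w)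
    + d_fun (u 8 w) - d_fun (u 9 w) - ipi / 2 * Log (u 2 w) - ipi * Log1m (u 8 w)
    + pi2 / 2"], goal_cases)
  case (1 y r s v q)
  then show ?case
    by - (rule DERIV_cong, (rule DERIV_arith DERIV_chains | assumption)+,
      simp only: Log_U[OF x(1)] Log1m_U[OF x(1)],
      simp add: algebra_simps add_divide_distrib diff_divide_distrib power2_eq_square)
next
  case 2
  show ?case
    by (rule tendsto_eq_intros U_limits refl | simp)+
qed

lemma Li_2_relation_12678:
  assumes y: "x < y" "y < 1"
  defines "w \<equiv> complex_of_real y"
  shows "Li 2 (u 1 w) + Li 2 (u 2 w) - Li 2 (u 6 w) + Li 2 (u 7 w) - Li 2 (u 8 w)
      + (Log (u 2 w) * Log1m (u 2 w) - Log (u 2 w) * Log1m (u 1 w))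
      - Log (u 2 w) * Log (u 2 w) / 2 - pi2 / 6 = 0"
  unfolding w_def
proof (rule vanishes_on_fibre[OF y, where \<Phi> = "\<lambda>w. Li 2 (u 1 w) + Li 2 (u 2 w) - Li 2 (u 6 w)
    + Li 2 (u 7 w) - Li 2 (u 8 w) + (Log (u 2 w) * Log1m (u 2 w) - Log (u 2 w) * Log1m (u 1 w))
    - Log (u 2 w) * Log (u 2 w) / 2 - pi2 / 6"], goal_cases)
  case (1 y r s v q)
  then show ?case
    by - (rule DERIV_cong, (rule DERIV_arith DERIV_chains | assumption)+,
      simp only: Log_U[OF x(1)] Log1m_U[OF x(1)],
      simp add: algebra_simps add_divide_distrib diff_divide_distrib power2_eq_square)
next
  case 2
  show ?case
    by (rule tendsto_eq_intros U_limits refl | simp)+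
qed

lemma Li_2_relation_45789:
  assumes y: "x < y" "y < 1"
  defines "w \<equiv> complex_of_real y"
  shows "Log (u 2 w) * Log (u 2 w) / 2 + Li 2 (u 4 w) + Li 2 (u 5 w) + Li 2 (u 7 w) + Li 2 (u 8 w)
      - Li 2 (u 9 w) = 0"
  unfolding w_def
proof (rule vanishes_on_fibre[OF y, where \<Phi> = "\<lambda>w. Log (u 2 w) * Log (u 2 w) / 2 + Li 2 (u 4 w)
    + Li 2 (u 5 w) + Li 2 (u 7 w) + Li 2 (u 8 w) - Li 2 (u 9 w)"], goal_cases)
  case (1 y r s v q)
  then show ?case
    by - (rule DERIV_cong, (rule DERIV_arith DERIV_chains | assumption)+,
      simp only: Log_U[OF x(1)] Log1m_U[OF x(1)],
      simp add: algebra_simps add_divide_distrib diff_divide_distrib power2_eq_square)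
next
  case 2
  show ?case
    by (rule tendsto_eq_intros U_limits refl | simp)+
qed

lemma Li_2_relation_135679:
  assumes y: "x < y" "y < 1"
  defines "w \<equiv> complex_of_real y"
  shows "2 * Li 2 (u 1 w) - Li 2 (u 3 w) + 2 * Li 2 (u 5 w) - Li 2 (u 6 w) + 2 * Li 2 (u 7 w)
      - Li 2 (u 9 w) = 0"
  unfolding w_def
proof (rule vanishes_on_fibre[OF y, where \<Phi> = "\<lambda>w. 2 * Li 2 (u 1 w) - Li 2 (u 3 w)
    + 2 * Li 2 (u 5 w) - Li 2 (u 6 w) + 2 * Li 2 (u 7 w) - Li 2 (u 9 w)"], goal_cases)
  case (1 y r s v q)
  then show ?case
    by - (rule DERIV_cong, (rule DERIV_arith DERIV_chains | assumption)+,
      simp only: Log_U[OF x(1)] Log1m_U[OF x(1)],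
      simp add: algebra_simps add_divide_distrib diff_divide_distrib power2_eq_square)
next
  case 2
  show ?case
    by (rule tendsto_eq_intros U_limits refl | simp)+
qed

text \<open>The classical nine-term equation of Spence and Kummer in the version for \<open>g\<close>, with
  \<open>g_tilde\<close> on the two negative arguments.\<close>

lemma spence_kummer_g:
  assumes y: "x < y" "y < 1"
  defines "w \<equiv> complex_of_real y"
  shows "2 * g_fun (u 1 w) + 2 * g_fun (u 2 w) - g_fun (u 3 w) + 2 * g_fun (u 4 w)
      + 2 * g_fun (u 5 w) - g_fun (u 6 w) + 2 * g_tilde (u 7 w) + 2 * g_tilde (u 8 w)
      - g_fun (u 9 w) = 0"
  unfolding w_def
proof (rule vanishes_on_fibre[OF y, where \<Phi> = "\<lambda>w. 2 * g_fun (u 1 w) + 2 * g_fun (u 2 w)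
    - g_fun (u 3 w) + 2 * g_fun (u 4 w) + 2 * g_fun (u 5 w) - g_fun (u 6 w) + 2 * g_tilde (u 7 w)
    + 2 * g_tilde (u 8 w) - g_fun (u 9 w)"], goal_cases)
  case (1 y r s v q)
  then show ?case
    by - (rule DERIV_cong, (rule DERIV_arith DERIV_chains | assumption)+,
      simp only: Log_U[OF x(1)] Log1m_U[OF x(1)],
      simp add: algebra_simps add_divide_distrib diff_divide_distrib power2_eq_square)
next
  case 2
  show ?case
    by (rule tendsto_eq_intros U_limits refl | simp)+
qed

text \<open>The derivative of \<open>h\<close> contains dilogarithms. Grouped by \<open>r\<close> and \<open>s\<close>, they form exactly the
  three relations for \<open>Li 2\<close> above.\<close>

lemma spence_kummer_h:
  assumes y: "x < y" "y < 1"
  defines "w \<equiv> complex_of_real y"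
  shows "2 * h_fun (u 1 w) + 2 * h_fun (u 2 w) - 2 * pi2 / 3 * Log (u 2 w) - h_fun (u 3 w)
      + 2 * h_fun (u 4 w) + 2 * h_fun (u 5 w) - h_fun (u 6 w) + 2 * h_tilde (u 7 w)
      + 2 * h_tilde (u 8 w) - h_fun (u 9 w) = 0"
  unfolding w_def
proof (rule vanishes_on_fibre[OF y, where \<Phi> = "\<lambda>w. 2 * h_fun (u 1 w) + 2 * h_fun (u 2 w)
    - 2 * pi2 / 3 * Log (u 2 w) - h_fun (u 3 w) + 2 * h_fun (u 4 w) + 2 * h_fun (u 5 w)
    - h_fun (u 6 w) + 2 * h_tilde (u 7 w) + 2 * h_tilde (u 8 w) - h_fun (u 9 w)"], goal_cases)
  case (1 y r s v q)
  let ?w = "complex_of_real y"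
  have "((\<lambda>w. 2 * h_fun (u 1 w) + 2 * h_fun (u 2 w) - 2 * pi2 / 3 * Log (u 2 w) - h_fun (u 3 w)
      + 2 * h_fun (u 4 w) + 2 * h_fun (u 5 w) - h_fun (u 6 w) + 2 * h_tilde (u 7 w)
      + 2 * h_tilde (u 8 w) - h_fun (u 9 w)) has_field_derivative
      2 * r * (2 * (Li 2 (u 1 ?w) + Li 2 (u 2 ?w) - Li 2 (u 6 ?w) + Li 2 (u 7 ?w) - Li 2 (u 8 ?w)
          + (Log (u 2 ?w) * Log1m (u 2 ?w) - Log (u 2 ?w) * Log1m (u 1 ?w))
          - Log (u 2 ?w) * Log (u 2 ?w) / 2 - pi2 / 6) - (2 * Li 2 (u 1 ?w) - Li 2 (u 3 ?w)
          + 2 * Li 2 (u 5 ?w) - Li 2 (u 6 ?w) + 2 * Li 2 (u 7 ?w) - Li 2 (u 9 ?w)))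
          - 4 * s * (Log (u 2 ?w) * Log (u 2 ?w) / 2 + Li 2 (u 4 ?w) + Li 2 (u 5 ?w)
          + Li 2 (u 7 ?w) + Li 2 (u 8 ?w) - Li 2 (u 9 ?w))) (at ?w)"
    using 1
    by - (rule DERIV_cong, (rule DERIV_arith DERIV_chains | assumption)+,
      simp only: Log_U[OF x(1)] Log1m_U[OF x(1)],
      simp add: algebra_simps add_divide_distrib diff_divide_distrib power2_eq_square)
  then show ?case
    unfolding Li_2_relation_12678[OF 1(1,2)] Li_2_relation_45789[OF 1(1,2)]
        Li_2_relation_135679[OF 1(1,2)] by simp
next
  case 2
  show ?case
    by (rule tendsto_eq_intros U_limits refl | simp)+
qed

end

section \<open>Relations between germs\<close>

lemma sum_9: "(\<Sum>i\<in>(UNIV :: 9 set). f i) = f 1 + f 2 + f 3 + f 4 + f 5 + f 6 + f 7 + f 8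
    + (f 9 :: complex)"
  unfolding UNIV_9 by (simp add: add.assoc)

text \<open>The addition theorem \<open>artanh s + artanh t = artanh ((s + t) / (1 + s * t))\<close> for the square
  roots of \<open>U 6\<close> and \<open>U 9\<close>, whose combination is the square root of \<open>U 3\<close>.\<close>

lemma artanh_sqrt_relation:
  assumes T: "0 < x" "x < y" "y < (1::real)"
  shows "artanh (sqrt (x / y)) = artanh (sqrt (x * y)) + artanh (sqrt (x * (1 - y) ^ 2 / (y * (1
      - x) ^ 2)))"
proof -
  define a b where "a = sqrt x" and "b = sqrt y"
  have ab: "0 < a" "a < b" "b < 1" "x = a\<^sup>2" "y = b\<^sup>2"
    using T by (auto simp: a_def b_def)
  define s t where "s = a * b" and "t = a * (1 - b\<^sup>2) / (b * (1 - a\<^sup>2))"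
  have sq: "a\<^sup>2 < 1" "b\<^sup>2 < 1"
    using T ab by auto
  have s: "0 < s" "s < 1"
    using ab mult_strict_mono[of a 1 b 1] by (auto simp: s_def)
  have "0 < b * (1 - a\<^sup>2)" "0 < 1 - b\<^sup>2"
    using ab sq by auto
  moreover have "b * (1 - a\<^sup>2) - a * (1 - b\<^sup>2) = (b - a) * (1 + s)" "b * (1 - a\<^sup>2) + a * (1 - b\<^sup>2)
      = (a + b) * (1 - s)"
    by (simp_all add: s_def algebra_simps power2_eq_square)
  moreover have "0 < (b - a) * (1 + s)"
    using ab s by simp
  ultimately have t: "0 < t" "t < 1" "1 - t = (b - a) * (1 + s) / (b * (1 - a\<^sup>2))" "1 + t = (a
      + b) * (1 - s) / (b * (1 - a\<^sup>2))"
    using ab by (auto simp: t_def field_simps)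
  have "(1 + a / b) / (1 - a / b) = (1 + s) / (1 - s) * ((1 + t) / (1 - t))"
    unfolding t(3,4) using ab s \<open>0 < b * (1 - a\<^sup>2)\<close> by (simp add: divide_simps) (simp add:
        algebra_simps)
  moreover have "0 < (1 + s) / (1 - s)" "0 < (1 + t) / (1 - t)"
    using s t(1,2) by simp_all
  ultimately have "artanh (a / b) = artanh s + artanh t"
    unfolding artanh_def by (simp only: ln_mult_pos add_divide_distrib)
  moreover have "sqrt (x / y) = a / b" "sqrt (x * y) = s"
    using ab by (simp_all add: real_sqrt_divide real_sqrt_mult s_def)
  moreover have "sqrt (x * (1 - y) ^ 2 / (y * (1 - x) ^ 2)) = t"
    using ab sq by (simp add: real_sqrt_divide real_sqrt_mult t_def)
  ultimately show ?thesis
    by simp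
qed

lemma Fs_vanish_on_triangle:
  fixes x y :: real
  assumes T: "0 < x" "x < y" "y < 1" and F: "F \<in> set Fs"
  shows "(\<Sum>i\<in>UNIV. F (U (of_real x, of_real y) $ i) $ i) = 0"
proof -
  define u where "u = U (of_real x, of_real y)"
  have pos: "0 < x" "x < 1" "x < y" "0 < y" "y < 1"
    using T by auto
  define P where "P = (\<lambda>k. (\<Sum>i\<in>UNIV. (Fs ! k) (u $ i) $ i) = 0)"
  note logs = Log_U[OF T, folded u_def] Log1m_U[OF T, folded u_def]
    continuation_eq[OF continues_Log_quotients(1) U_in_Omega[OF T], folded u_def]
    continuation_eq[OF continues_Log_quotients(2) U_in_Omega[OF T], folded u_def]
  have "P 0" "P 1" "P 2" "P 3" "P 4" "P 5" "P 6" "P 8" "P 10" "P 11" "P 12" "P 13" "P 17" "P 18"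
      "P 19"
    unfolding P_def sum_9 Fs_def
    by (simp_all add: vector_9 logs algebra_simps power2_eq_square)
  moreover have "P 7" "P 9" "P 14" "P 15"
  proof -
    have nz: "complex_of_real x \<noteq> 0" "complex_of_real y \<noteq> 0" "complex_of_real x \<noteq> 1"
        "complex_of_real y \<noteq> 1"
      "1 - complex_of_real x \<noteq> 0" "1 - complex_of_real y \<noteq> 0" "complex_of_real x - 1 \<noteq> 0"
      "x \<noteq> 0" "y \<noteq> 0" "x \<noteq> 1" "y \<noteq> 1"
      using pos by auto
    show "P 7" "P 9" "P 14" "P 15"
      unfolding P_def sum_9 Fs_def u_def U_def
      by (simp_all add: vector_9 nz divide_simps) (simp_all add: algebra_simps power2_eq_square)
  qed
  moreover have "P 16"
  proof -
    have "a_fun (of_real t) = of_real (artanh (sqrt t))" if "0 < t" "t < 1" for t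
      using continues_a_fun that by (simp add: continues_def)
    then have "a_fun (u $ 3) = of_real (artanh (sqrt (x / y)))" "a_fun (u $ 6)
        = of_real (artanh (sqrt (x * y)))"
      "a_fun (u $ 9) = of_real (artanh (sqrt (x * (1 - y) ^ 2 / (y * (1 - x) ^ 2))))"
      unfolding u_def U_real[OF T] using triangle_bounds[OF T] by blast+
    then show ?thesis
      unfolding P_def sum_9 Fs_def artanh_sqrt_relation[OF T] by (simp add: vector_9)
  qed
  moreover have "P 20" "P 21" "P 24" "P 25" "P 26" "P 27"
    using rogers_five_term[OF pos(1,2) T(2,3), folded u_def] rogers_relation_12678[OF pos(1,2)
        T(2,3), folded u_def]
      Li_2_relation_45789[OF pos(1,2) T(2,3), folded u_def] Li_2_relation_135679[OF pos(1,2)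
          T(2,3), folded u_def]
      spence_kummer_g[OF pos(1,2) T(2,3), folded u_def] spence_kummer_h[OF pos(1,2) T(2,3), folded
          u_def]
    unfolding P_def sum_9 Fs_def
    by (simp_all add: vector_9 algebra_simps power2_eq_square)
  moreover have "P 22"
  proof -
    have "ipi / 2 * Log (u $ 4) - ipi / 2 * Log (u $ 8) = ipi / 2 * Log (u $ 2) + pi2 / 2"
      by (simp add: logs algebra_simps power2_eq_square)
    then show ?thesis
      using rogers_relation_45789[OF pos(1,2) T(2,3), folded u_def]
      unfolding P_def sum_9 Fs_def by (simp add: vector_9 algebra_simps add_divide_distrib)
  qed
  moreover have "P 23"
  proof -
    have e: "Log (u $ 4) ^ 2 / 2 - Log (u $ 8) ^ 2 / 2 + ipi * Log (u $ 8)
      = (Log (u $ 2) * Log1m (u $ 2) - Log (u $ 2) * Log1m (u $ 1))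
          - Log (u $ 2) * Log (u $ 2) / 2 - pi2 / 2"
      by (simp add: logs algebra_simps power2_eq_square add_divide_distrib diff_divide_distrib)
    show ?thesis
      using arg_cong2[where f = "(+)", OF e Li_2_relation_12678[OF pos(1,2) T(2,3), folded u_def]]
      unfolding P_def sum_9 Fs_def by (simp add: vector_9 algebra_simps)
  qed
  moreover obtain k where "F = Fs ! k" "k < length Fs"
    using F by (metis in_set_conv_nth)
  moreover from this(2) have "k < 28"
    by (simp add: Fs_def)
  moreover from this have "k
      \<in> {0, 1, 2, 3, 4, 5, 6, 7, 8, 9, 10, 11, 12, 13, 14, 15, 16, 17, 18, 19, 20, 21, 22, 23, 24, 25, 26, 27}"
    by (simp only: insert_iff empty_iff) presburger
  ultimately have "P k"
    by blast
  then show ?thesis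
    using \<open>F = Fs ! k\<close> by (simp add: P_def u_def)
qed

text \<open>The identity theorem is first applied in \<open>y\<close> for real \<open>x\<close>, then in \<open>x\<close> for every complex
  \<open>y\<close>.\<close>

lemma two_variable_identity:
  fixes \<Phi> :: "complex \<Rightarrow> complex \<Rightarrow> complex" and a b :: real
  assumes holx: "\<And>y. y \<in> ball (of_real b) r \<Longrightarrow> (\<lambda>x. \<Phi> x y) holomorphic_on ball (of_real a) r"
    and holy: "\<And>x. x \<in> ball (of_real a) r \<Longrightarrow> (\<lambda>y. \<Phi> x y) holomorphic_on ball (of_real b) r"
    and zero: "\<And>s t :: real. \<bar>s - a\<bar> < r \<Longrightarrow> \<bar>t - b\<bar> < r \<Longrightarrow> \<Phi> (of_real s) (of_real t) = 0"
    and xy: "x \<in> ball (of_real a) r" "y \<in> ball (of_real b) r"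
  shows "\<Phi> x y = 0"
proof -
  have one: "f z = 0"
    if f: "f holomorphic_on ball (of_real c) r" and 0: "\<And>t :: real. \<bar>t - c\<bar> < r \<Longrightarrow> f (of_real t) = 0"
      and z: "z \<in> ball (of_real c) r" for f z and c :: real
  proof (rule analytic_continuation[OF f open_ball connected_ball _ _ _ _ z])
    have r: "r > 0"
      using z by (auto simp: dist_norm intro: le_less_trans[OF norm_ge_zero])
    then have "c islimpt {c<..<c + r}"
      by (intro islimpt_greaterThanLessThan1) simp
    moreover have "\<forall>\<^sub>F t in at c. complex_of_real t \<noteq> of_real c"
      unfolding of_real_eq_iff by (rule eventually_neq_at_within)
    ultimately show "complex_of_real c islimpt of_real ` {c<..<c + r}"
      by (intro islimpt_isCont_image continuous_intros)
    show "complex_of_real ` {c<..<c + r} \<subseteq> ball (of_real c) r"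
    proof (clarsimp simp: dist_norm)
      fix t assume "c < t" "t < c + r"
      moreover have "norm (complex_of_real c - of_real t) = \<bar>c - t\<bar>"
        by (metis norm_of_real of_real_diff)
      ultimately show "cmod (complex_of_real c - complex_of_real t) < r"
        by simp
    qed
    show "complex_of_real c \<in> ball (of_real c) r"
      using r by simp
    show "f w = 0" if "w \<in> of_real ` {c<..<c + r}" for w
      using that 0 by auto
  qed
  have "\<Phi> (of_real s) y = 0" if "\<bar>s - a\<bar> < r" for s :: real
  proof (rule one[OF holy _ xy(2)])
    have "norm (complex_of_real a - of_real s) = \<bar>a - s\<bar>"
      by (metis norm_of_real of_real_diff)
    then show "of_real s \<in> ball (complex_of_real a) r"
      using that by (simp add: dist_norm)
  qed (use zero that in auto)
  then show ?thesis
    by (rule one[OF holx[OF xy(2)] _ xy(1)])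
qed

lemma holomorphic_U:
  assumes "x \<noteq> 1" "y \<noteq> 0"
  shows "((\<lambda>x. U (x, y) $ i) holomorphic_on - {1})" "((\<lambda>y. U (x, y) $ i) holomorphic_on - {0})"
proof -
  have "(\<lambda>x. U (x, y) $ i) holomorphic_on - {1}" (is "?P i")
    by (rule index_9_cases[where P = ?P]; unfold U_def vector_9 case_prod_conv;
        use assms in \<open>auto intro!: holomorphic_intros\<close>)
  then show "((\<lambda>x. U (x, y) $ i) holomorphic_on - {1})" .
  have "(\<lambda>y. U (x, y) $ i) holomorphic_on - {0}" (is "?P i")
    by (rule index_9_cases[where P = ?P]; unfold U_def vector_9 case_prod_conv;
        use assms in \<open>auto intro!: holomorphic_intros\<close>)
  then show "((\<lambda>y. U (x, y) $ i) holomorphic_on - {0})" .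
qed

lemma Fs_in_S:
  assumes F: "F \<in> set Fs"
  shows "germs_of F \<in> S"
proof -
  have "\<forall>\<^sub>F w in nhds omega0. \<forall>i. U w $ i \<in> Omega"
  proof (rule eventually_all_finite)
    show "\<forall>\<^sub>F w in nhds omega0. U w $ i \<in> Omega" for i
      using isCont_U[of i] base_points_in_Omega[of i] open_Omega
      by (metis continuous_within tendsto_at_iff_tendsto_nhds topological_tendstoD)
  qed
  then obtain e where e: "e > 0" "\<And>w i. dist w omega0 < e \<Longrightarrow> U w $ i \<in> Omega"
    by (auto simp: eventually_nhds_metric)
  define r where "r = min (e / 2) (1 / 12)"
  have r: "r > 0" "r \<le> 1/12" "2 * r \<le> e"
    using e by (auto simp: r_def)
  define a b :: real where "a = 1/3" and "b = 1/2"
  have omega0: "omega0 = (of_real a, of_real b)"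
    by (simp add: omega0_def a_def b_def)
  have U: "U (x, y) $ i \<in> Omega" if "x \<in> ball (of_real a) r" "y \<in> ball (of_real b) r" for x y i
  proof (rule e(2))
    have "dist (x, y) omega0 \<le> dist x (of_real a) + dist y (of_real b)"
      unfolding omega0 dist_Pair_Pair by (rule sqrt_sum_squares_le_sum) auto
    then show "dist (x, y) omega0 < e"
      using that r by (simp add: dist_commute)
  qed
  have x1: "x \<noteq> 1" if "x \<in> ball (of_real a) r" for x :: complex
    using that r dist_of_real[of a 1, where 'a = complex] by (auto simp: a_def dist_real_def)
  have y0: "y \<noteq> 0" if "y \<in> ball (of_real b) r" for y :: complex
    using that r dist_of_real[of b 0, where 'a = complex] by (auto simp: b_def dist_real_def)
  have zero: "(\<Sum>i\<in>UNIV. F (U (x, y) $ i) $ i) = 0" if "x \<in> ball (of_real a) r" "y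
      \<in> ball (of_real b) r" for x y
  proof (rule two_variable_identity[where \<Phi> = "\<lambda>x y. \<Sum>i\<in>UNIV. F (U (x, y) $ i) $ i", OF _ _ _ that])
    fix y assume y: "y \<in> ball (complex_of_real b) r"
    have "((\<lambda>z. F z $ i) \<circ> (\<lambda>x. U (x, y) $ i)) holomorphic_on ball (of_real a) r" for i
      by (rule holomorphic_on_compose_gen[OF _ Fs_holomorphic[OF F]], rule
          holomorphic_on_subset[OF holomorphic_U(1)[of 0]])
        (use U y y0 x1[of 1] in auto)
    then show "(\<lambda>x. \<Sum>i\<in>UNIV. F (U (x, y) $ i) $ i) holomorphic_on ball (of_real a) r"
      unfolding o_def by (intro holomorphic_intros)
  next
    fix x assume x: "x \<in> ball (complex_of_real a) r"
    have "((\<lambda>z. F z $ i) \<circ> (\<lambda>y. U (x, y) $ i)) holomorphic_on ball (of_real b) r" for i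
      by (rule holomorphic_on_compose_gen[OF _ Fs_holomorphic[OF F]], rule
          holomorphic_on_subset[OF holomorphic_U(2)[of x 1]])
        (use U x x1 y0[of 0] in auto)
    then show "(\<lambda>y. \<Sum>i\<in>UNIV. F (U (x, y) $ i) $ i) holomorphic_on ball (of_real b) r"
      unfolding o_def by (intro holomorphic_intros)
  next
    fix s t :: real assume "\<bar>s - a\<bar> < r" "\<bar>t - b\<bar> < r"
    then have "0 < s" "s < t" "t < 1"
      using r by (auto simp: a_def b_def)
    from Fs_vanish_on_triangle[OF this F]
    show "(\<Sum>i\<in>UNIV. F (U (of_real s, of_real t) $ i) $ i) = 0" .
  qed
  have "\<forall>\<^sub>F w in nhds omega0. (\<Sum>i\<in>UNIV. F (U w $ i) $ i) = 0"
  proof -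
    have "\<forall>\<^sub>F w in nhds omega0. w \<in> ball (of_real a) r \<times> ball (of_real b) r"
      unfolding omega0 using r by (intro eventually_nhds_in_open open_Times) auto
    then show ?thesis
      by eventually_elim (use zero in auto)
  qed
  then show ?thesis
    unfolding S_def mem_Collect_eq is_relation.abs_eq[OF Fs_germs[OF F]] .
qed

section \<open>Linear independence\<close>

text \<open>The Taylor remainders of the polylogarithm, divided by the appropriate power of \<open>x\<close>. They
  tend to the next Taylor coefficient, which is all that is used about the expansion at 0.\<close>

definition polylog_tail :: "nat \<Rightarrow> nat \<Rightarrow> real \<Rightarrow> real" where
  "polylog_tail n m x = (\<Sum>k. x ^ k / real (Suc (k + m)) ^ n)"

lemma polylog_tail_summable:
  fixes x :: real
  assumes "\<bar>x\<bar> < 1"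
  shows "summable (\<lambda>k. x ^ k / real (Suc (k + m)) ^ n)"
proof (rule summable_comparison_test')
  show "summable (\<lambda>k. \<bar>x\<bar> ^ k)"
    using assms by (simp add: summable_geometric)
  show "norm (x ^ k / real (Suc (k + m)) ^ n) \<le> \<bar>x\<bar> ^ k" for k
  proof -
    have "(1::real) \<le> real (Suc (k + m)) ^ n"
      by (rule one_le_power) simp
    then have "\<bar>x\<bar> ^ k / real (Suc (k + m)) ^ n \<le> \<bar>x\<bar> ^ k / 1"
      by (intro divide_left_mono) auto
    then show ?thesis
      by (simp add: power_abs del: of_nat_Suc)
  qed
qed

lemma polylog_tail_step:
  assumes "\<bar>x\<bar> < 1"
  shows "polylog_tail n m x = 1 / real (Suc m) ^ n + x * polylog_tail n (Suc m) x"
proof -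
  have "polylog_tail n m x - 1 / real (Suc m) ^ n = (\<Sum>k. x * (x ^ k / real (Suc (k + Suc m)) ^ n))"
    using suminf_split_head[OF polylog_tail_summable[OF assms, of m n]] by (simp add:
        polylog_tail_def)
  also have "\<dots> = x * polylog_tail n (Suc m) x"
    unfolding polylog_tail_def by (rule suminf_mult[OF polylog_tail_summable[OF assms]])
  finally show ?thesis
    by simp
qed

lemma polylog_eq_tail:
  assumes "\<bar>x\<bar> < 1"
  shows "polylog n x = x * polylog_tail n 0 x"
  using suminf_mult[OF polylog_tail_summable[OF assms, of 0 n], of x]
  by (simp add: polylog_def polylog_tail_def)

lemma tendsto_polylog_tail:
  "(polylog_tail n m \<longlongrightarrow> 1 / real (Suc m) ^ n) (at_right 0)"
proof -
  have "isCont (\<lambda>x. \<Sum>k. (1 / real (Suc (k + m)) ^ n) * x ^ k) 0"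
    using polylog_tail_summable[of _ m n]
    by (intro isCont_powser'[where K = "1/2"]) (auto simp: )
  then have "isCont (polylog_tail n m) 0"
    by (simp add: polylog_tail_def[abs_def])
  moreover have "polylog_tail n m 0 = 1 / real (Suc m) ^ n"
    using polylog_tail_step[of 0] by simp
  ultimately show ?thesis
    by (metis isCont_def filterlim_at_split)
qed

lemma ln_1m_eq_tail:
  assumes "0 < x" "x < 1"
  shows "ln (1 - x) = - (x * polylog_tail 1 0 x)"
  using polylog_1[OF assms] polylog_eq_tail[of x 1] assms by simp

text \<open>The coefficients are read off one after the other from the asymptotic expansion at 0:
  first those of the unbounded terms \<open>1/x\<close>, \<open>ln\<^sup>2\<close>, \<open>ln\<close>, then of \<open>1\<close> and of \<open>sqrt x\<close>, then of
  \<open>x * ln\<^sup>2\<close>, \<open>x * ln\<close>, \<open>x\<close> and \<open>x\<^sup>2 * ln\<close>. What remains is a combination of \<open>x\<close>, \<open>Li 1\<close>, \<open>Li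
  2\<close>, \<open>Li 3\<close>, for which the coefficients of \<open>x\<close>, \<open>x\<^sup>2\<close>, \<open>x\<^sup>3\<close>, \<open>x\<^sup>4\<close> suffice.\<close>

lemma real_functions_independent:
  fixes c1 c2 c3 c4 c5 c6 c7 c8 c9 c10 c11 c12 :: real
  assumes rel: "\<And>x. 0 < x \<Longrightarrow> x < 1 \<Longrightarrow> c1 + c2 * x + c3 / x + c4 * artanh (sqrt x) + c5 * ln x
     + c6 * ln (1 - x) + c7 * ln x ^ 2 + c8 * ln x * ln (1 - x) + c9 * polylog 2 x
     + c10 * polylog 3 x + c11 * ln x * polylog 2 x + c12 * ln x ^ 2 * ln (1 - x) = 0"
  shows "c1 = 0 \<and> c2 = 0 \<and> c3 = 0 \<and> c4 = 0 \<and> c5 = 0 \<and> c6 = 0 \<and> c7 = 0 \<and> c8 = 0 \<and> c9 = 0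
     \<and> c10 = 0 \<and> c11 = 0 \<and> c12 = 0"
proof -
  let ?F = "at_right (0::real)"
  let ?p = "\<lambda>n. polylog_tail n 0"
  have ev: "\<forall>\<^sub>F x in ?F. 0 < x \<and> x < (1::real)"
    by (auto simp: eventually_at_right_field intro!: exI[of _ 1])
  have limit0: "l = 0" if "(f \<longlongrightarrow> l) ?F" and "\<And>x. 0 < x \<Longrightarrow> x < 1 \<Longrightarrow> f x = 0" for f and l :: real
  proof -
    have "(f \<longlongrightarrow> 0) ?F"
      by (rule tendsto_eventually) (use ev that(2) in \<open>auto elim: eventually_mono\<close>)
    then show ?thesis
      using that(1) tendsto_unique trivial_limit_at_right_real by blast
  qed
  have E: "c1 + c2 * x + c3 / x + c4 * artanh (sqrt x) + c5 * ln x
     - c6 * (x * ?p 1 x) + c7 * ln x ^ 2 - c8 * ln x * (x * ?p 1 x) + c9 * (x * ?p 2 x)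
     + c10 * (x * ?p 3 x) + c11 * ln x * (x * ?p 2 x) - c12 * ln x ^ 2 * (x * ?p 1 x) = 0"
    if "0 < x" "x < 1" for x
    using rel[OF that] that ln_1m_eq_tail[OF that] by (simp add: polylog_eq_tail)
  have t [tendsto_intros]: "(?p n \<longlongrightarrow> 1) ?F" for n
    using tendsto_polylog_tail[of n 0] by simp
  have art: "((\<lambda>x::real. artanh (sqrt x)) \<longlongrightarrow> 0) ?F"
    unfolding artanh_def by real_asymp
  have art2: "((\<lambda>x::real. artanh (sqrt x) / sqrt x) \<longlongrightarrow> 1) ?F"
    unfolding artanh_def by real_asymp
  have id: "((\<lambda>x::real. x) \<longlongrightarrow> 0) ?F" by real_asymp
  have l1: "((\<lambda>x::real. x * ln x) \<longlongrightarrow> 0) ?F" by real_asymp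
  have l2: "((\<lambda>x::real. x * ln x ^ 2) \<longlongrightarrow> 0) ?F" by real_asymp
  have i1: "((\<lambda>x::real. 1 / ln x) \<longlongrightarrow> 0) ?F" by real_asymp
  have sq: "((\<lambda>x::real. sqrt x) \<longlongrightarrow> 0) ?F" by real_asymp
  have sl1: "((\<lambda>x::real. sqrt x * ln x) \<longlongrightarrow> 0) ?F" by real_asymp
  have sl2: "((\<lambda>x::real. sqrt x * ln x ^ 2) \<longlongrightarrow> 0) ?F" by real_asymp
  note T = art art2 id l1 l2 i1 sq sl1 sl2 t
  have c3: "c3 = 0"
  proof (rule limit0)
    show "((\<lambda>x. c1 * x + c2 * (x * x) + c3 + c4 * (x * artanh (sqrt x)) + c5 * (x * ln x)
     - c6 * (x * x * ?p 1 x) + c7 * (x * ln x ^ 2) - c8 * (x * ln x) * (x * ?p 1 x) + c9 * (x * x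
         * ?p 2 x)
     + c10 * (x * x * ?p 3 x) + c11 * (x * ln x) * (x * ?p 2 x) - c12 * (x * ln x ^ 2) * (x * ?p 1
         x))
      \<longlongrightarrow> c3) ?F"
      by (rule tendsto_eq_intros T refl | simp)+
    show "c1 * x + c2 * (x * x) + c3 + c4 * (x * artanh (sqrt x)) + c5 * (x * ln x)
     - c6 * (x * x * ?p 1 x) + c7 * (x * ln x ^ 2) - c8 * (x * ln x) * (x * ?p 1 x) + c9 * (x * x
         * ?p 2 x)
     + c10 * (x * x * ?p 3 x) + c11 * (x * ln x) * (x * ?p 2 x)
         - c12 * (x * ln x ^ 2) * (x * ?p 1 x) = 0"
      if "0 < x" "x < 1" for x
      using arg_cong[OF E[OF that], of "\<lambda>e. x * e"] that by (simp add: algebra_simps)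
  qed
  have c7: "c7 = 0"
  proof (rule limit0)
    show "((\<lambda>x. (c1 + c2 * x + c4 * artanh (sqrt x)) * (1 / ln x) ^ 2 + c5 * (1 / ln x)
     - c6 * (x * ?p 1 x) * (1 / ln x) ^ 2 + c7 - c8 * (1 / ln x) * (x * ?p 1 x)
     + (c9 * (x * ?p 2 x) + c10 * (x * ?p 3 x)) * (1 / ln x) ^ 2 + c11 * (1 / ln x) * (x * ?p 2 x)
     - c12 * (x * ?p 1 x)) \<longlongrightarrow> c7) ?F"
      by (rule tendsto_eq_intros T refl | simp)+
    show "(c1 + c2 * x + c4 * artanh (sqrt x)) * (1 / ln x) ^ 2 + c5 * (1 / ln x)
     - c6 * (x * ?p 1 x) * (1 / ln x) ^ 2 + c7 - c8 * (1 / ln x) * (x * ?p 1 x)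
     + (c9 * (x * ?p 2 x) + c10 * (x * ?p 3 x)) * (1 / ln x) ^ 2 + c11 * (1 / ln x) * (x * ?p 2 x)
     - c12 * (x * ?p 1 x) = 0"
      if "0 < x" "x < 1" for x
    proof -
      have "ln x * (1 / ln x) = 1"
        using that by simp
      moreover have "c1 + c2 * x + c4 * artanh (sqrt x) + c5 * ln x
        - c6 * (x * ?p 1 x) + c7 * ln x ^ 2 - c8 * ln x * (x * ?p 1 x) + c9 * (x * ?p 2 x)
        + c10 * (x * ?p 3 x) + c11 * ln x * (x * ?p 2 x) - c12 * ln x ^ 2 * (x * ?p 1 x) = 0"
        using E[OF that] c3 by simp
      ultimately show ?thesis
        by algebra
    qed
  qed
  have c5: "c5 = 0"
  proof (rule limit0)
    show "((\<lambda>x. (c1 + c2 * x + c4 * artanh (sqrt x)) * (1 / ln x) + c5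
     - c6 * (x * ?p 1 x) * (1 / ln x) - c8 * (x * ?p 1 x)
     + (c9 * (x * ?p 2 x) + c10 * (x * ?p 3 x)) * (1 / ln x) + c11 * (x * ?p 2 x)
     - c12 * (x * ln x) * ?p 1 x) \<longlongrightarrow> c5) ?F"
      by (rule tendsto_eq_intros T refl | simp)+
    show "(c1 + c2 * x + c4 * artanh (sqrt x)) * (1 / ln x) + c5
     - c6 * (x * ?p 1 x) * (1 / ln x) - c8 * (x * ?p 1 x)
     + (c9 * (x * ?p 2 x) + c10 * (x * ?p 3 x)) * (1 / ln x) + c11 * (x * ?p 2 x)
     - c12 * (x * ln x) * ?p 1 x = 0"
      if "0 < x" "x < 1" for x
      using arg_cong[OF E[OF that], of "\<lambda>e. e * (1 / ln x)"] c3 c7 that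
      by (simp add: divide_simps) (simp add: algebra_simps power2_eq_square)
  qed
  have c1: "c1 = 0"
  proof (rule limit0)
    show "((\<lambda>x. c1 + c2 * x + c4 * artanh (sqrt x)
     - c6 * (x * ?p 1 x) - c8 * (x * ln x) * ?p 1 x + c9 * (x * ?p 2 x)
     + c10 * (x * ?p 3 x) + c11 * (x * ln x) * ?p 2 x - c12 * (x * ln x ^ 2) * ?p 1 x) \<longlongrightarrow> c1) ?F"
      by (rule tendsto_eq_intros T refl | simp)+
  qed (use E c3 c7 c5 in \<open>simp add: algebra_simps\<close>)
  have c4: "c4 = 0"
  proof (rule limit0)
    show "((\<lambda>x. c2 * sqrt x + c4 * (artanh (sqrt x) / sqrt x)
     - c6 * (sqrt x * ?p 1 x) - c8 * (sqrt x * ln x) * ?p 1 x + c9 * (sqrt x * ?p 2 x)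
     + c10 * (sqrt x * ?p 3 x) + c11 * (sqrt x * ln x) * ?p 2 x
         - c12 * (sqrt x * ln x ^ 2) * ?p 1 x) \<longlongrightarrow> c4) ?F"
      by (rule tendsto_eq_intros T refl | simp)+
    show "c2 * sqrt x + c4 * (artanh (sqrt x) / sqrt x)
     - c6 * (sqrt x * ?p 1 x) - c8 * (sqrt x * ln x) * ?p 1 x + c9 * (sqrt x * ?p 2 x)
     + c10 * (sqrt x * ?p 3 x) + c11 * (sqrt x * ln x) * ?p 2 x
         - c12 * (sqrt x * ln x ^ 2) * ?p 1 x = 0"
      if "0 < x" "x < 1" for x
    proof -
      define s where "s = sqrt x"
      have s: "x = s * s" "s > 0"
        using that by (auto simp: s_def)
      have "s * (c2 * s + c4 * (artanh s / s)
       - c6 * (s * ?p 1 x) - c8 * (s * ln x) * ?p 1 x + c9 * (s * ?p 2 x)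
       + c10 * (s * ?p 3 x) + c11 * (s * ln x) * ?p 2 x - c12 * (s * ln x ^ 2) * ?p 1 x) = 0"
        using E[OF that] c3 c7 c5 c1 s unfolding s_def[symmetric] by (simp add: field_simps)
      then show ?thesis
        using s(2) by (simp add: s_def)
    qed
  qed
  have E2: "c2 - c6 * ?p 1 x - c8 * ln x * ?p 1 x + c9 * ?p 2 x
     + c10 * ?p 3 x + c11 * ln x * ?p 2 x - c12 * ln x ^ 2 * ?p 1 x = 0"
    if "0 < x" "x < 1" for x
  proof -
    have "x * (c2 - c6 * ?p 1 x - c8 * ln x * ?p 1 x + c9 * ?p 2 x
     + c10 * ?p 3 x + c11 * ln x * ?p 2 x - c12 * ln x ^ 2 * ?p 1 x) = 0"
      using E[OF that] c1 c3 c4 c5 c7 by (simp add: algebra_simps)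
    then show ?thesis
      using that by simp
  qed
  have c12: "- c12 = 0"
  proof (rule limit0)
    show "((\<lambda>x. (c2 - c6 * ?p 1 x + c9 * ?p 2 x + c10 * ?p 3 x) * (1 / ln x) ^ 2
       - c8 * (1 / ln x) * ?p 1 x + c11 * (1 / ln x) * ?p 2 x - c12 * ?p 1 x) \<longlongrightarrow> - c12) ?F"
      by (rule tendsto_eq_intros T refl | simp)+
    show "(c2 - c6 * ?p 1 x + c9 * ?p 2 x + c10 * ?p 3 x) * (1 / ln x) ^ 2
       - c8 * (1 / ln x) * ?p 1 x + c11 * (1 / ln x) * ?p 2 x - c12 * ?p 1 x = 0"
      if "0 < x" "x < 1" for x
    proof -
      have "ln x * (1 / ln x) = 1"
        using that by simp
      then show ?thesis
        using E2[OF that] by algebra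
    qed
  qed
  have c8: "- c8 + c11 = 0"
  proof (rule limit0)
    show "((\<lambda>x. (c2 - c6 * ?p 1 x + c9 * ?p 2 x + c10 * ?p 3 x) * (1 / ln x)
       - c8 * ?p 1 x + c11 * ?p 2 x) \<longlongrightarrow> - c8 + c11) ?F"
      by (rule tendsto_eq_intros T refl | simp)+
    show "(c2 - c6 * ?p 1 x + c9 * ?p 2 x + c10 * ?p 3 x) * (1 / ln x)
       - c8 * ?p 1 x + c11 * ?p 2 x = 0"
      if "0 < x" "x < 1" for x
      using arg_cong[OF E2[OF that], of "\<lambda>e. e * (1 / ln x)"] c12 that
      by (simp add: divide_simps) (simp add: algebra_simps power2_eq_square)
  qed
  have p: "?p n x = 1 + x * polylog_tail n 1 x" "polylog_tail n 1 x = 1 / 2 ^ n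
      + x * polylog_tail n 2 x"
    "polylog_tail n 2 x = 1 / 3 ^ n + x * polylog_tail n 3 x"
    if "0 < x" "x < 1" for x n
    using polylog_tail_step[of x n 0] polylog_tail_step[of x n 1] polylog_tail_step[of x n 2] that
    by (simp_all add: numeral_eq_Suc)
  note T1 = tendsto_polylog_tail[of _ 1] tendsto_polylog_tail[of _ 2] tendsto_polylog_tail[of _ 3]
  have c2: "c2 - c6 + c9 + c10 = 0"
  proof (rule limit0)
    show "((\<lambda>x. c2 - c6 * ?p 1 x + c9 * ?p 2 x + c10 * ?p 3 x
       + c8 * (x * ln x) * (polylog_tail 2 1 x - polylog_tail 1 1 x)) \<longlongrightarrow> c2 - c6 + c9 + c10) ?F"
      by (rule tendsto_eq_intros T T1 refl | simp)+
    show "c2 - c6 * ?p 1 x + c9 * ?p 2 x + c10 * ?p 3 x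
       + c8 * (x * ln x) * (polylog_tail 2 1 x - polylog_tail 1 1 x) = 0"
      if "0 < x" "x < 1" for x
    proof -
      have "c11 = c8"
        using c8 by simp
      then show ?thesis
        using E2[OF that] c12 by (simp add: p(1)[OF that] algebra_simps)
    qed
  qed
  have E3: "- c6 * polylog_tail 1 1 x + c9 * polylog_tail 2 1 x + c10 * polylog_tail 3 1 x
     + c8 * ln x * (polylog_tail 2 1 x - polylog_tail 1 1 x) = 0"
    if "0 < x" "x < 1" for x
  proof -
    have "c11 = c8" "c2 = c6 - c9 - c10"
      using c8 c2 by simp_all
    then have "x * (- c6 * polylog_tail 1 1 x + c9 * polylog_tail 2 1 x + c10 * polylog_tail 3 1 x
     + c8 * ln x * (polylog_tail 2 1 x - polylog_tail 1 1 x)) = 0"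
      using E2[OF that] c12 by (simp add: p(1)[OF that] algebra_simps)
    then show ?thesis
      using that by simp
  qed
  have "c8 * (1 / 4 - 1 / 2) = 0"
  proof (rule limit0)
    show "((\<lambda>x. (- c6 * polylog_tail 1 1 x + c9 * polylog_tail 2 1 x
        + c10 * polylog_tail 3 1 x) * (1 / ln x)
     + c8 * (polylog_tail 2 1 x - polylog_tail 1 1 x)) \<longlongrightarrow> c8 * (1 / 4 - 1 / 2)) ?F"
      by (rule tendsto_eq_intros T T1 refl | simp)+
    show "(- c6 * polylog_tail 1 1 x + c9 * polylog_tail 2 1 x
        + c10 * polylog_tail 3 1 x) * (1 / ln x)
     + c8 * (polylog_tail 2 1 x - polylog_tail 1 1 x) = 0"
      if "0 < x" "x < 1" for x
      using arg_cong[OF E3[OF that], of "\<lambda>e. e * (1 / ln x)"] that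
      by (simp add: divide_simps) (simp add: algebra_simps)
  qed
  then have c8': "c8 = 0" by simp
  have E4: "- c6 / 2 + c9 / 4 + c10 / 8
    + x * (- c6 / 3 + c9 / 9 + c10 / 27 + x * (- c6 * polylog_tail 1 3 x + c9 * polylog_tail 2 3 x
        + c10 * polylog_tail 3 3 x)) = 0"
    if "0 < x" "x < 1" for x
    using E3[OF that] c8' unfolding p(2)[OF that] p(3)[OF that] by (simp add: algebra_simps)
  have e1: "- c6 / 2 + c9 / 4 + c10 / 8 = 0"
    by (rule limit0[OF _ E4]) (rule tendsto_eq_intros T T1 refl | simp)+
  have E5: "- c6 / 3 + c9 / 9 + c10 / 27 + x * (- c6 * polylog_tail 1 3 x
      + c9 * polylog_tail 2 3 x + c10 * polylog_tail 3 3 x) = 0"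
    if "0 < x" "x < 1" for x
    using E4[OF that] that unfolding e1 by simp
  have e2: "- c6 / 3 + c9 / 9 + c10 / 27 = 0"
    by (rule limit0[OF _ E5]) (rule tendsto_eq_intros T T1 refl | simp)+
  have E6: "- c6 * polylog_tail 1 3 x + c9 * polylog_tail 2 3 x + c10 * polylog_tail 3 3 x = 0"
    if "0 < x" "x < 1" for x
    using E5[OF that] that unfolding e2 by simp
  have e3: "- c6 / 4 + c9 / 16 + c10 / 64 = 0"
    by (rule limit0[OF _ E6]) (rule tendsto_eq_intros T T1 refl | simp)+
  show ?thesis
    using c1 c2 c3 c4 c5 c7 c8 c8' c12 e1 e2 e3 by simp
qed

text \<open>The twelve functions are real on the unit interval, so the real and imaginary parts of the
  coefficients satisfy the same relation there.\<close>

lemma functions_independent: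
  assumes rel: "\<And>z. z \<in> Omega \<Longrightarrow> c1 + c2 * z + c3 / z + c4 * a_fun z + c5 * Log z
     + c6 * Log1m z + c7 * Log z ^ 2 + c8 * Log z * Log1m z + c9 * Li 2 z
     + c10 * Li 3 z + c11 * Log z * Li 2 z + c12 * Log z ^ 2 * Log1m z = 0"
  shows "c1 = 0 \<and> c2 = 0 \<and> c3 = 0 \<and> c4 = 0 \<and> c5 = 0 \<and> c6 = 0 \<and> c7 = 0 \<and> c8 = 0 \<and> c9 = 0
     \<and> c10 = 0 \<and> c11 = 0 \<and> c12 = 0"
proof -
  have E: "c1 + c2 * of_real x + c3 / of_real x + c4 * of_real (artanh (sqrt x))
      + c5 * of_real (ln x)
     + c6 * of_real (ln (1 - x)) + c7 * of_real (ln x) ^ 2 + c8 * of_real (ln x) * of_real (ln (1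
         - x)) + c9 * of_real (polylog 2 x)
     + c10 * of_real (polylog 3 x) + c11 * of_real (ln x) * of_real (polylog 2 x)
         + c12 * of_real (ln x) ^ 2 * of_real (ln (1 - x)) = 0"
    (is "?E x = 0") if "0 < x" "x < 1" for x
    using rel[OF real_in_Omega[OF that]] that continues_Log continues_Log1m continues_Li
        continues_a_fun
    by (simp add: continues_def)
  have "Re (?E x) = 0" "Im (?E x) = 0" if "0 < x" "x < 1" for x
    unfolding E[OF that] by simp_all
  then have "0 < x \<Longrightarrow> x < 1 \<Longrightarrow> Re c1 + Re c2 * x + Re c3 / x + Re c4 * artanh (sqrt x) + Re c5 * ln x
     + Re c6 * ln (1 - x) + Re c7 * ln x ^ 2 + Re c8 * ln x * ln (1 - x) + Re c9 * polylog 2 x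
     + Re c10 * polylog 3 x + Re c11 * ln x * polylog 2 x + Re c12 * ln x ^ 2 * ln (1 - x) = 0"
    and "0 < x \<Longrightarrow> x < 1 \<Longrightarrow> Im c1 + Im c2 * x + Im c3 / x + Im c4 * artanh (sqrt x) + Im c5 * ln x
     + Im c6 * ln (1 - x) + Im c7 * ln x ^ 2 + Im c8 * ln x * ln (1 - x) + Im c9 * polylog 2 x
     + Im c10 * polylog 3 x + Im c11 * ln x * polylog 2 x + Im c12 * ln x ^ 2 * ln (1 - x) = 0"
         for x
    by (simp_all add: power2_eq_square)
  from real_functions_independent[OF this(1)] real_functions_independent[OF this(2)] show ?thesis
    by (simp add: complex_eq_iff)
qed

text \<open>Each of the nine entries of the relation is written in the basis of
  \<open>functions_independent\<close>; \<open>eqs i\<close> collects the twelve resulting equations for entry \<open>i\<close>. The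
  system is solved without elimination: in the order chosen below there is always an equation
  whose only unknown that is not yet known to be zero is the next one.\<close>

lemma Fs_independent_mod_constants:
  fixes c :: "nat \<Rightarrow> complex" and k :: "complex ^ 9"
  assumes rel: "\<And>i z. z \<in> Omega \<Longrightarrow> k $ i + (\<Sum>j<28. c j * (Fs ! j) z $ i) = 0"
  shows "(\<forall>j<28. c j = 0) \<and> k = 0"
proof -
  note expand = Fs_def lessThan_nat_numeral lessThan_Suc vector_9 d_fun_def g_fun_def h_fun_def
      g_tilde_def
    h_tilde_def continuation_eq[OF continues_Log_quotients(1)] continuation_eq[OF
        continues_Log_quotients(2)]
  have "(k $ 1 - (pi2 / 6) * c 20 - (pi2 / 6) * c 21 + pi2 * c 22
      - (4 * of_real (polylog 3 1) / 9) * c 26)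
      + c 15 * z
      + c 7 / z
      + 0 * a_fun z
      + (c 0 + c 1 + c 5 + c 6) * Log z
      + (- c 1 + c 2 + c 4 + c 8) * Log1m z
      + 2 * c 17 * Log z ^ 2
      + ((1 / 2) * c 20 + (1 / 2) * c 21) * Log z * Log1m z
      + (c 20 + c 21 + c 23 + 2 * c 25) * Li 2 z
      + 2 * c 26 * Li 3 z
      + (- 2 * c 26 + 4 * c 27) * Log z * Li 2 z
      + (- (2 / 3) * c 26 + 2 * c 27) * Log z ^ 2 * Log1m z = 0" if "z \<in> Omega" for z
    using rel[OF that, of 1] that
    by (simp add: expand)
      (simp add: algebra_simps add_divide_distrib diff_divide_distrib power2_eq_square
          power3_eq_cube)
  note eqs1 = functions_independent[OF this]
  have "(k $ 2 + (pi2 / 6) * c 20 - (pi2 / 6) * c 21 - (4 * of_real (polylog 3 1) / 9) * c 26)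
      + c 9 * z
      + c 14 / z
      + 0 * a_fun z
      + (- c 0 + c 5 + c 11 - (ipi / 2) * c 21 - (2 * pi2 / 3) * c 27) * Log z
      + (- c 2) * Log1m z
      + (2 * c 17 + (1 / 2) * c 24) * Log z ^ 2
      + (- (1 / 2) * c 20 + (1 / 2) * c 21) * Log z * Log1m z
      + (- c 20 + c 21 + c 23) * Li 2 z
      + 2 * c 26 * Li 3 z
      + (- 2 * c 26 + 4 * c 27) * Log z * Li 2 z
      + (- (2 / 3) * c 26 + 2 * c 27) * Log z ^ 2 * Log1m z = 0" if "z \<in> Omega" for z
    using rel[OF that, of 2] that
    by (simp add: expand)
      (simp add: algebra_simps add_divide_distrib diff_divide_distrib power2_eq_square
          power3_eq_cube)
  note eqs2 = functions_independent[OF this]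
  have "(k $ 3 + (pi2 / 6) * c 20 + (2 * of_real (polylog 3 1) / 9) * c 26)
      + 0 * z
      + 0 / z
      + c 16 * a_fun z
      + (- c 0 - c 1 + c 3) * Log z
      + (c 1 - c 4) * Log1m z
      + (- c 17 + c 19) * Log z ^ 2
      + (- (1 / 2) * c 20) * Log z * Log1m z
      + (- c 20 - c 25) * Li 2 z
      + (- c 26) * Li 3 z
      + (c 26 - 2 * c 27) * Log z * Li 2 z
      + ((1 / 3) * c 26 - c 27) * Log z ^ 2 * Log1m z = 0" if "z \<in> Omega" for z
    using rel[OF that, of 3] that
    by (simp add: expand)
      (simp add: algebra_simps add_divide_distrib diff_divide_distrib power2_eq_square
          power3_eq_cube)
  note eqs3 = functions_independent[OF this]
  have "(k $ 4 + (pi2 / 6) * c 20 - (pi2 / 6) * c 22 - (4 * of_real (polylog 3 1) / 9) * c 26)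
      + c 9 * z
      + c 15 / z
      + 0 * a_fun z
      + (c 2 + c 3 + c 6 - (ipi / 2) * c 22) * Log z
      + (- c 1) * Log1m z
      + (- 2 * c 19 + (1 / 2) * c 23) * Log z ^ 2
      + (- (1 / 2) * c 20 + (1 / 2) * c 22) * Log z * Log1m z
      + (- c 20 + c 22 + c 24) * Li 2 z
      + 2 * c 26 * Li 3 z
      + (- 2 * c 26 + 4 * c 27) * Log z * Li 2 z
      + (- (2 / 3) * c 26 + 2 * c 27) * Log z ^ 2 * Log1m z = 0" if "z \<in> Omega" for z
    using rel[OF that, of 4] that
    by (simp add: expand)
      (simp add: algebra_simps add_divide_distrib diff_divide_distrib power2_eq_square
          power3_eq_cube)
  note eqs4 = functions_independent[OF this]
  have "(k $ 5 - (pi2 / 6) * c 20 - (pi2 / 6) * c 22 - (4 * of_real (polylog 3 1) / 9) * c 26)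
      + c 14 * z
      + c 7 / z
      + 0 * a_fun z
      + (- c 3) * Log z
      + (c 4 + c 13) * Log1m z
      + (- 2 * c 19) * Log z ^ 2
      + ((1 / 2) * c 20 + (1 / 2) * c 22) * Log z * Log1m z
      + (c 20 + c 22 + c 24 + 2 * c 25) * Li 2 z
      + 2 * c 26 * Li 3 z
      + (- 2 * c 26 + 4 * c 27) * Log z * Li 2 z
      + (- (2 / 3) * c 26 + 2 * c 27) * Log z ^ 2 * Log1m z = 0" if "z \<in> Omega" for z
    using rel[OF that, of 5] that
    by (simp add: expand)
      (simp add: algebra_simps add_divide_distrib diff_divide_distrib power2_eq_square
          power3_eq_cube)
  note eqs5 = functions_independent[OF this]
  have "(k $ 6 + (pi2 / 6) * c 21 + (2 * of_real (polylog 3 1) / 9) * c 26)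
      + 0 * z
      + 0 / z
      + (- c 16) * a_fun z
      + (- c 5 + c 10) * Log z
      + (- c 8) * Log1m z
      + (- c 17 + c 18) * Log z ^ 2
      + (- (1 / 2) * c 21) * Log z * Log1m z
      + (- c 21 - c 23 - c 25) * Li 2 z
      + (- c 26) * Li 3 z
      + (c 26 - 2 * c 27) * Log z * Li 2 z
      + ((1 / 3) * c 26 - c 27) * Log z ^ 2 * Log1m z = 0" if "z \<in> Omega" for z
    using rel[OF that, of 6] that
    by (simp add: expand)
      (simp add: algebra_simps add_divide_distrib diff_divide_distrib power2_eq_square
          power3_eq_cube)
  note eqs6 = functions_independent[OF this]
  have "(k $ 7 + ipi * c 6 - c 7 - c 9 - (pi2 / 6) * c 21 - (pi2 / 6) * c 22
      - (4 * of_real (polylog 3 1) / 9) * c 26)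
      + c 9 * z
      + c 7 / z
      + 0 * a_fun z
      + (- c 6 - c 10 + c 12) * Log z
      + (c 8 - c 11 + c 13 + (2 * pi2 / 3) * c 26 - 2 * pi2 * c 27) * Log1m z
      + (- 2 * c 18) * Log z ^ 2
      + ((1 / 2) * c 21 + (1 / 2) * c 22 + (4 * ipi / 3) * c 26 - 4 * ipi * c 27) * Log z * Log1m z
      + (c 21 + c 22 + c 23 + c 24 + 2 * c 25 + 2 * ipi * c 26 - 4 * ipi * c 27) * Li 2 z
      + 2 * c 26 * Li 3 z
      + (- 2 * c 26 + 4 * c 27) * Log z * Li 2 z
      + (- (2 / 3) * c 26 + 2 * c 27) * Log z ^ 2 * Log1m z = 0" if "z \<in> Omega" for z
    using rel[OF that, of 7] that
    by (simp add: expand)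
      (simp add: algebra_simps add_divide_distrib diff_divide_distrib power2_eq_square
          power3_eq_cube)
  note eqs7 = functions_independent[OF this]
  have "(k $ 8 - c 14 - c 15 + (pi2 / 6) * c 21 - (pi2 / 6) * c 22
      - (4 * of_real (polylog 3 1) / 9) * c 26)
      + c 14 * z
      + c 15 / z
      + 0 * a_fun z
      + (c 10 + c 12 + (ipi / 2) * c 22 + ipi * c 23) * Log z
      + (c 11 - ipi * c 22 + (2 * pi2 / 3) * c 26 - 2 * pi2 * c 27) * Log1m z
      + (- 2 * c 18 - (1 / 2) * c 23) * Log z ^ 2
      + (- (1 / 2) * c 21 + (1 / 2) * c 22 + (4 * ipi / 3) * c 26 - 4 * ipi * c 27) * Log z *
          Log1m z
      + (- c 21 + c 22 - c 23 + c 24 + 2 * ipi * c 26 - 4 * ipi * c 27) * Li 2 z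
      + 2 * c 26 * Li 3 z
      + (- 2 * c 26 + 4 * c 27) * Log z * Li 2 z
      + (- (2 / 3) * c 26 + 2 * c 27) * Log z ^ 2 * Log1m z = 0" if "z \<in> Omega" for z
    using rel[OF that, of 8] that
    by (simp add: expand)
      (simp add: algebra_simps add_divide_distrib diff_divide_distrib power2_eq_square
          power3_eq_cube)
  note eqs8 = functions_independent[OF this]
  have "(k $ 9 - 2 * ipi * c 12 - 4 * pi2 * c 18 + (pi2 / 6) * c 22 + (pi2 / 3) * c 23
      + (2 * of_real (polylog 3 1) / 9) * c 26)
      + 0 * z
      + 0 / z
      + (- c 16) * a_fun z
      + (- c 12 + 4 * ipi * c 18) * Log z
      + (- c 13) * Log1m z
      + (c 18 + c 19) * Log z ^ 2
      + (- (1 / 2) * c 22) * Log z * Log1m z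
      + (- c 22 - c 24 - c 25) * Li 2 z
      + (- c 26) * Li 3 z
      + (c 26 - 2 * c 27) * Log z * Li 2 z
      + ((1 / 3) * c 26 - c 27) * Log z ^ 2 * Log1m z = 0" if "z \<in> Omega" for z
    using rel[OF that, of 9] that
    by (simp add: expand)
      (simp add: algebra_simps add_divide_distrib diff_divide_distrib power2_eq_square
          power3_eq_cube)
  note eqs9 = functions_independent[OF this]
  have z0: "c 15 = 0" "c 7 = 0" "c 17 = 0" "c 26 = 0"
    using eqs1 by simp_all
  have z0': "c 27 = 0"
    using eqs1 by (simp add: z0)
  have z1: "c 9 = 0" "c 14 = 0" "c 2 = 0" "c 24 = 0"
    using eqs2 by (auto simp: z0 z0')
  have z2: "c 16 = 0" "c 19 = 0" "c 20 = 0" "c 25 = 0"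
    using eqs3 by (auto simp: z0 z0' z1)
  have z3: "c (Suc 0) = 0" "c 23 = 0" "c 22 = 0"
    using eqs4 by (auto simp: z0 z0' z1 z2)
  have z4: "c 3 = 0"
    using eqs5 by (auto simp: z0 z0' z1 z2 z3)
  have z5: "c 8 = 0" "c 18 = 0" "c 21 = 0"
    using eqs6 by (auto simp: z0 z0' z1 z2 z3 z4)
  have z6: "c 11 = 0"
    using eqs8 by (auto simp: z0 z0' z1 z2 z3 z4 z5)
  have z7: "c 12 = 0" "c 13 = 0"
    using eqs9 by (auto simp: z0 z0' z1 z2 z3 z4 z5 z6)
  have z8: "c 4 = 0"
    using eqs1 by (auto simp: z0 z0' z1 z2 z3 z4 z5 z6 z7)
  have z9: "c 0 = 0"
    using eqs3 by (auto simp: z0 z0' z1 z2 z3 z4 z5 z6 z7 z8)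
  have z10: "c 6 = 0"
    using eqs4 by (auto simp: z0 z0' z1 z2 z3 z4 z5 z6 z7 z8 z9)
  have z11: "c 10 = 0"
    using eqs7 by (auto simp: z0 z0' z1 z2 z3 z4 z5 z6 z7 z8 z9 z10)
  have z12: "c 5 = 0"
    using eqs1 by (auto simp: z0 z0' z1 z2 z3 z4 z5 z6 z7 z8 z9 z10 z11)
  note zeros = z0 z0' z1 z2 z3 z4 z5 z6 z7 z8 z9 z10 z11 z12
  have "c j = 0" if "j < 28" for j
  proof -
    have "j
        \<in> {0, Suc 0, 2, 3, 4, 5, 6, 7, 8, 9, 10, 11, 12, 13, 14, 15, 16, 17, 18, 19, 20, 21, 22, 23, 24, 25, 26, 27}"
      using that by (simp only: insert_iff empty_iff) presburger
    then show ?thesis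
      using zeros by blast
  qed
  moreover have "k $ 1 = 0" "k $ 2 = 0" "k $ 3 = 0" "k $ 4 = 0" "k $ 5 = 0" "k $ 6 = 0" "k $ 7
      = 0" "k $ 8 = 0" "k $ 9 = 0"
    using eqs1[THEN conjunct1] eqs2[THEN conjunct1] eqs3[THEN conjunct1] eqs4[THEN conjunct1]
        eqs5[THEN conjunct1] eqs6[THEN conjunct1] eqs7[THEN conjunct1] eqs8[THEN conjunct1]
        eqs9[THEN conjunct1] by (simp_all add: zeros)
  then have "k $ i = 0" for i
    by (rule index_9_cases[where P = "\<lambda>i. k $ i = 0"])
  ultimately show ?thesis
    by (simp add: vec_eq_iff)
qed

section \<open>Bol's bound on the space of relations\<close>

text \<open>Comparing coefficients of powers of \<open>m\<close> gives the first \<open>k + 1\<close> moments \<open>(\<Sum>i\<in>I. c i * \<sigma> i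
  ^ n) = 0\<close>. A polynomial of degree at most \<open>k\<close> that vanishes at all \<open>\<sigma> i\<close> except \<open>\<sigma> j\<close> then
  isolates \<open>c j\<close>.\<close>

lemma powers_of_linear_forms_independent:
  fixes c \<sigma> :: "'i \<Rightarrow> complex"
  assumes fin: "finite I" and inj: "inj_on \<sigma> I" and card: "card I \<le> Suc k"
    and rel: "\<And>m. (\<Sum>i\<in>I. c i * (1 + \<sigma> i * m) ^ k) = 0" and j: "j \<in> I"
  shows "c j = 0"
proof -
  have moments: "(\<Sum>i\<in>I. c i * \<sigma> i ^ n) = 0" if "n \<le> k" for n
  proof -
    have "(\<Sum>n\<le>k. (of_nat (k choose n) * (\<Sum>i\<in>I. c i * \<sigma> i ^ n)) * m ^ n) = 0" for m
    proof -
      have "(\<Sum>n\<le>k. (of_nat (k choose n) * (\<Sum>i\<in>I. c i * \<sigma> i ^ n)) * m ^ n)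
          = (\<Sum>n\<le>k. \<Sum>i\<in>I. c i * (of_nat (k choose n) * (\<sigma> i * m) ^ n))"
        by (simp add: sum_distrib_left sum_distrib_right power_mult_distrib mult_ac)
      also have "\<dots> = (\<Sum>i\<in>I. \<Sum>n\<le>k. c i * (of_nat (k choose n) * (\<sigma> i * m) ^ n))"
        by (rule sum.swap)
      also have "\<dots> = (\<Sum>i\<in>I. c i * (\<sigma> i * m + 1) ^ k)"
        by (simp add: binomial_ring sum_distrib_left)
      finally show ?thesis
        using rel[of m] by (simp add: add.commute)
    qed
    from zero_polynom_imp_zero_coeffs[OF this that] show ?thesis
      using that by simp
  qed
  define p where "p = (\<Prod>i\<in>I - {j}. [:- \<sigma> i, 1:])"
  have "degree p \<le> (\<Sum>i\<in>I - {j}. degree [:- \<sigma> i, 1:])"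
    unfolding p_def using degree_prod_sum_le[of "I - {j}" "\<lambda>i. [:- \<sigma> i, 1:]"] fin by
        (simp add: o_def)
  then have deg: "degree p \<le> k"
    using card j fin by simp
  have "(\<Sum>i\<in>I. c i * poly p (\<sigma> i)) = (\<Sum>i\<in>I. \<Sum>n\<le>degree p. c i * (coeff p n * \<sigma> i ^ n))"
    by (simp add: poly_altdef sum_distrib_left)
  also have "\<dots> = (\<Sum>n\<le>degree p. \<Sum>i\<in>I. c i * (coeff p n * \<sigma> i ^ n))"
    by (rule sum.swap)
  also have "\<dots> = (\<Sum>n\<le>degree p. coeff p n * (\<Sum>i\<in>I. c i * \<sigma> i ^ n))"
    by (simp add: sum_distrib_left mult_ac)
  also have "\<dots> = 0"
    using deg by (intro sum.neutral) (auto simp: moments)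
  finally have "(\<Sum>i\<in>I. c i * poly p (\<sigma> i)) = 0" .
  moreover have "c i * poly p (\<sigma> i) = 0" if "i \<in> I - {j}" for i
    using that fin by (auto simp: p_def poly_prod intro!: prod_zero)
  ultimately have "c j * poly p (\<sigma> j) = 0"
    using sum.remove[OF fin j, of "\<lambda>i. c i * poly p (\<sigma> i)"] by (simp add: sum.neutral)
  moreover have "poly p (\<sigma> j) \<noteq> 0"
    using fin inj j by (auto simp: p_def poly_prod inj_on_def)
  ultimately show ?thesis
    by simp
qed

lift_definition taylor :: "germs \<Rightarrow> 9 \<Rightarrow> nat \<Rightarrow> complex" is
  "\<lambda>F i k. (deriv ^^ k) (\<lambda>z. F z $ i) (U omega0 $ i) / fact k"
  by (intro ext arg_cong2[where f = "(/)"] higher_deriv_cong_ev) (auto simp: same_germs_def)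

lemma taylor_add: "taylor (G + H) i k = taylor G i k + taylor H i k"
  by transfer (simp add: same_germs_def higher_deriv_add_at add_divide_distrib)

lemma taylor_scale: "taylor (scale_germs c G) i k = c * taylor G i k"
  by transfer (simp add: same_germs_def higher_deriv_cmult')

lemma taylor_eq_0_imp_eq_0:
  assumes "\<And>i k. taylor G i k = 0"
  shows "G = 0"
  using assms
proof (transfer, unfold same_germs_def, intro allI conjI)
  fix F :: "complex \<Rightarrow> complex ^ 9" and i
  assume F: "\<forall>i. (\<lambda>z. F z $ i) analytic_on {U omega0 $ i} \<and> (\<lambda>z. F z $ i) analytic_on {U omega0 $ i}
      \<and> (\<forall>\<^sub>F z in nhds (U omega0 $ i). F z $ i = F z $ i)"
    and 0: "\<And>i k. (deriv ^^ k) (\<lambda>z. F z $ i) (U omega0 $ i) / fact k = 0"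
  show "(\<lambda>z. F z $ i) analytic_on {U omega0 $ i}" "(\<lambda>z. 0 $ i) analytic_on {U omega0 $ i}"
    using F by simp_all
  obtain e where e: "e > 0" "(\<lambda>z. F z $ i) holomorphic_on ball (U omega0 $ i) e"
    using F by (auto simp: analytic_on_def)
  have "F z $ i = 0 $ i" if "z \<in> ball (U omega0 $ i) e" for z
    using holomorphic_fun_eq_0_on_ball[OF e(2) that] 0 by simp
  then show "\<forall>\<^sub>F z in nhds (U omega0 $ i). F z $ i = 0 $ i"
    using eventually_nhds_in_open[of "ball (U omega0 $ i) e" "U omega0 $ i"] e(1)
    by (auto elim: eventually_mono)
qed

text \<open>The quotient of \<open>f\<close> by \<open>h ^ k\<close>, extended continuously to \<open>h = 0\<close>. Having it as a function
  of \<open>h\<close> on a full neighbourhood is convenient because the increments of \<open>U i\<close> along a line,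
  substituted for \<open>h\<close>, may vanish.\<close>

lemma analytic_leading_term:
  assumes f: "f analytic_on {p}" and 0: "\<And>j. j < k \<Longrightarrow> (deriv ^^ j) f p / fact j = (0 :: complex)"
  obtains K where "isCont K 0" "K 0 = (deriv ^^ k) f p / fact k" "\<forall>\<^sub>F h in nhds 0. f (p + h)
      = h ^ k * K h"
proof -
  define E where "E = fps_expansion f p"
  have E: "(\<lambda>h. f (p + h)) has_fps_expansion E"
    unfolding E_def by (rule analytic_at_imp_has_fps_expansion[OF f])
  have nth: "fps_nth E n = (deriv ^^ n) f p / fact n" for n
    by (simp add: E_def fps_expansion_def)
  show ?thesis
  proof (cases "E = 0")
    case True
    have "\<forall>\<^sub>F h in nhds 0. f (p + h) = 0"
      using E True by (auto simp: has_fps_expansion_def elim: eventually_mono)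
    then show ?thesis
      using nth[of k] True by (intro that[of "\<lambda>_. 0"]) auto
  next
    case False
    define K where "K = (\<lambda>h. if h = 0 then fps_nth E k else f (p + h) / h ^ k)"
    have "k \<le> subdegree E"
      using False 0 nth by (intro subdegree_geI) auto
    then have "K has_fps_expansion fps_shift k E"
      unfolding K_def by (intro has_fps_expansion_shift E refl)
    then have "isCont K 0"
      by (rule has_fps_expansion_imp_continuous)
    moreover have "f (p + h) = h ^ k * K h" for h
      using nth[of 0] 0[of 0] by (cases "k = 0") (auto simp: K_def nth)
    ultimately show ?thesis
      by (intro that[of K]) (auto simp: K_def nth)
  qed
qed

text \<open>Along the line \<open>t \<mapsto> omega0 + t * (1/3, 3/2 + m/2)\<close>, the logarithmic derivative of \<open>U i\<close> at
  \<open>t = 0\<close> is \<open>log_grad $ i + log_grad' $ i * m\<close>. The direction for \<open>m = 0\<close> is chosen such that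
  none of the nine derivatives vanishes; the quotients of the two vectors are then the nine
  slopes of the web.\<close>

definition log_grad :: "complex ^ 9" where
  "log_grad = vector [1, 3, -2, -5/2, -9/2, 4, -3/2, -11/2, -7]"

definition log_grad' :: "complex ^ 9" where
  "log_grad' = vector [0, 1, -1, -1, -2, 1, -1, -2, -3]"

lemma DERIV_U_line:
  "((\<lambda>t. U (1/3 + t/3, 1/2 + t * (3/2 + m/2)) $ i) has_field_derivative
     U omega0 $ i * (log_grad $ i + log_grad' $ i * m)) (at 0)" (is "?P i")
  by (rule index_9_cases[where P = ?P]; simp only: U_def omega0_def log_grad_def log_grad'_def
      vector_9 case_prod_conv;
      (rule DERIV_cong, (rule derivative_intros | simp)+, (simp add: field_simps
          power2_eq_square)?))

text \<open>If all entries vanish to order \<open>k\<close>, the relation along a line is divided by \<open>t ^ k\<close>, and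
  \<open>t\<close> tends to 0.\<close>

lemma leading_terms_relation_functions:
  fixes F :: "complex \<Rightarrow> complex ^ 9"
  assumes F: "same_germs F F"
    and rel: "\<forall>\<^sub>F w in nhds omega0. (\<Sum>i\<in>UNIV. F (U w $ i) $ i) = 0"
    and 0: "\<And>i j. j < k \<Longrightarrow> (deriv ^^ j) (\<lambda>z. F z $ i) (U omega0 $ i) / fact j = 0"
  shows "(\<Sum>i\<in>UNIV. (deriv ^^ k) (\<lambda>z. F z $ i) (U omega0 $ i) / fact k
      * (U omega0 $ i * (log_grad $ i + log_grad' $ i * m)) ^ k) = 0"
proof -
  have "\<exists>K. isCont K 0 \<and> K 0 = (deriv ^^ k) (\<lambda>z. F z $ i) (U omega0 $ i) / fact k
      \<and> (\<forall>\<^sub>F h in nhds 0. F (U omega0 $ i + h) $ i = h ^ k * K h)" for i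
  proof -
    have "(\<lambda>z. F z $ i) analytic_on {U omega0 $ i}"
      using F by (simp add: same_germs_def)
    from analytic_leading_term[OF this 0] obtain K where "isCont K 0"
      "K 0 = (deriv ^^ k) (\<lambda>z. F z $ i) (U omega0 $ i) / fact k"
      "\<forall>\<^sub>F h in nhds 0. F (U omega0 $ i + h) $ i = h ^ k * K h"
      by blast
    then show ?thesis
      by blast
  qed
  then have "\<exists>K. \<forall>i. isCont (K i) 0 \<and> K i 0 = (deriv ^^ k) (\<lambda>z. F z $ i) (U omega0 $ i) / fact k
      \<and> (\<forall>\<^sub>F h in nhds 0. F (U omega0 $ i + h) $ i = h ^ k * K i h)"
    by (intro choice allI)
  then obtain K where K: "\<And>i. isCont (K i) 0" "\<And>i. K i 0
      = (deriv ^^ k) (\<lambda>z. F z $ i) (U omega0 $ i) / fact k"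
     "\<And>i. \<forall>\<^sub>F h in nhds 0. F (U omega0 $ i + h) $ i = h ^ k * K i h"
    by blast
  define w where "w = (\<lambda>t::complex. (1/3 + t/3, 1/2 + t * (3/2 + m/2)))"
  have w0: "w 0 = omega0"
    by (simp add: w_def omega0_def)
  have "isCont w 0"
    unfolding w_def by (intro continuous_intros) simp_all
  then have w: "filterlim w (nhds omega0) (at 0)"
    by (simp add: isCont_def w0)
  define D where "D = (\<lambda>i. U omega0 $ i * (log_grad $ i + log_grad' $ i * m))"
  have dU: "((\<lambda>t. U (w t) $ i) has_field_derivative D i) (at 0)" for i
    unfolding w_def D_def by (rule DERIV_U_line)
  define d where "d = (\<lambda>i t. U (w t) $ i - U omega0 $ i)"
  have d: "((\<lambda>t. d i t / t) \<longlongrightarrow> D i) (at 0)" for i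
    using dU[of i] by (simp add: has_field_derivative_iff d_def w0)
  have d0: "filterlim (d i) (nhds 0) (at 0)" for i
  proof -
    have "isCont (\<lambda>t. U (w t) $ i) 0"
      using dU DERIV_isCont by blast
    then have "((\<lambda>t. U (w t) $ i) \<longlongrightarrow> U omega0 $ i) (at 0)"
      by (simp add: isCont_def w0)
    then show ?thesis
      unfolding d_def by (simp add: LIM_zero_iff)
  qed
  have "((\<lambda>t. \<Sum>i\<in>UNIV. (d i t / t) ^ k * K i (d i t)) \<longlongrightarrow> (\<Sum>i\<in>UNIV. D i ^ k * K i 0)) (at 0)"
    by (intro tendsto_intros d isCont_tendsto_compose[OF K(1) d0])
  moreover have "\<forall>\<^sub>F t in at 0. (\<Sum>i\<in>UNIV. (d i t / t) ^ k * K i (d i t)) = 0"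
  proof -
    have "\<forall>\<^sub>F t in at 0. F (U omega0 $ i + d i t) $ i = d i t ^ k * K i (d i t)" for i
      by (rule eventually_compose_filterlim[OF K(3) d0])
    then have "\<forall>\<^sub>F t in at 0. \<forall>i. F (U (w t) $ i) $ i = d i t ^ k * K i (d i t)"
      by (simp add: eventually_all_finite d_def)
    moreover have "\<forall>\<^sub>F t in at 0. (\<Sum>i\<in>UNIV. F (U (w t) $ i) $ i) = 0"
      by (rule eventually_compose_filterlim[OF rel w])
    ultimately show ?thesis
    proof eventually_elim
      case (elim t)
      have "(\<Sum>i\<in>UNIV. (d i t / t) ^ k * K i (d i t)) = (\<Sum>i\<in>UNIV. d i t ^ k * K i (d i t)) / t ^ k"
        by (simp add: sum_divide_distrib power_divide)
      then show ?case
        using elim by simp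
    qed
  qed
  then have "((\<lambda>t. \<Sum>i\<in>UNIV. (d i t / t) ^ k * K i (d i t)) \<longlongrightarrow> 0) (at 0)"
    by (rule tendsto_eventually)
  ultimately have "(\<Sum>i\<in>UNIV. D i ^ k * K i 0) = 0"
    by (rule tendsto_unique[rotated]) simp
  then show ?thesis
    by (simp add: K(2) D_def mult.commute)
qed

lemma leading_terms_relation:
  assumes "G \<in> S" and "\<And>i j. j < k \<Longrightarrow> taylor G i j = 0"
  shows "(\<Sum>i\<in>UNIV. taylor G i k * (U omega0 $ i * (log_grad $ i + log_grad' $ i * m)) ^ k) = 0"
  using assms unfolding S_def mem_Collect_eq
  by transfer (rule leading_terms_relation_functions)

definition first_eight :: "9 list" where
  "first_eight = [1, 2, 3, 4, 5, 6, 7, 8]"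

text \<open>The pairs of an order \<open>k < 8\<close> and one of the first \<open>8 - k\<close> indices. The order 0
  contributes 8 pairs since the constant terms only have to add up to zero.\<close>

definition free_jets :: "(nat \<times> 9) set" where
  "free_jets = (SIGMA k:{..<8}. set (take (8 - k) first_eight))"

lemma distinct_first_eight: "distinct first_eight"
  by (simp add: first_eight_def)

lemma card_free_jets: "card free_jets = 36"
proof -
  have "card (set (take (8 - k) first_eight)) = 8 - k" for k
    using distinct_card[OF distinct_take[OF distinct_first_eight]] by (simp add: first_eight_def)
  then show ?thesis
    by (simp add: free_jets_def card_SigmaI lessThan_nat_numeral lessThan_Suc)
qed

text \<open>By induction on the order \<open>k\<close>, at most \<open>k + 1\<close> coefficients of order \<open>k\<close> can be non-zero,
  and their relation involves as many independent \<open>k\<close>-th powers; for \<open>k \<ge> 8\<close> all nine powers are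
  independent.\<close>

lemma free_jets_determine:
  assumes G: "G \<in> S" and 0: "\<And>k i. (k, i) \<in> free_jets \<Longrightarrow> taylor G i k = 0"
  shows "G = 0"
proof (rule taylor_eq_0_imp_eq_0)
  fix i k
  show "taylor G i k = 0"
  proof (induction k arbitrary: i rule: less_induct)
    case (less k)
    define I where "I = {i. taylor G i k \<noteq> 0}"
    define \<sigma> where "\<sigma> = (\<lambda>i. log_grad' $ i / log_grad $ i)"
    have nz: "U omega0 $ i \<noteq> 0" "log_grad $ i \<noteq> 0" for i
      by (rule index_9_cases[where i = i], simp_all add: U_def omega0_def log_grad_def vector_9)+
    have v: "\<sigma> 1 = 0" "\<sigma> 2 = 1/3" "\<sigma> 3 = 1/2" "\<sigma> 4 = 2/5" "\<sigma> 5 = 4/9" "\<sigma> 6 = 1/4"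
      "\<sigma> 7 = 2/3" "\<sigma> 8 = 4/11" "\<sigma> 9 = 3/7"
      unfolding \<sigma>_def log_grad_def log_grad'_def vector_9 by simp_all
    have "inj \<sigma>"
      unfolding UNIV_9 inj_on_insert by (simp add: v)
    have "I \<subseteq> UNIV - set (take (8 - k) first_eight)"
      using 0 by (cases "k < 8") (auto simp: I_def free_jets_def)
    then have "card I \<le> card (UNIV - set (take (8 - k) first_eight))"
      by (intro card_mono) auto
    also have "\<dots> = 9 - (8 - k)"
      using distinct_card[OF distinct_take[OF distinct_first_eight, of "8 - k"]]
      by (subst card_Diff_subset) (auto simp: first_eight_def)
    finally have card: "card I \<le> Suc k"
      by simp
    show ?case
    proof (rule ccontr)
      assume i: "taylor G i k \<noteq> 0"
      have "taylor G i k * (U omega0 $ i * log_grad $ i) ^ k = 0"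
      proof (rule powers_of_linear_forms_independent[where I = I and \<sigma> = \<sigma>])
        fix m
        have "(\<Sum>i\<in>I. taylor G i k * (U omega0 $ i * log_grad $ i) ^ k * (1 + \<sigma> i * m) ^ k)
          = (\<Sum>i\<in>UNIV. taylor G i k * (U omega0 $ i * (log_grad $ i + log_grad' $ i * m)) ^ k)"
        proof (rule sum.mono_neutral_cong_left)
          fix i
          have "U omega0 $ i * (log_grad $ i + log_grad' $ i * m)
            = (U omega0 $ i * log_grad $ i) * (1 + \<sigma> i * m)"
            using nz(2)[of i] by (simp add: \<sigma>_def field_simps)
          then show "taylor G i k * (U omega0 $ i * log_grad $ i) ^ k * (1 + \<sigma> i * m) ^ k
            = taylor G i k * (U omega0 $ i * (log_grad $ i + log_grad' $ i * m)) ^ k"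
            by (simp only: power_mult_distrib mult.assoc)
        qed (auto simp: I_def)
        also have "\<dots> = 0"
          by (rule leading_terms_relation[OF G less])
        finally show "(\<Sum>i\<in>I. taylor G i k * (U omega0 $ i * log_grad $ i) ^ k * (1 + \<sigma> i * m) ^ k)
            = 0" .
      next
        show "inj_on \<sigma> I"
          using \<open>inj \<sigma>\<close> by (rule inj_on_subset) simp
      qed (use card i in \<open>simp_all add: I_def\<close>)
      then show False
        using nz i by simp
    qed
  qed
qed

text \<open>The 36 Taylor coefficients embed \<^term>\<open>S\<close> into a space of dimension 36, which is the span of
  the image of \<open>B\<close>.\<close>

lemma independent_36_spans_S:
  assumes B: "B \<subseteq> S" "germs.independent B" "card B = 36"
  shows "S \<subseteq> germs.span B"
proof
  have "finite free_jets"
    using card_free_jets card.infinite by fastforce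
  then obtain h where h: "bij_betw h (UNIV :: 36 set) free_jets"
    using finite_same_card_bij[of "UNIV :: 36 set" free_jets] card_free_jets by auto
  define \<phi> :: "germs \<Rightarrow> complex ^ 36" where
    "\<phi> = (\<lambda>G. \<chi> n. taylor G (snd (h n)) (fst (h n)))"
  interpret vector_space_pair scale_germs "(*s) :: complex \<Rightarrow> complex ^ 36 \<Rightarrow> complex ^ 36"
    by unfold_locales
  have lin: "Vector_Spaces.linear scale_germs (*s) \<phi>"
    by unfold_locales (simp_all add: \<phi>_def vec_eq_iff taylor_add taylor_scale)
  have \<phi>0: "G = 0" if "G \<in> S" "\<phi> G = 0" for G
  proof (rule free_jets_determine[OF that(1)])
    fix k i assume "(k, i) \<in> free_jets"
    then obtain n where n: "h n = (k, i)"
      using h by (metis bij_betw_imp_surj_on imageE)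
    then show "taylor G i k = 0"
      using arg_cong[OF that(2), of "\<lambda>v. v $ n"] n by (simp add: \<phi>_def)
  qed
  have span: "germs.span B \<subseteq> S"
    by (rule germs.span_minimal[OF B(1) subspace_S])
  have "inj_on \<phi> S"
  proof (rule inj_onI)
    fix G H assume "G \<in> S" "H \<in> S" "\<phi> G = \<phi> H"
    then have "G - H = 0"
      by (intro \<phi>0 germs.subspace_diff[OF subspace_S]) (simp_all add: linear_diff[OF lin])
    then show "G = H"
      by simp
  qed
  then have inj: "inj_on \<phi> (germs.span B)"
    using span inj_on_subset by blast
  have "vec.independent (\<phi> ` B)"
    by (rule linear_independent_injective_image[OF lin B(2) inj])
  moreover have "card (\<phi> ` B) = 36"
    using B(3) card_image[OF inj_on_subset[OF inj germs.span_superset]] by simp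
  ultimately have "vec.span (\<phi> ` B) = UNIV"
    using vec.card_ge_dim_independent[of "\<phi> ` B" UNIV] unfolding vec_dim_card by auto
  fix G assume G: "G \<in> S"
  have "\<phi> G \<in> \<phi> ` germs.span B"
    using \<open>vec.span (\<phi> ` B) = UNIV\<close> linear_span_image[OF lin] by auto
  then show "G \<in> germs.span B"
    using \<open>inj_on \<phi> S\<close> G span by (auto dest: inj_onD)
qed

section \<open>Assembling the basis\<close>

lemma (in vector_space) list_independent:
  assumes 0: "\<And>c. (\<Sum>j<length vs. scale (c j) (vs ! j)) = 0 \<Longrightarrow> \<forall>j<length vs. c j = 0"
  shows "distinct vs" "independent (set vs)"
proof -
  show d: "distinct vs"
    unfolding distinct_conv_nth
  proof (intro allI impI notI)
    fix i j assume ij: "i < length vs" "j < length vs" "i \<noteq> j" "vs ! i = vs ! j"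
    define c where "c = (\<lambda>l. if l = i then 1 else if l = j then - 1 else 0 :: 'a)"
    have "(\<Sum>l<length vs. scale (c l) (vs ! l)) = (\<Sum>l\<in>{i, j}. scale (c l) (vs ! l))"
      using ij by (intro sum.mono_neutral_right) (auto simp: c_def)
    also have "\<dots> = 0"
      using ij by (simp add: c_def)
    finally have "c i = 0"
      using 0 ij by blast
    then show False
      by (simp add: c_def)
  qed
  show "independent (set vs)"
  proof (rule independent_if_scalars_zero)
    fix f x assume f: "(\<Sum>x\<in>set vs. scale (f x) x) = 0" and x: "x \<in> set vs"
    have "(\<Sum>j<length vs. scale (f (vs ! j)) (vs ! j)) = (\<Sum>x\<in>set vs. scale (f x) x)"
      by (rule sum.reindex_bij_betw[OF bij_betw_nth[OF d refl refl]])
    then show "f x = 0"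
      using 0[of "\<lambda>j. f (vs ! j)"] f x by (metis in_set_conv_nth)
  qed simp
qed

lemma (in vector_space) list_independentD:
  assumes "distinct vs" "independent (set vs)" and sum: "(\<Sum>j<length vs. scale (c j) (vs ! j)) = 0"
    and j: "j < length vs"
  shows "c j = 0"
proof -
  define f where "f = (\<lambda>x. c (the_inv_into {..<length vs} ((!) vs) x))"
  have bij: "bij_betw ((!) vs) {..<length vs} (set vs)"
    by (rule bij_betw_nth[OF assms(1) refl refl])
  have f: "f (vs ! i) = c i" if "i < length vs" for i
    using that bij by (simp add: f_def the_inv_into_f_f bij_betw_def)
  have "(\<Sum>x\<in>set vs. scale (f x) x) = (\<Sum>i<length vs. scale (f (vs ! i)) (vs ! i))"
    by (rule sum.reindex_bij_betw[OF bij, symmetric])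
  also have "\<dots> = 0"
    using sum f by simp
  finally have "f (vs ! j) = 0"
    using independentD[OF assms(2) finite_set subset_refl, of f "vs ! j"] j by simp
  then show ?thesis
    using f j by simp
qed

lemma same_germs_const: "same_germs (\<lambda>z. c) (\<lambda>z. c)"
  by (simp add: same_germs_refl_iff)

lemma germs_of_sum:
  fixes n :: nat
  assumes "\<And>j. j < n \<Longrightarrow> same_germs (H j) (H j)"
  shows "same_germs (\<lambda>z. \<Sum>j<n. c j *s H j z) (\<lambda>z. \<Sum>j<n. c j *s H j z)
    \<and> (\<Sum>j<n. scale_germs (c j) (germs_of (H j))) = germs_of (\<lambda>z. \<Sum>j<n. c j *s H j z)"
  using assms
proof (induction n)
  case 0
  show ?case
    by (simp add: same_germs_refl_iff zero_germs_def)
next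
  case (Suc n)
  have H: "same_germs (H n) (H n)"
    using Suc.prems by simp
  have sc: "same_germs (\<lambda>z. c n *s H n z) (\<lambda>z. c n *s H n z)"
    using H by (auto simp: same_germs_refl_iff intro!: analytic_on_mult)
  have IH: "same_germs (\<lambda>z. \<Sum>j<n. c j *s H j z) (\<lambda>z. \<Sum>j<n. c j *s H j z)"
    "(\<Sum>j<n. scale_germs (c j) (germs_of (H j))) = germs_of (\<lambda>z. \<Sum>j<n. c j *s H j z)"
    using Suc by auto
  show ?case
    using IH(1) sc by (simp add: IH(2) scale_germs.abs_eq[OF H] plus_germs.abs_eq[OF IH(1) sc])
      (auto simp: same_germs_refl_iff intro!: analytic_on_add)
qed

theorem mainTheorem1:
  fixes Cs :: "(complex ^ 9) list" and Gamma :: "germs list"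
  assumes "length Cs = 8" and "distinct Cs"
    and "vec.independent (set Cs)"
    and "vec.span (set Cs) = {c. (\<Sum>i\<in>UNIV. c $ i) = 0}"
    and "Gamma = map germs_of (map (\<lambda>c z. c) Cs @ Fs)"
  shows "distinct Gamma \<and> germs.independent (set Gamma) \<and> germs.span (set Gamma) = S
       \<and> germs.dim S = 36"
proof -
  define Hs where "Hs = map (\<lambda>c z. c) Cs @ Fs"
  have len: "length Fs = 28" "length Hs = 36" "length Gamma = 36"
    using assms(1,5) by (simp_all add: Fs_def Hs_def)
  have Hs: "same_germs (Hs ! j) (Hs ! j)" if "j < 36" for j
  proof -
    have "Hs ! j \<in> set Hs"
      using that len by simp
    then show ?thesis
      by (auto simp: Hs_def Fs_germs same_germs_const)
  qed
  have Gamma: "Gamma ! j = germs_of (Hs ! j)" if "j < 36" for j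
    using that len unfolding assms(5) Hs_def[symmetric] by (intro nth_map) simp
  have indep: "\<forall>j<36. c j = 0" if "(\<Sum>j<36. scale_germs (c j) (Gamma ! j)) = 0" for c
  proof -
    define K where "K = (\<Sum>j<8. c j *s Cs ! j)"
    define T where "T = (\<lambda>z. \<Sum>j<36. c j *s (Hs ! j) z)"
    have T_germ: "same_germs T T" "germs_of T = 0"
      using germs_of_sum[of 36 "(!) Hs" c] Hs that Gamma by (auto simp: T_def)
    have T_eq: "T z $ i = K $ i + (\<Sum>j<28. c (8 + j) * (Fs ! j) z $ i)" for z i
    proof -
      have split: "(\<Sum>j<m + n. f j) = (\<Sum>j<m. f j) + (\<Sum>j<n. f (m + j))" for f :: "nat
          \<Rightarrow> complex" and m n
        by (induction n) (simp_all add: add.assoc)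
      have "T z $ i = (\<Sum>j<8 + 28. c j * (Hs ! j) z $ i)"
        by (simp add: T_def)
      also have "\<dots> = (\<Sum>j<8. c j * (Hs ! j) z $ i) + (\<Sum>j<28. c (8 + j) * (Hs ! (8 + j)) z $ i)"
        by (rule split)
      also have "(\<Sum>j<8. c j * (Hs ! j) z $ i) = K $ i"
        using assms(1) by (simp add: K_def Hs_def nth_append)
      also have "(\<Sum>j<28. c (8 + j) * (Hs ! (8 + j)) z $ i) = (\<Sum>j<28. c (8 + j) * (Fs ! j) z $ i)"
        using assms(1) by (simp add: Hs_def nth_append)
      finally show ?thesis .
    qed
    have zero: "T z $ i = 0" if z: "z \<in> Omega" for z i
    proof -
      have "same_germs T (\<lambda>_. 0)"
        using Quotient3_rel[OF Quotient3_germs, of T "\<lambda>_. 0"] T_germ same_germs_const[of 0]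
        unfolding zero_germs_def by blast
      then have "\<forall>\<^sub>F z in nhds (U omega0 $ i). T z $ i = 0"
        by (simp add: same_germs_def)
      then obtain e where e: "e > 0" "\<And>z. dist z (U omega0 $ i) < e \<Longrightarrow> T z $ i = 0"
        by (auto simp: eventually_nhds_metric)
      have "(\<lambda>z. (Fs ! j) z $ i) holomorphic_on Omega" if "j < 28" for j
        using that len by (intro Fs_holomorphic) simp
      then have hol: "(\<lambda>z. T z $ i) holomorphic_on Omega"
        unfolding T_eq by (intro holomorphic_intros) auto
      show ?thesis
      proof (rule analytic_continuation_open[of "ball (U omega0 $ i) e \<inter> Omega" Omega
          "\<lambda>z. T z $ i" "\<lambda>_. 0"])
        have "U omega0 $ i \<in> ball (U omega0 $ i) e \<inter> Omega"
          using e(1) base_points_in_Omega by simp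
        then show "ball (U omega0 $ i) e \<inter> Omega \<noteq> {}"
          by blast
      qed (use e z hol connected_Omega open_Omega in \<open>auto simp: dist_commute\<close>)
    qed
    have 28: "(\<forall>j<28. c (8 + j) = 0) \<and> K = 0"
      by (rule Fs_independent_mod_constants) (simp only: zero flip: T_eq)
    have 8: "c j = 0" if "j < 8" for j
      using vec.list_independentD[OF assms(2,3), of c j] assms(1) that 28 by (simp add: K_def)
    show ?thesis
    proof (intro allI impI)
      fix j :: nat assume "j < 36"
      then show "c j = 0"
        using 8[of j] 28 le_add_diff_inverse[of 8 j] by (cases "j < 8") (auto dest: spec[of _ "j
            - 8"])
    qed
  qed
  from germs.list_independent[of Gamma] indep len
  have dist: "distinct Gamma" and ind: "germs.independent (set Gamma)"
    by auto
  have card: "card (set Gamma) = 36"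
    using distinct_card[OF dist] len by simp
  have "germs_of (\<lambda>z. c) \<in> S" if "c \<in> set Cs" for c
  proof -
    have "c \<in> vec.span (set Cs)"
      using that by (rule vec.span_base)
    then have "(\<Sum>i\<in>UNIV. c $ i) = 0"
      using assms(4) by simp
    then show ?thesis
      unfolding S_def mem_Collect_eq is_relation.abs_eq[OF same_germs_const] by simp
  qed
  then have sub: "set Gamma \<subseteq> S"
    using Fs_in_S by (auto simp: assms(5))
  have "germs.span (set Gamma) = S"
    using independent_36_spans_S[OF sub ind card] germs.span_minimal[OF sub subspace_S] by blast
  moreover have "germs.dim S = 36"
    using germs.dim_eq_card_independent[OF ind] card germs.dim_span[of "set Gamma"]
    unfolding calculation by simp
  ultimately show ?thesis
    using dist ind by blast
qed

end
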